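(* Let $d\ge1$, let $\widetilde{\mathcal O}=\Delta+2x\cdot\nabla$ on $\mathbb{R}^d$, and let $A=-\widetilde{\mathcal O}$, regarded as a positive self-adjoint operator on $L^2(\gamma_{-d})=L^2(\mathbb{R}^d,\pi^{d/2}e^{|x|^2}dx)$. The following operators are bounded on $L^2(\gamma_{-d})$. (a) Maximal semigroup operator: $\mathcal{M}f(x)=\sup_{t>0}|e^{-tA}f(x)|$. (b) Riesz transforms: $R_if(x)=\partial_{x_i}A^{-1/2}f(x)$ and $R_i^*f(x)=(\partial_{x_i}+2x_i)A^{-1/2}f(x)$, for $i=1,\dots,d$. (c) Littlewood--Paley square function: $Gf(x)=\Big(\int_0^\infty|t\,\partial_te^{-tA}f(x)|^2\,\frac{dt}{t}\Big)^{1/2}$.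
   Context: The self-adjoint realization of $A=-\widetilde{\mathcal O}$ is the one diagonalized by the orthogonal basis $e^{-|x|^2}\prod_{j=1}^dH_{k_j}(x_j)$, $k=(k_1,\dots,k_d)\in\mathbb{N}_0^d$, of $L^2(\gamma_{-d})$, with corresponding eigenvalues $2(k_1+\dots+k_d)+2d$, where $H_n(s)=(-1)^ne^{s^2}\frac{d^n}{ds^n}e^{-s^2}$ are the classical Hermite polynomials; $e^{-tA}$ and $A^{-1/2}$ are defined spectrally. A (possibly sublinear) operator $T$ is bounded on $L^2(\gamma_{-d})$ if there is a constant $C$ with $\|Tf\|_{L^2(\gamma_{-d})}\le C\|f\|_{L^2(\gamma_{-d})}$ for all $f\in L^2(\gamma_{-d})$. For $t>0$, $e^{-tA}f$ is taken to be the continuous version in $(t,x)$. *)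

theory Defs
  imports "HOL-Analysis.Analysis"
begin

section \<open>The inverse Gaussian measure and its \<open>L\<^sup>2\<close> space\<close>

definition inv_gauss :: "(real ^ 'n) measure" where
  "inv_gauss = density lborel
     (\<lambda>x. ennreal (pi powr (real CARD('n) / 2) * exp ((norm x)\<^sup>2)))"

definition ennsqrt :: "ennreal \<Rightarrow> ennreal" where
  "ennsqrt y = (if y = \<infinity> then \<infinity> else ennreal (sqrt (enn2real y)))"

text \<open>
  The norm is defined on functions with values in \<open>[0,\<infinity>]\<close>, because the maximal and square
  functions are a priori allowed to be infinite; a complex-valued function enters through its
  modulus. For non-measurable functions \<^term>\<open>nn_integral\<close> is only a lower integral, so
  measurability is demanded separately wherever the norm is used.
\<close>

definition L2_norm :: "(real ^ 'n \<Rightarrow> ennreal) \<Rightarrow> ennreal" where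
  "L2_norm g = ennsqrt (\<integral>\<^sup>+x. (g x)\<^sup>2 \<partial>inv_gauss)"

abbreviation modulus :: "('a \<Rightarrow> complex) \<Rightarrow> 'a \<Rightarrow> ennreal" where
  "modulus f \<equiv> (\<lambda>x. ennreal (cmod (f x)))"

definition L2 :: "(real ^ 'n \<Rightarrow> complex) set" where
  "L2 = {f \<in> borel_measurable borel. L2_norm (modulus f) < \<infinity>}"

text \<open>
  Elements of \<open>L\<^sup>2\<close> are represented by functions rather than by classes, so an operator is a
  relation: \<open>T f g\<close> says that \<open>g\<close> is the modulus of a representative of the value of
  the operator at \<open>f\<close>. For the operators below such a \<open>g\<close> is unique up to null sets.
  That the operator is defined on all of \<open>L\<^sup>2\<close> is part of the assertion.
\<close>

definition L2_bounded ::
  "((real ^ 'n \<Rightarrow> complex) \<Rightarrow> (real ^ 'n \<Rightarrow> ennreal) \<Rightarrow> bool) \<Rightarrow> bool" where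
  "L2_bounded T \<longleftrightarrow> (\<exists>C::real. C \<ge> 0 \<and> (\<forall>f\<in>L2. \<exists>g. T f g \<and> g \<in> borel_measurable borel \<and>
     L2_norm g \<le> ennreal C * L2_norm (modulus f)))"


section \<open>The operator and its eigenfunctions\<close>

definition pdv :: "'n \<Rightarrow> (real ^ 'n \<Rightarrow> 'b::real_normed_vector) \<Rightarrow> real ^ 'n \<Rightarrow> 'b" where
  "pdv i u x = vector_derivative (\<lambda>s. u (x + s *\<^sub>R axis i 1)) (at 0)"

definition Otilde :: "(real ^ 'n \<Rightarrow> real) \<Rightarrow> real ^ 'n \<Rightarrow> real" where
  "Otilde u x = (\<Sum>i\<in>UNIV. pdv i (pdv i u) x) + 2 * (\<Sum>i\<in>UNIV. x $ i * pdv i u x)"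

definition hermite :: "nat \<Rightarrow> real \<Rightarrow> real" where
  "hermite n s = (-1) ^ n * exp (s\<^sup>2) * (deriv ^^ n) (\<lambda>r. exp (- r\<^sup>2)) s"

definition eigenfun :: "('n::finite \<Rightarrow> nat) \<Rightarrow> real ^ 'n \<Rightarrow> real" where
  "eigenfun k x = exp (- (norm x)\<^sup>2) * (\<Prod>j\<in>UNIV. hermite (k j) (x $ j))"

definition eigenval :: "('n::finite \<Rightarrow> nat) \<Rightarrow> real" where
  "eigenval k = 2 * real (\<Sum>j\<in>UNIV. k j) + 2 * real CARD('n)"

definition coefficient :: "('n::finite \<Rightarrow> nat) \<Rightarrow> (real ^ 'n \<Rightarrow> complex) \<Rightarrow> complex" where
  "coefficient k f = (LINT x|inv_gauss. f x * of_real (eigenfun k x)) /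
     of_real (LINT x|inv_gauss. (eigenfun k x)\<^sup>2)"

text \<open>
  Spectral calculus for the self-adjoint realization \<open>A\<close> of \<open>- Otilde\<close> diagonalized by
  \<^const>\<open>eigenfun\<close>: \<open>spectral \<phi> f g\<close> says that \<open>g\<close> represents \<open>\<phi>(A) f\<close>, the sum
  of the expansion being taken in \<open>L\<^sup>2\<close>. In particular \<open>A\<close> itself is \<open>spectral (\<lambda>l. l)\<close>.
\<close>

definition spectral ::
  "(real \<Rightarrow> real) \<Rightarrow> (real ^ 'n \<Rightarrow> complex) \<Rightarrow> (real ^ 'n \<Rightarrow> complex) \<Rightarrow> bool" where
  "spectral \<phi> f g \<longleftrightarrow> g \<in> L2 \<and>
     ((\<lambda>K. L2_norm (modulus (\<lambda>x. g x -
         (\<Sum>k\<in>K. of_real (\<phi> (eigenval k)) * coefficient k f * of_real (eigenfun k x)))))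
       \<longlongrightarrow> 0) (finite_subsets_at_top UNIV)"

text \<open>\<open>u\<close> is the version of \<open>(t, x) \<mapsto> e\<^sup>-\<^sup>t\<^sup>A f(x)\<close> that is continuous for \<open>t > 0\<close>;
  the values of \<open>u\<close> for \<open>t \<le> 0\<close> are irrelevant.\<close>

definition semigroup_version ::
  "(real ^ 'n \<Rightarrow> complex) \<Rightarrow> (real \<Rightarrow> real ^ 'n \<Rightarrow> complex) \<Rightarrow> bool" where
  "semigroup_version f u \<longleftrightarrow>
     (\<forall>t>0. spectral (\<lambda>l. exp (- t * l)) f (u t)) \<and>
     continuous_on ({0<..} \<times> UNIV) (\<lambda>(t, x). u t x)"


section \<open>Weak derivatives\<close>

primrec C_k :: "nat \<Rightarrow> (real ^ 'n \<Rightarrow> real) \<Rightarrow> bool" where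
  "C_k 0 p \<longleftrightarrow> continuous_on UNIV p"
| "C_k (Suc m) p \<longleftrightarrow> (\<forall>x. p differentiable (at x)) \<and> (\<forall>i. C_k m (pdv i p))"

definition test_function :: "(real ^ 'n \<Rightarrow> real) \<Rightarrow> bool" where
  "test_function p \<longleftrightarrow> (\<forall>m. C_k m p) \<and> (\<exists>K. compact K \<and> (\<forall>x. x \<notin> K \<longrightarrow> p x = 0))"

definition loc_integrable :: "(real ^ 'n \<Rightarrow> complex) \<Rightarrow> bool" where
  "loc_integrable f \<longleftrightarrow> f \<in> borel_measurable borel \<and>
     (\<forall>K. compact K \<longrightarrow> set_integrable lborel K f)"

definition weak_pdv ::
  "'n \<Rightarrow> (real ^ 'n \<Rightarrow> complex) \<Rightarrow> (real ^ 'n \<Rightarrow> complex) \<Rightarrow> bool" where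
  "weak_pdv i F D \<longleftrightarrow> loc_integrable F \<and> loc_integrable D \<and>
     (\<forall>p. test_function p \<longrightarrow>
        (LINT x|lborel. F x * of_real (pdv i p x)) = - (LINT x|lborel. D x * of_real (p x)))"


section \<open>The operators\<close>

definition maximal_op :: "(real ^ 'n \<Rightarrow> complex) \<Rightarrow> (real ^ 'n \<Rightarrow> ennreal) \<Rightarrow> bool" where
  "maximal_op f g \<longleftrightarrow> (\<exists>u. semigroup_version f u \<and>
     g = (\<lambda>x. SUP t\<in>{0<..}. ennreal (cmod (u t x))))"

definition riesz :: "'n \<Rightarrow> (real ^ 'n \<Rightarrow> complex) \<Rightarrow> (real ^ 'n \<Rightarrow> ennreal) \<Rightarrow> bool" where
  "riesz i f g \<longleftrightarrow> (\<exists>F D. spectral (\<lambda>l. l powr (- 1 / 2)) f F \<and> weak_pdv i F D \<and>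
     g = modulus D)"

definition riesz_adj :: "'n \<Rightarrow> (real ^ 'n \<Rightarrow> complex) \<Rightarrow> (real ^ 'n \<Rightarrow> ennreal) \<Rightarrow> bool" where
  "riesz_adj i f g \<longleftrightarrow> (\<exists>F D. spectral (\<lambda>l. l powr (- 1 / 2)) f F \<and> weak_pdv i F D \<and>
     g = modulus (\<lambda>x. D x + of_real (2 * x $ i) * F x))"

definition square_function :: "(real ^ 'n \<Rightarrow> complex) \<Rightarrow> (real ^ 'n \<Rightarrow> ennreal) \<Rightarrow> bool" where
  "square_function f g \<longleftrightarrow> (\<exists>u v. semigroup_version f u \<and>
     (\<forall>t>0. \<forall>x. ((\<lambda>s. u s x) has_vector_derivative v t x) (at t)) \<and>
     g = (\<lambda>x. ennsqrt (\<integral>\<^sup>+t\<in>{0<..}. ennreal ((cmod (of_real t * v t x))\<^sup>2 / t) \<partial>lborel)))"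


section \<open>Consistency of the definitions\<close>

text \<open>\<^const>\<open>eigenfun\<close> are indeed the eigenfunctions of \<^const>\<open>Otilde\<close>, and
  \<^const>\<open>eigenval\<close> the corresponding eigenvalues of its negative.\<close>

lemma gauss_deriv:
  fixes s :: real
  defines "G \<equiv> \<lambda>n. (deriv ^^ n) (\<lambda>r::real. exp (- r\<^sup>2))"
  shows "(G n has_real_derivative G (Suc n) s) (at s)"
    and "G (Suc (Suc n)) s = - 2 * s * G (Suc n) s - 2 * real (Suc n) * G n s"
proof -
  have S: "G (Suc n) = deriv (G n)" for n by (simp add: G_def)
  have "\<forall>s. (G n has_real_derivative G (Suc n) s) (at s) \<and>
      (G (Suc n) has_real_derivative G (Suc (Suc n)) s) (at s) \<and>
      G (Suc (Suc n)) s = - 2 * s * G (Suc n) s - 2 * real (Suc n) * G n s"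
  proof (induction n)
    case 0
    have d: "(G 0 has_real_derivative - 2 * s * exp (- s\<^sup>2)) (at s)" for s
      unfolding G_def by (auto intro!: derivative_eq_intros)
    then have e: "G (Suc 0) = (\<lambda>s. - 2 * s * exp (- s\<^sup>2))"
      unfolding S by (auto intro!: DERIV_imp_deriv)
    have d1: "(G (Suc 0) has_real_derivative
        (- 2 * s * (- 2 * s * exp (- s\<^sup>2)) - 2 * exp (- s\<^sup>2))) (at s)" for s
      unfolding e by (auto intro!: derivative_eq_intros)
    then have e1: "G (Suc (Suc 0)) = (\<lambda>s. - 2 * s * (- 2 * s * exp (- s\<^sup>2)) - 2 * exp (- s\<^sup>2))"
      unfolding S[of "Suc 0"] by (auto intro!: DERIV_imp_deriv)
    have g0: "G 0 s = exp (- s\<^sup>2)" for s by (simp add: G_def)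
    have "G (Suc (Suc 0)) s = - 2 * s * G (Suc 0) s - 2 * real (Suc 0) * G 0 s" for s
      by (simp add: e e1 g0)
    moreover have "(G 0 has_real_derivative G (Suc 0) s) (at s)" for s
      using d[of s] by (simp only: e)
    moreover have "(G (Suc 0) has_real_derivative G (Suc (Suc 0)) s) (at s)" for s
      using d1[of s] by (simp only: e1)
    ultimately show ?case by blast
  next
    case (Suc n)
    then have f: "G (Suc (Suc n)) = (\<lambda>s. - 2 * s * G (Suc n) s - 2 * real (Suc n) * G n s)"
      and D0: "\<And>s. (G n has_real_derivative G (Suc n) s) (at s)"
      and D1: "\<And>s. (G (Suc n) has_real_derivative G (Suc (Suc n)) s) (at s)" by blast+
    have d: "(G (Suc (Suc n)) has_real_derivative
        - 2 * s * G (Suc (Suc n)) s - 2 * real (Suc (Suc n)) * G (Suc n) s) (at s)" for s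
    proof (subst f)
      show "((\<lambda>s. - 2 * s * G (Suc n) s - 2 * real (Suc n) * G n s) has_real_derivative
        - 2 * s * G (Suc (Suc n)) s - 2 * real (Suc (Suc n)) * G (Suc n) s) (at s)"
        by (rule derivative_eq_intros D0 D1 refl)+ (simp add: algebra_simps)
    qed
    then have "G (Suc (Suc (Suc n))) =
        (\<lambda>s. - 2 * s * G (Suc (Suc n)) s - 2 * real (Suc (Suc n)) * G (Suc n) s)"
      unfolding S[of "Suc (Suc n)"] by (auto intro!: DERIV_imp_deriv)
    with d D1 show ?case by auto
  qed
  then show "(G n has_real_derivative G (Suc n) s) (at s)"
    and "G (Suc (Suc n)) s = - 2 * s * G (Suc n) s - 2 * real (Suc n) * G n s" by blast+
qed

definition hermite_fun :: "nat \<Rightarrow> real \<Rightarrow> real" where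
  "hermite_fun n s = exp (- s\<^sup>2) * hermite n s"

lemma hermite_fun_eq: "hermite_fun n s = (-1) ^ n * (deriv ^^ n) (\<lambda>r. exp (- r\<^sup>2)) s"
  by (simp add: hermite_fun_def hermite_def exp_minus field_simps)

lemma hermite_fun_deriv:
  "(hermite_fun n has_real_derivative - hermite_fun (Suc n) s) (at s)"
proof -
  have "hermite_fun n = (\<lambda>s. (-1) ^ n * (deriv ^^ n) (\<lambda>r. exp (- r\<^sup>2)) s)"
    by (auto simp: hermite_fun_eq)
  then show ?thesis
    using DERIV_cmult[OF gauss_deriv(1)[of n s], of "(-1) ^ n"] by (simp add: hermite_fun_eq)
qed

lemma hermite_fun_rec:
  "hermite_fun (Suc (Suc n)) s = 2 * s * hermite_fun (Suc n) s - 2 * real (Suc n) * hermite_fun n s"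
proof -
  have "(-1) ^ n * (a - b) = c * ((-1) ^ Suc n * d) - e * ((-1) ^ n * g)"
    if "a = - c * d" "b = e * g" for a b c d e g :: real
    using that by (simp add: algebra_simps)
  from this[OF refl refl] show ?thesis
    unfolding hermite_fun_eq gauss_deriv(2)[of n s] by simp
qed

lemma eigenfun_eq: "eigenfun k x = (\<Prod>j\<in>UNIV. hermite_fun (k j) (x $ j))"
proof -
  have "(norm x)\<^sup>2 = (\<Sum>j\<in>UNIV. (x $ j)\<^sup>2)"
    by (simp add: norm_vec_def L2_set_def sum_nonneg)
  then have "exp (- (norm x)\<^sup>2) = (\<Prod>j\<in>UNIV. exp (- (x $ j)\<^sup>2))"
    by (simp add: exp_sum flip: sum_negf)
  then show ?thesis
    by (simp add: eigenfun_def hermite_fun_def prod.distrib)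
qed

lemma eigenfun_split:
  "eigenfun (k(i := m)) x = hermite_fun m (x $ i) * (\<Prod>j\<in>UNIV - {i}. hermite_fun (k j) (x $ j))"
  unfolding eigenfun_eq by (subst prod.remove[of _ i]) (auto intro!: prod.cong)

lemma eigenfun_line_deriv:
  "((\<lambda>s. eigenfun k (x + s *\<^sub>R axis i 1)) has_real_derivative
     - eigenfun (k(i := Suc (k i))) x) (at 0)"
proof -
  let ?c = "\<Prod>j\<in>UNIV - {i}. hermite_fun (k j) (x $ j)"
  have *: "eigenfun k (x + s *\<^sub>R axis i 1) = hermite_fun (k i) (x $ i + s) * ?c" for s
  proof -
    have "(\<Prod>j\<in>UNIV - {i}. hermite_fun (k j) ((x + s *\<^sub>R axis i 1) $ j)) = ?c"
      by (rule prod.cong) (auto simp: axis_def)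
    with eigenfun_split[of k i "k i" "x + s *\<^sub>R axis i 1"] show ?thesis
      by (simp add: axis_def)
  qed
  have "((\<lambda>s. hermite_fun (k i) (x $ i + s)) has_real_derivative - hermite_fun (Suc (k i)) (x $ i)) (at 0)"
    using hermite_fun_deriv[of "k i" "x $ i + 0"] DERIV_shift[of "hermite_fun (k i)" _ 0 "x $ i"]
    by (simp add: add.commute)
  then have "((\<lambda>s. eigenfun k (x + s *\<^sub>R axis i 1)) has_real_derivative
      - hermite_fun (Suc (k i)) (x $ i) * ?c) (at 0)"
    unfolding * by (rule DERIV_cmult_right)
  then show ?thesis
    by (simp add: eigenfun_split)
qed

lemma pdv_eigenfun: "pdv i (eigenfun k) = (\<lambda>x. - eigenfun (k(i := Suc (k i))) x)"
  using eigenfun_line_deriv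
  by (auto simp: pdv_def fun_eq_iff has_real_derivative_iff_has_vector_derivative
      intro!: vector_derivative_at)

lemma pdv_uminus_eigenfun:
  "pdv i (\<lambda>x. - eigenfun k x) = (\<lambda>x. eigenfun (k(i := Suc (k i))) x)"
  using DERIV_minus[OF eigenfun_line_deriv]
  by (auto simp: pdv_def fun_eq_iff has_real_derivative_iff_has_vector_derivative
      intro!: vector_derivative_at)

lemma Otilde_eigenfun: "- Otilde (eigenfun k) x = eigenval k * eigenfun k x"
proof -
  have "pdv i (pdv i (eigenfun k)) x + 2 * (x $ i * pdv i (eigenfun k) x)
      = - (2 * real (k i) + 2) * eigenfun k x" for i
  proof -
    have "eigenfun k x = eigenfun (k(i := k i)) x" by simp
    then show ?thesis
      unfolding pdv_eigenfun pdv_uminus_eigenfun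
      by (simp only: fun_upd_same fun_upd_upd eigenfun_split hermite_fun_rec)
         (simp add: algebra_simps)
  qed
  then have "Otilde (eigenfun k) x = (\<Sum>i\<in>UNIV. - (2 * real (k i) + 2) * eigenfun k x)"
    unfolding Otilde_def by (simp add: sum_distrib_left flip: sum.distrib)
  also have "\<dots> = (\<Sum>i\<in>UNIV. - (2 * real (k i) + 2)) * eigenfun k x"
    by (rule sum_distrib_right[symmetric])
  also have "(\<Sum>i\<in>UNIV. - (2 * real (k i) + 2)) = - eigenval k"
    unfolding eigenval_def sum_negf sum.distrib of_nat_sum sum_distrib_left by simp
  finally show ?thesis by simp
qed

text \<open>\<^const>\<open>spectral\<close> determines the result almost everywhere, and
  \<^const>\<open>semigroup_version\<close> determines \<open>u\<close> for \<open>t > 0\<close>.\<close>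

lemma ennsqrt_power2: "(ennsqrt y)\<^sup>2 = y"
  by (cases y)
    (auto simp: ennsqrt_def ennreal_power power2_eq_square ennreal_mult_top simp flip: ennreal_mult)

lemma continuous_eigenfun: "continuous_on UNIV (eigenfun k)"
proof -
  have "continuous_on UNIV (hermite_fun n)" for n
    using hermite_fun_deriv by (meson DERIV_isCont continuous_at_imp_continuous_on)
  then have "continuous_on UNIV (\<lambda>x::real^'a. hermite_fun (k j) (x $ j))" for j
    by (rule continuous_on_compose2[OF _ continuous_on_component[OF continuous_on_id]]) simp
  then have "continuous_on UNIV (\<lambda>x::real^'a. \<Prod>j\<in>UNIV. hermite_fun (k j) (x $ j))"
    by (intro continuous_on_prod)
  then show ?thesis by (simp add: eigenfun_eq[abs_def])
qed

lemma spectral_unique: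
  fixes g g' :: "real ^ 'n \<Rightarrow> complex"
  assumes "spectral \<phi> f g" "spectral \<phi> f g'"
  shows "AE x in lborel. g x = g' x"
proof -
  define S where "S K x = (\<Sum>k\<in>K. of_real (\<phi> (eigenval k)) * coefficient k f *
    complex_of_real (eigenfun k x))" for K and x :: "real ^ 'n"
  define I where "I h = (\<integral>\<^sup>+x. (modulus h x)\<^sup>2 \<partial>inv_gauss)" for h :: "real ^ 'n \<Rightarrow> complex"
  have sets: "sets inv_gauss = sets (borel :: (real ^ 'n) measure)"
    by (simp add: inv_gauss_def)
  have [measurable]: "g \<in> borel_measurable borel" "g' \<in> borel_measurable borel"
    using assms by (auto simp: spectral_def L2_def)
  have [measurable]: "eigenfun k \<in> borel_measurable borel" for k :: "'n \<Rightarrow> nat"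
    by (intro borel_measurable_continuous_onI continuous_eigenfun)
  have [measurable]: "S K \<in> borel_measurable borel" for K
    unfolding S_def by measurable
  have lim: "((\<lambda>K. I (\<lambda>x. h x - S K x)) \<longlongrightarrow> 0) (finite_subsets_at_top UNIV)"
    if "spectral \<phi> f h" for h
  proof -
    from that have l: "((\<lambda>K. L2_norm (modulus (\<lambda>x. h x - S K x))) \<longlongrightarrow> 0)
        (finite_subsets_at_top UNIV)"
      by (simp add: spectral_def S_def)
    have "((\<lambda>K. L2_norm (modulus (\<lambda>x. h x - S K x)) * L2_norm (modulus (\<lambda>x. h x - S K x)))
        \<longlongrightarrow> 0 * 0) (finite_subsets_at_top UNIV)"
      by (intro tendsto_mult_ennreal l) auto
    then show ?thesis
      by (simp add: L2_norm_def I_def ennsqrt_power2 flip: power2_eq_square)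
  qed
  have bound: "I (\<lambda>x. g x - g' x) \<le> 2 * I (\<lambda>x. g x - S K x) + 2 * I (\<lambda>x. g' x - S K x)" for K
  proof -
    have pt: "(modulus (\<lambda>x. g x - g' x) x)\<^sup>2 \<le>
        2 * (modulus (\<lambda>x. g x - S K x) x)\<^sup>2 + 2 * (modulus (\<lambda>x. g' x - S K x) x)\<^sup>2" for x
    proof -
      have "cmod (g x - g' x) \<le> cmod (g x - S K x) + cmod (g' x - S K x)"
        using norm_triangle_ineq4[of "g x - S K x" "g' x - S K x"] by simp
      then have "(cmod (g x - g' x))\<^sup>2 \<le> (cmod (g x - S K x) + cmod (g' x - S K x))\<^sup>2"
        by (intro power_mono) auto
      also have "\<dots> \<le> 2 * (cmod (g x - S K x))\<^sup>2 + 2 * (cmod (g' x - S K x))\<^sup>2"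
        using sum_squares_bound[of "cmod (g x - S K x)" "cmod (g' x - S K x)"]
        by (simp add: power2_sum)
      finally have "ennreal ((cmod (g x - g' x))\<^sup>2) \<le>
          ennreal (2 * (cmod (g x - S K x))\<^sup>2 + 2 * (cmod (g' x - S K x))\<^sup>2)"
        by (rule ennreal_leI)
      then show ?thesis by (simp add: ennreal_power ennreal_mult)
    qed
    have "I (\<lambda>x. g x - g' x) \<le> (\<integral>\<^sup>+x. 2 * (modulus (\<lambda>x. g x - S K x) x)\<^sup>2 +
        2 * (modulus (\<lambda>x. g' x - S K x) x)\<^sup>2 \<partial>inv_gauss)"
      unfolding I_def by (intro nn_integral_mono pt)
    also have "\<dots> = 2 * I (\<lambda>x. g x - S K x) + 2 * I (\<lambda>x. g' x - S K x)"
      unfolding I_def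
      by (subst nn_integral_add) (auto simp: nn_integral_cmult measurable_cong_sets[OF sets refl])
    finally show ?thesis .
  qed
  have "((\<lambda>K. 2 * I (\<lambda>x. g x - S K x) + 2 * I (\<lambda>x. g' x - S K x)) \<longlongrightarrow> 2 * 0 + 2 * 0)
      (finite_subsets_at_top UNIV)"
    by (intro tendsto_add tendsto_mult_ennreal tendsto_const lim assms) auto
  then have "I (\<lambda>x. g x - g' x) \<le> 2 * 0 + 2 * 0"
    by (rule tendsto_lowerbound) (auto intro: bound)
  then have "I (\<lambda>x. g x - g' x) = 0" by simp
  then have "AE x in inv_gauss. (modulus (\<lambda>x. g x - g' x) x)\<^sup>2 = 0"
    unfolding I_def
    by (subst (asm) nn_integral_0_iff_AE) (auto simp: measurable_cong_sets[OF sets refl])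
  then show ?thesis
    unfolding inv_gauss_def by (subst (asm) AE_density) auto
qed

lemma semigroup_version_unique:
  fixes f :: "real ^ 'n \<Rightarrow> complex"
  assumes "semigroup_version f u" and "semigroup_version f v" and t: "t > 0"
  shows "u t = v t"
proof -
  have c: "continuous_on UNIV (w t)" if "semigroup_version f w" for w
  proof -
    have "continuous_on ({0<..} \<times> UNIV) (\<lambda>(t, x). w t x)"
      using that by (simp add: semigroup_version_def)
    moreover have "continuous_on UNIV (\<lambda>x::real^'n. (t, x))"
      by (rule continuous_on_Pair[OF continuous_on_const continuous_on_id])
    moreover have "range (Pair t) \<subseteq> {0<..} \<times> (UNIV :: (real^'n) set)"
      using t by auto
    ultimately have "continuous_on UNIV (\<lambda>x. (\<lambda>(t, x). w t x) (t, x))"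
      by (rule continuous_on_compose2)
    then show ?thesis by simp
  qed
  let ?N = "{x. u t x \<noteq> v t x}"
  have N: "open ?N"
    using c[OF assms(1)] c[OF assms(2)] by (rule open_Collect_neq)
  have "spectral (\<lambda>l. exp (- t * l)) f (u t)" "spectral (\<lambda>l. exp (- t * l)) f (v t)"
    using assms by (auto simp: semigroup_version_def)
  then have "AE x in lborel. u t x = v t x"
    by (rule spectral_unique)
  then obtain M where M: "?N \<subseteq> M" "M \<in> null_sets lborel"
    by (elim AE_E) (auto simp: null_sets_def)
  then have "negligible M"
    using null_sets_completionI negligible_iff_null_sets by blast
  then have "negligible ?N"
    using M(1) negligible_subset by blast
  then have "?N = {}"
    using N open_not_negligible by blast
  then show ?thesis by auto
qed

end

theory Submission
  imports Defs "HOL-Real_Asymp.Real_Asymp" "HOL-Probability.Probability"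
begin

text \<open>
  Let \<open>e\<^sub>k\<close> be the eigenfunctions, \<open>N\<^sub>k\<close> their squared norms, \<open>\<lambda>\<^sub>k = 2|k| + 2d\<close> the eigenvalues
  and \<open>c\<^sub>k\<close> the coefficients of \<open>f\<close>. All operators are obtained from functions of \<open>A\<close>, and two of the
  three bounds are statements about orthogonal expansions.

  Square function. By orthogonality and Tonelli, the squared norm of \<open>G f\<close> is at most the sum of
  \<open>|c\<^sub>k|\<^sup>2 N\<^sub>k\<close> times \<open>\<integral> t \<lambda>\<^sup>2 e\<^bsup>-2t\<lambda>\<^esup> dt\<close> with \<open>\<lambda> = \<lambda>\<^sub>k\<close>. This integral is \<open>1/4\<close> for every \<open>\<lambda>\<close>, and
  Bessel's inequality finishes the argument.

  Riesz transforms. The operator \<open>\<partial>\<^sub>i\<close> raises and \<open>\<partial>\<^sub>i + 2 x\<^sub>i\<close> lowers the index \<open>k\<^sub>i\<close>. Hence the images of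
  the \<open>e\<^sub>k\<close> are again orthogonal, with squared norms \<open>2 (k\<^sub>i + 1) N\<^sub>k\<close> and \<open>2 k\<^sub>i N\<^sub>k\<close>, and both are at most
  \<open>\<lambda>\<^sub>k N\<^sub>k\<close>. The factor \<open>\<lambda>\<^sub>k\<^bsup>-1/2\<^esup>\<close> of \<open>A\<^bsup>-1/2\<^esup>\<close> compensates this loss. Limits of partial sums are
  taken along a common subsequence that converges almost everywhere, and integration by parts
  against test functions passes to the limit because convergence in \<open>L\<^sup>2(\<gamma>\<^bsub>-d\<^esub>)\<close> implies convergence in
  the unweighted \<open>L\<^sup>1\<close>.

  Maximal operator. Orthogonality does not suffice here; the additional information is that
  \<open>e\<^bsup>-tA\<^esup>\<close> has a nonnegative kernel. By the product structure this follows from Mehler's formula in one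
  variable, which is proved by showing that the generating series satisfies a linear differential
  equation. For a semigroup \<open>(T\<^sup>n)\<close> of contractions with symmetric nonnegative kernels,
  the averages \<open>A\<^sub>n = (T + \<dots> + T\<^sup>n) / n\<close> satisfy \<open>A\<^sub>n A\<^sub>m \<le> 2 (A\<^bsub>2n\<^esub> + A\<^bsub>2m\<^esub>)\<close>. If \<open>L\<close> is a linearization of the
  maximal operator of the averages, this controls \<open>L L\<^sup>*\<close> by an operator of the same kind as \<open>L\<close>; so if
  \<open>C\<close> is the best bound for the norms of all linearizations, then \<open>C\<^sup>2 \<le> 4 C\<close>, that is \<open>C \<le> 4\<close>
  (\<open>maximal_ergodic\<close>). The difference between \<open>T\<^sup>n f\<close> and \<open>A\<^sub>n f\<close> is dominated by a discrete square
  function, which is again a matter of orthogonality (\<open>discrete_square_function\<close>). The resulting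
  bound for the times \<open>\<tau>, 2\<tau>, 3\<tau>, \<dots>\<close> does not depend on \<open>\<tau>\<close>; letting \<open>\<tau>\<close> run through \<open>2\<^bsup>-m\<^esup>\<close> and using
  continuity in \<open>t\<close> gives the supremum over all \<open>t > 0\<close>.
\<close>

section \<open>Hermite functions on the line\<close>

lemma hermite_fun_0: "hermite_fun 0 s = exp (- s\<^sup>2)"
  by (simp add: hermite_fun_eq)

lemma hermite_fun_1: "hermite_fun (Suc 0) s = 2 * s * exp (- s\<^sup>2)"
proof -
  have "(hermite_fun 0 has_real_derivative - 2 * s * exp (- s\<^sup>2)) (at s)"
    unfolding hermite_fun_0[abs_def] by (auto intro!: derivative_eq_intros)
  from DERIV_unique[OF this hermite_fun_deriv] show ?thesis by simp
qed

lemma isCont_hermite_fun: "isCont (hermite_fun n) s"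
  by (rule DERIV_isCont[OF hermite_fun_deriv])

lemma continuous_hermite_fun: "continuous_on A (hermite_fun n)"
  by (intro continuous_at_imp_continuous_on ballI isCont_hermite_fun)

lemma hermite_fun_measurable [measurable]: "hermite_fun n \<in> borel_measurable borel"
  by (intro borel_measurable_continuous_onI continuous_hermite_fun)

text \<open>
  Polynomial factors are absorbed by giving up a little of the Gaussian. The recursion multiplies
  by \<open>s\<close>, so the induction needs the estimate for all exponents \<open>a < 1\<close> at once: the step for \<open>a\<close> uses
  the hypothesis for \<open>(1 + a) / 2\<close>.
\<close>

lemma hermite_fun_decay:
  assumes "a < 1"
  shows "\<exists>C\<ge>0. \<forall>s. \<bar>hermite_fun n s\<bar> \<le> C * exp (- a * s\<^sup>2)"
  using assms
proof (induction n arbitrary: a rule: induct_nat_012)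
  case 0
  then show ?case
    using mult_right_mono[of a 1 "_\<^sup>2"]
    by (intro exI[of _ 1]) (simp add: hermite_fun_0)
next
  have poly: "\<bar>s\<bar> * exp (- ((1 + a) / 2) * s\<^sup>2) \<le> (1 + 2 / (1 - a)) * exp (- a * s\<^sup>2)"
    if "a < 1" for a s :: real
  proof -
    define b where "b = (1 - a) / 2"
    have b: "b > 0" using that by (simp add: b_def)
    have "\<bar>s\<bar> \<le> 1 + s\<^sup>2"
      using zero_le_power2[of "\<bar>s\<bar> - 1"] by (simp add: power2_diff)
    also have "\<dots> \<le> (1 + 1 / b) * (1 + b * s\<^sup>2)"
      using b by (simp add: field_simps)
    also have "\<dots> \<le> (1 + 1 / b) * exp (b * s\<^sup>2)"
      using b by (intro mult_left_mono) auto
    finally have "\<bar>s\<bar> * exp (- ((1 + a) / 2) * s\<^sup>2)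
        \<le> (1 + 1 / b) * exp (b * s\<^sup>2) * exp (- ((1 + a) / 2) * s\<^sup>2)"
      by (rule mult_right_mono) simp
    also have "\<dots> = (1 + 1 / b) * exp (- a * s\<^sup>2)"
      by (simp add: b_def field_simps flip: exp_add)
    also have "1 / b = 2 / (1 - a)" by (simp add: b_def)
    finally show ?thesis .
  qed
  {
    case 1
    have "\<bar>hermite_fun (Suc 0) s\<bar> \<le> (2 * (1 + 2 / (1 - a))) * exp (- a * s\<^sup>2)" for s
    proof -
      have "\<bar>s\<bar> * exp (- s\<^sup>2) \<le> \<bar>s\<bar> * exp (- ((1 + a) / 2) * s\<^sup>2)"
        using mult_right_mono[of "(1 + a) / 2" 1 "s\<^sup>2"] \<open>a < 1\<close>
        by (intro mult_left_mono) (simp_all del: divide_le_eq_numeral1)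
      also note poly[OF 1, of s]
      finally have "2 * (\<bar>s\<bar> * exp (- s\<^sup>2)) \<le> 2 * ((1 + 2 / (1 - a)) * exp (- a * s\<^sup>2))"
        by (rule mult_left_mono) simp
      then show ?thesis
        by (simp add: hermite_fun_1 abs_mult mult.assoc del: distrib_right_numeral distrib_left_numeral)
    qed
    with 1 show ?case
      by (intro exI[of _ "2 * (1 + 2 / (1 - a))"]) simp
  next
    case (ge2 n)
    from ge2(3) have a': "(1 + a) / 2 < 1" by simp
    obtain C D where C: "C \<ge> 0" "\<And>s. \<bar>hermite_fun n s\<bar> \<le> C * exp (- a * s\<^sup>2)"
      and D: "D \<ge> 0" "\<And>s. \<bar>hermite_fun (Suc n) s\<bar> \<le> D * exp (- ((1 + a) / 2) * s\<^sup>2)"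
      using ge2(1)[OF ge2(3)] ge2(2)[OF a'] by blast
    have "\<bar>hermite_fun (Suc (Suc n)) s\<bar>
        \<le> (2 * D * (1 + 2 / (1 - a)) + 2 * real (Suc n) * C) * exp (- a * s\<^sup>2)" for s
    proof -
      have "\<bar>hermite_fun (Suc (Suc n)) s\<bar>
          \<le> 2 * (\<bar>s\<bar> * \<bar>hermite_fun (Suc n) s\<bar>) + 2 * real (Suc n) * \<bar>hermite_fun n s\<bar>"
        unfolding hermite_fun_rec by (rule order_trans[OF abs_triangle_ineq4]) (simp add: abs_mult)
      also have "\<bar>s\<bar> * \<bar>hermite_fun (Suc n) s\<bar> \<le> \<bar>s\<bar> * (D * exp (- ((1 + a) / 2) * s\<^sup>2))"
        by (intro mult_left_mono D) auto
      also have "\<dots> = D * (\<bar>s\<bar> * exp (- ((1 + a) / 2) * s\<^sup>2))" by simp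
      also have "\<dots> \<le> D * ((1 + 2 / (1 - a)) * exp (- a * s\<^sup>2))"
        by (intro mult_left_mono poly ge2 D)
      also have "2 * real (Suc n) * \<bar>hermite_fun n s\<bar> \<le> 2 * real (Suc n) * (C * exp (- a * s\<^sup>2))"
        by (intro mult_left_mono C) auto
      finally show ?thesis by (simp add: algebra_simps)
    qed
    with C D ge2(3) show ?case
      by (intro exI[of _ "2 * D * (1 + 2 / (1 - a)) + 2 * real (Suc n) * C"]) auto
  }
qed

lemma integrable_gaussian:
  assumes "c > 0"
  shows "integrable lborel (\<lambda>x::real. exp (- c * x\<^sup>2))"
proof -
  have sq: "(1 / sqrt (2 * c))\<^sup>2 = 1 / (2 * c)"
    using assms by (simp add: power_divide)
  define K where "K = sqrt (pi / c)"
  have K: "K \<noteq> 0" using assms by (simp add: K_def)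
  have "normal_density 0 (1 / sqrt (2 * c)) = (\<lambda>x. 1 / K * exp (- c * x\<^sup>2))"
    using assms unfolding normal_density_def sq K_def by (auto simp: mult.commute)
  moreover have "integrable lborel (normal_density 0 (1 / sqrt (2 * c)))"
    using assms by (intro integrable_normal_density) auto
  ultimately have "integrable lborel (\<lambda>x. 1 / K * exp (- c * x\<^sup>2))"
    by (simp only:)
  from integrable_mult_right[OF this, of K] show ?thesis
    using K by simp
qed

lemma integral_gaussian: "(LINT x|lborel. exp (- x\<^sup>2)) = sqrt pi"
proof -
  have "(LINT x|lborel. normal_density 0 (sqrt (1/2)) x) = 1" by simp
  also have "normal_density 0 (sqrt (1/2)) = (\<lambda>x. exp (- x\<^sup>2) / sqrt pi)"
    by (auto simp: normal_density_def real_sqrt_divide field_simps)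
  finally show ?thesis by (simp add: field_simps)
qed

text \<open>
  The integrand of the one-variable inner product, up to the factor \<open>\<pi>\<^bsup>1/2\<^esup>\<close>.
\<close>

definition hermite_weighted :: "nat \<Rightarrow> nat \<Rightarrow> real \<Rightarrow> real" where
  "hermite_weighted m n s = exp (s\<^sup>2) * (hermite_fun m s * hermite_fun n s)"

lemma hermite_weighted_decay:
  "\<exists>C\<ge>0. \<forall>s. \<bar>hermite_weighted m n s\<bar> \<le> C * exp (- (1/2) * s\<^sup>2)"
proof -
  obtain C D where C: "C \<ge> 0" "\<And>s. \<bar>hermite_fun m s\<bar> \<le> C * exp (- (3/4) * s\<^sup>2)"
      and D: "D \<ge> 0" "\<And>s. \<bar>hermite_fun n s\<bar> \<le> D * exp (- (3/4) * s\<^sup>2)"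
    using hermite_fun_decay[of "3/4" m] hermite_fun_decay[of "3/4" n] by auto
  have "\<bar>hermite_weighted m n s\<bar> \<le> (C * D) * exp (- (1/2) * s\<^sup>2)" for s
  proof -
    have "\<bar>hermite_fun m s * hermite_fun n s\<bar> \<le> (C * exp (- (3/4) * s\<^sup>2)) * (D * exp (- (3/4) * s\<^sup>2))"
      unfolding abs_mult by (intro mult_mono C D) (auto simp: C)
    then have "exp (s\<^sup>2) * \<bar>hermite_fun m s * hermite_fun n s\<bar>
        \<le> exp (s\<^sup>2) * ((C * exp (- (3/4) * s\<^sup>2)) * (D * exp (- (3/4) * s\<^sup>2)))"
      by (intro mult_left_mono) auto
    also have "\<dots> = C * D * (exp (s\<^sup>2) * exp (- (3/4) * s\<^sup>2) * exp (- (3/4) * s\<^sup>2))" by simp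
    also have "exp (s\<^sup>2) * exp (- (3/4) * s\<^sup>2) * exp (- (3/4) * s\<^sup>2) = exp (- (1/2) * s\<^sup>2)"
      by (simp flip: exp_add)
    finally show ?thesis by (simp add: hermite_weighted_def abs_mult)
  qed
  with C D show ?thesis by (intro exI[of _ "C * D"]) simp
qed

lemma continuous_hermite_weighted: "continuous_on A (hermite_weighted m n)"
  unfolding hermite_weighted_def[abs_def]
  by (intro continuous_on_mult continuous_hermite_fun) (intro continuous_intros)

lemma integrable_hermite_weighted: "integrable lborel (hermite_weighted m n)"
proof -
  obtain C where C: "C \<ge> 0" "\<And>s. \<bar>hermite_weighted m n s\<bar> \<le> C * exp (- (1/2) * s\<^sup>2)"
    using hermite_weighted_decay by blast
  have meas: "hermite_weighted m n \<in> borel_measurable borel"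
    by (intro borel_measurable_continuous_onI continuous_hermite_weighted)
  show ?thesis
    by (rule Bochner_Integration.integrable_bound[of _ "\<lambda>s. C * exp (- (1/2) * s\<^sup>2)"])
       (use C meas integrable_gaussian[of "1/2"] in \<open>auto simp: AE_I2\<close>)
qed

lemma hermite_weighted_tendsto:
  "(hermite_weighted m n \<longlongrightarrow> 0) at_top" "(hermite_weighted m n \<longlongrightarrow> 0) at_bot"
proof -
  obtain C where C: "C \<ge> 0" "\<And>s. \<bar>hermite_weighted m n s\<bar> \<le> C * exp (- (1/2) * s\<^sup>2)"
    using hermite_weighted_decay by blast
  have "((\<lambda>s. C * exp (- (1/2) * s\<^sup>2)) \<longlongrightarrow> C * 0) at_top"
       "((\<lambda>s. C * exp (- (1/2) * s\<^sup>2)) \<longlongrightarrow> C * 0) at_bot"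
    by (rule tendsto_mult_left, real_asymp)+
  moreover have "\<forall>\<^sub>F s in G. norm (hermite_weighted m n s) \<le> C * exp (- (1/2) * s\<^sup>2)" for G
    using C(2) by (simp add: always_eventually)
  ultimately show "(hermite_weighted m n \<longlongrightarrow> 0) at_top" "(hermite_weighted m n \<longlongrightarrow> 0) at_bot"
    by (metis Lim_null_comparison mult_zero_right)+
qed

lemma LINT_deriv_eq_0:
  fixes F f :: "real \<Rightarrow> real"
  assumes "\<And>x. (F has_real_derivative f x) (at x)" "continuous_on UNIV f" "integrable lborel f"
    "(F \<longlongrightarrow> 0) at_top" "(F \<longlongrightarrow> 0) at_bot"
  shows "(LINT x|lborel. f x) = 0"
proof -
  have "(LBINT x=-\<infinity>..\<infinity>. f x) = 0 - 0"
    using assms by (intro interval_integral_FTC_integrable[where F = F])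
      (auto simp: ereal_tendsto_simps has_real_derivative_iff_has_vector_derivative
        continuous_on_eq_continuous_at set_integrable_def)
  then show ?thesis by (simp add: interval_lebesgue_integral_def set_lebesgue_integral_def)
qed

text \<open>
  Differentiating \<open>e\<^bsup>s\<^sup>2\<^esup> h\<^bsub>m+1\<^esub> h\<^sub>n\<close> and integrating over the line lowers both indices by one at the cost
  of the factor \<open>2 (m + 1)\<close>. Repeating this reduces everything to an index \<open>0\<close>, where the integrand
  is a derivative or the Gaussian itself.
\<close>

theorem LINT_hermite_weighted:
  "(LINT s|lborel. hermite_weighted m n s) = (if m = n then sqrt pi * 2 ^ n * fact n else 0)"
proof (induction n arbitrary: m)
  have deriv: "(hermite_weighted (Suc m) n has_real_derivative
      2 * real (Suc m) * hermite_weighted m n s - hermite_weighted (Suc m) (Suc n) s) (at s)" for m n s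
    unfolding hermite_weighted_def[abs_def]
    by (auto intro!: derivative_eq_intros hermite_fun_deriv simp: hermite_fun_rec algebra_simps)
  have step: "(LINT s|lborel. hermite_weighted (Suc m) (Suc n) s)
      = 2 * real (Suc m) * (LINT s|lborel. hermite_weighted m n s)" for m n
  proof -
    have "(LINT s|lborel. 2 * real (Suc m) * hermite_weighted m n s - hermite_weighted (Suc m) (Suc n) s) = 0"
      by (rule LINT_deriv_eq_0[OF deriv])
        (intro continuous_intros continuous_hermite_weighted integrable_hermite_weighted
           hermite_weighted_tendsto Bochner_Integration.integrable_diff integrable_mult_right)+
    then show ?thesis
      by (simp add: integrable_hermite_weighted)
  qed
  have zero: "(LINT s|lborel. hermite_weighted 0 (Suc n) s) = 0" for n
  proof -
    have deriv: "(hermite_weighted 0 n has_real_derivative - hermite_weighted 0 (Suc n) s) (at s)" for s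
      unfolding hermite_weighted_def[abs_def] hermite_fun_0
      by (auto intro!: derivative_eq_intros hermite_fun_deriv simp: algebra_simps)
    have "(LINT s|lborel. - hermite_weighted 0 (Suc n) s) = 0"
      by (rule LINT_deriv_eq_0[OF deriv])
        (intro continuous_intros continuous_hermite_weighted integrable_hermite_weighted
           hermite_weighted_tendsto Bochner_Integration.integrable_minus)+
    then show ?thesis by simp
  qed
  {
    case 0
    show ?case
    proof (cases m)
      case 0
      then show ?thesis
        by (simp add: hermite_weighted_def hermite_fun_0 integral_gaussian flip: exp_add)
    next
      case (Suc k)
      have "hermite_weighted (Suc k) 0 = hermite_weighted 0 (Suc k)"
        by (auto simp: hermite_weighted_def)
      with Suc zero[of k] show ?thesis by simp
    qed
  next
    case (Suc n)
    then show ?case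
      by (cases m) (simp_all add: step zero)
  }
qed

text \<open>
  The function \<open>h\<^sub>n\<^sup>2\<close> vanishes at \<open>-\<infinity>\<close> and has the derivative \<open>- 2 h\<^sub>n h\<^bsub>n+1\<^esub>\<close>, which is bounded by
  \<open>h\<^sub>n\<^sup>2 + h\<^bsub>n+1\<^esub>\<^sup>2\<close>. So the norms bound the supremum. The bound is uniform in \<open>s\<close> and loses only a polynomial
  in \<open>n\<close>, which is harmless in front of geometrically decaying factors.
\<close>

lemma hermite_fun_sup_bound: "(hermite_fun n s)\<^sup>2 \<le> sqrt pi * 2 ^ n * fact n * (2 * real n + 3)"
proof -
  let ?f = "\<lambda>s. - 2 * (hermite_fun n s * hermite_fun (Suc n) s)"
  let ?w = "\<lambda>s. hermite_weighted n n s + hermite_weighted (Suc n) (Suc n) s"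
  have le: "(hermite_fun m s)\<^sup>2 \<le> hermite_weighted m m s" for m s
    using mult_right_mono[of 1 "exp (s\<^sup>2)" "(hermite_fun m s)\<^sup>2"]
    by (simp add: hermite_weighted_def power2_eq_square)
  have fw: "\<bar>?f s\<bar> \<le> ?w s" for s
  proof -
    have "\<bar>?f s\<bar> = 2 * \<bar>hermite_fun n s\<bar> * \<bar>hermite_fun (Suc n) s\<bar>" by (simp add: abs_mult)
    also have "\<dots> \<le> (hermite_fun n s)\<^sup>2 + (hermite_fun (Suc n) s)\<^sup>2"
      using sum_squares_bound[of "\<bar>hermite_fun n s\<bar>" "\<bar>hermite_fun (Suc n) s\<bar>"] by simp
    finally show ?thesis using le[of n s] le[of "Suc n" s] by linarith
  qed
  have w: "integrable lborel ?w"
    by (intro Bochner_Integration.integrable_add integrable_hermite_weighted)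
  have f: "integrable lborel ?f"
    by (rule Bochner_Integration.integrable_bound[OF w]) (use fw in \<open>auto intro!: AE_I2 order_trans[OF _ abs_ge_self]\<close>)
  have sq0: "((\<lambda>s. (hermite_fun n s)\<^sup>2) \<longlongrightarrow> 0) at_bot"
    by (rule Lim_null_comparison[OF _ hermite_weighted_tendsto(2)[of n n]]) (use le[of n] in auto)
  have "(LBINT x=-\<infinity>..ereal s. ?f x) = (hermite_fun n s)\<^sup>2 - 0"
  proof (rule interval_integral_FTC_integrable[where F = "\<lambda>s. (hermite_fun n s)\<^sup>2"])
    show "((\<lambda>s. (hermite_fun n s)\<^sup>2) has_vector_derivative ?f x) (at x)" for x
      unfolding has_real_derivative_iff_has_vector_derivative[symmetric]
      by (auto intro!: derivative_eq_intros hermite_fun_deriv)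
    show "isCont ?f x" for x
      by (intro continuous_intros isCont_hermite_fun)
    show "set_integrable lborel (einterval (- \<infinity>) (ereal s)) ?f"
      unfolding set_integrable_def by (rule integrable_mult_indicator[OF _ f]) simp
    have "isCont (\<lambda>s. (hermite_fun n s)\<^sup>2) s"
      by (intro continuous_intros isCont_hermite_fun)
    then have "((\<lambda>s. (hermite_fun n s)\<^sup>2) \<longlongrightarrow> (hermite_fun n s)\<^sup>2) (at_left s)"
      by (simp add: isCont_def filterlim_at_split)
    then show "(((\<lambda>s. (hermite_fun n s)\<^sup>2) \<circ> real_of_ereal) \<longlongrightarrow> (hermite_fun n s)\<^sup>2) (at_left (ereal s))"
      by (simp add: ereal_tendsto_simps)
  qed (use sq0 in \<open>auto simp: ereal_tendsto_simps\<close>)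
  then have "(hermite_fun n s)\<^sup>2 = (LINT x|lborel. indicator {..<s} x * ?f x)"
    by (simp add: interval_lebesgue_integral_def set_lebesgue_integral_def)
  also have "\<dots> \<le> (LINT x|lborel. ?w x)"
  proof (rule integral_mono)
    show "integrable lborel (\<lambda>x. indicator {..<s} x * ?f x)"
      using integrable_mult_indicator[OF _ f, of "{..<s}"] by simp
    show "indicator {..<s} x * ?f x \<le> ?w x" for x
      using fw[of x] by (auto simp: indicator_def)
  qed (rule w)
  also have "\<dots> = sqrt pi * 2 ^ n * fact n * (2 * real n + 3)"
    by (simp add: integrable_hermite_weighted LINT_hermite_weighted algebra_simps)
  finally show ?thesis .
qed

section \<open>Mehler's formula\<close>

lemma summable_power_times_geometric:
  fixes r :: real
  assumes "\<bar>r\<bar> < 1"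
  shows "summable (\<lambda>n. real n ^ p * r ^ n)"
  using assms
proof (induction p arbitrary: r)
  case (Suc p)
  have "summable (\<lambda>n. diffs (\<lambda>n. real n ^ p) n * r ^ n)"
    by (rule termdiff_converges[of r 1]) (use Suc in auto)
  from summable_mult[OF this, of r] have "summable (\<lambda>n. real (Suc n) ^ Suc p * r ^ Suc n)"
    by (simp add: diffs_def mult_ac)
  then show ?case
    by (subst (asm) summable_Suc_iff)
qed (auto intro: summable_geometric)

lemma summable_poly_times_geometric:
  fixes r :: real and c :: "nat \<Rightarrow> 'b::{real_normed_div_algebra, banach}"
  assumes "\<bar>r\<bar> < 1" "\<And>n. norm (c n) \<le> C * (real n + a) ^ p" "a \<ge> 0"
  shows "summable (\<lambda>n. norm (c n) * \<bar>r\<bar> ^ n)"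
proof (rule summable_comparison_test')
  show "summable (\<lambda>n. \<bar>C\<bar> * (\<Sum>i\<le>p. of_nat (p choose i) * a ^ (p - i) * (real n ^ i * \<bar>r\<bar> ^ n)))"
    using assms by (intro summable_mult summable_sum summable_power_times_geometric) auto
  show "norm (norm (c n) * \<bar>r\<bar> ^ n) \<le> \<bar>C\<bar> * (\<Sum>i\<le>p. of_nat (p choose i) * a ^ (p - i) * (real n ^ i * \<bar>r\<bar> ^ n))" for n
  proof -
    have "norm (c n) \<le> \<bar>C\<bar> * (real n + a) ^ p"
      using assms(2)[of n] assms(3) by (smt (verit) mult_right_mono zero_le_power of_nat_0_le_iff)
    then have "norm (c n) * \<bar>r\<bar> ^ n \<le> \<bar>C\<bar> * (real n + a) ^ p * \<bar>r\<bar> ^ n"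
      by (rule mult_right_mono) simp
    also have "\<dots> = \<bar>C\<bar> * (\<Sum>i\<le>p. of_nat (p choose i) * a ^ (p - i) * (real n ^ i * \<bar>r\<bar> ^ n))"
      unfolding binomial_ring by (simp only: sum_distrib_left sum_distrib_right mult_ac)
    finally show ?thesis by simp
  qed
qed

definition hermite_norm :: "nat \<Rightarrow> real" where
  "hermite_norm n = 2 ^ n * fact n"

lemma hermite_norm_pos [simp]: "hermite_norm n > 0" "hermite_norm n \<noteq> 0" "\<bar>hermite_norm n\<bar> = hermite_norm n"
  by (simp_all add: hermite_norm_def)

lemma hermite_norm_Suc: "hermite_norm (Suc n) = 2 * real (Suc n) * hermite_norm n"
  by (simp add: hermite_norm_def)

lemma hermite_prod_bound:
  "\<bar>hermite_fun m x * hermite_fun n y\<bar>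
    \<le> sqrt pi * (hermite_norm m * (2 * real m + 3) + hermite_norm n * (2 * real n + 3))"
proof -
  have "\<bar>hermite_fun m x * hermite_fun n y\<bar> \<le> (hermite_fun m x)\<^sup>2 + (hermite_fun n y)\<^sup>2"
    using sum_squares_bound[of "\<bar>hermite_fun m x\<bar>" "\<bar>hermite_fun n y\<bar>"]
      abs_ge_zero[of "hermite_fun m x * hermite_fun n y"]
    unfolding abs_mult mult.assoc power2_abs by linarith
  also have "\<dots> \<le> sqrt pi * hermite_norm m * (2 * real m + 3) + sqrt pi * hermite_norm n * (2 * real n + 3)"
    using hermite_fun_sup_bound[of m x] hermite_fun_sup_bound[of n y]
    by (intro add_mono) (simp_all add: hermite_norm_def mult.assoc)
  finally show ?thesis by (simp add: algebra_simps)
qed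

definition mehler_coeff :: "real \<Rightarrow> real \<Rightarrow> nat \<Rightarrow> real" where
  "mehler_coeff x y n = hermite_fun n x * hermite_fun n y / hermite_norm n"

lemma mehler_coeff_abs_summable:
  assumes "\<bar>r\<bar> < 1"
  shows "summable (\<lambda>n. \<bar>mehler_coeff x y n\<bar> * \<bar>r\<bar> ^ n)"
proof -
  have "norm (mehler_coeff x y n) \<le> (4 * sqrt pi) * (real n + 2) ^ 1" for n
  proof -
    have "\<bar>hermite_fun n x * hermite_fun n y\<bar> \<le> sqrt pi * (hermite_norm n * (4 * real n + 6))"
      using hermite_prod_bound[of n x n y] by (simp add: algebra_simps)
    also have "\<dots> \<le> sqrt pi * (hermite_norm n * (4 * real n + 8))"
      by (intro mult_left_mono) (auto simp: less_imp_le)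
    finally show ?thesis
      by (simp add: mehler_coeff_def field_simps)
  qed
  from summable_poly_times_geometric[OF assms this] show ?thesis by simp
qed

definition mehler_kernel :: "real \<Rightarrow> real \<Rightarrow> real \<Rightarrow> real" where
  "mehler_kernel x y r = (\<Sum>n. mehler_coeff x y n * r ^ n)"

text \<open>
  The series with one index shifted; it turns the recursion of the Hermite functions into linear
  relations between power series.
\<close>

definition mehler_mixed :: "real \<Rightarrow> real \<Rightarrow> nat \<Rightarrow> real" where
  "mehler_mixed x y n = hermite_fun n x * hermite_fun (Suc n) y / hermite_norm n"

lemma summable_mehler_mixed:
  assumes "\<bar>r\<bar> < 1"
  shows "summable (\<lambda>n. mehler_mixed x y n * r ^ n)" 
proof -
  have "norm (mehler_mixed x y n) \<le> (8 * sqrt pi) * (real n + 3) ^ 2" for n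
  proof -
    have "\<bar>hermite_fun n x * hermite_fun (Suc n) y\<bar>
        \<le> sqrt pi * (hermite_norm n * (2 * real n + 3) + hermite_norm (Suc n) * (2 * real (Suc n) + 3))"
      by (rule hermite_prod_bound)
    also have "\<dots> = hermite_norm n * (sqrt pi * (2 * real n + 3 + 2 * real (Suc n) * (2 * real (Suc n) + 3)))"
      by (simp add: hermite_norm_Suc algebra_simps)
    also have "\<dots> \<le> hermite_norm n * (sqrt pi * (8 * (real n + 3) ^ 2))"
      by (intro mult_left_mono) (auto simp: less_imp_le power2_eq_square algebra_simps)
    finally show ?thesis
      by (simp add: mehler_mixed_def field_simps)
  qed
  from summable_poly_times_geometric[OF assms this]
  have "summable (\<lambda>n. norm (mehler_mixed x y n * r ^ n))"
    by (simp add: abs_mult power_abs)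
  then show ?thesis by (rule summable_norm_cancel)
qed


text \<open>
  Let \<open>K\<close> be the series, \<open>P\<close> and \<open>Q\<close> the two mixed series. The three-term recursion, applied in one
  variable at a time, gives \<open>P = 2 y K - r Q\<close>, \<open>Q = 2 x K - r P\<close> and an expression of \<open>K'\<close> in terms of \<open>P\<close>
  and \<open>K\<close>. Eliminating \<open>P\<close> and \<open>Q\<close> leaves a homogeneous linear differential equation of first order
  for \<open>K\<close> in \<open>r\<close>, and \<open>K\<close> is determined by its value at \<open>r = 0\<close>.
\<close>

theorem mehler_formula:
  assumes "\<bar>r\<bar> < 1"
  shows "mehler_kernel x y r = exp (- (x\<^sup>2 + y\<^sup>2 - 2 * r * x * y) / (1 - r\<^sup>2)) / sqrt (1 - r\<^sup>2)"
proof -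
  define K' where "K' r = (\<Sum>n. diffs (mehler_coeff x y) n * r ^ n)" for r
  have summable_K: "summable (\<lambda>n. mehler_coeff x y n * r ^ n)" if "\<bar>r\<bar> < 1" for r
    using mehler_coeff_abs_summable[OF that, of x y]
    by (intro summable_norm_cancel[of "\<lambda>n. mehler_coeff x y n * r ^ n"]) (simp add: abs_mult power_abs)
  have summable_K': "summable (\<lambda>n. diffs (mehler_coeff x y) n * r ^ n)" if "\<bar>r\<bar> < 1" for r
    by (rule termdiff_converges[of r 1]) (use that summable_K in auto)
  have K_deriv: "(mehler_kernel x y has_real_derivative K' r) (at r)" if "\<bar>r\<bar> < 1" for r
    unfolding mehler_kernel_def[abs_def] K'_def
    by (rule termdiffs_strong'[of 1]) (use that summable_K in auto)
  have head: "(\<Sum>n. c n * r ^ n) = c 0 + r * (\<Sum>n. c (Suc n) * r ^ n)"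
    "summable (\<lambda>n. c (Suc n) * r ^ n)"
    if "summable (\<lambda>n. c n * r ^ n)" for c :: "nat \<Rightarrow> real" and r :: real
  proof -
    show s: "summable (\<lambda>n. c (Suc n) * r ^ n)"
      using that by (rule summable_powser_split_head[THEN iffD2, rotated]) 
    show "(\<Sum>n. c n * r ^ n) = c 0 + r * (\<Sum>n. c (Suc n) * r ^ n)"
      using powser_split_head(1)[OF that] by (simp add: mult.commute)
  qed
  have mixed: "(\<Sum>n. mehler_mixed u v n * r ^ n)
      = 2 * v * (\<Sum>n. mehler_coeff u v n * r ^ n) - r * (\<Sum>n. mehler_mixed v u n * r ^ n)"
    if r: "\<bar>r\<bar> < 1" for u v r
  proof -
    have sc: "summable (\<lambda>n. mehler_coeff u v n * r ^ n)"
      using mehler_coeff_abs_summable[OF that, of u v]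
      by (intro summable_norm_cancel[of "\<lambda>n. mehler_coeff u v n * r ^ n"]) (simp add: abs_mult power_abs)
    have c0: "mehler_mixed u v 0 = 2 * v * mehler_coeff u v 0"
      by (simp add: mehler_mixed_def mehler_coeff_def hermite_fun_0 hermite_fun_1)
    have cS: "mehler_mixed u v (Suc n) * r ^ n = 2 * v * (mehler_coeff u v (Suc n) * r ^ n) - mehler_mixed v u n * r ^ n" for n
    proof -
      have "mehler_mixed u v (Suc n) = 2 * v * mehler_coeff u v (Suc n) - mehler_mixed v u n"
      proof -
        have "a * (2 * v * b - c * d) / (c * w) = 2 * v * (a * b / (c * w)) - d * a / w"
          if "c \<noteq> 0" "w \<noteq> 0" for a b c d w :: real
          using that by (simp add: field_simps)
        then show ?thesis
          unfolding mehler_mixed_def mehler_coeff_def hermite_fun_rec hermite_norm_Suc by simp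
      qed
      then show ?thesis by (simp only: left_diff_distrib mult.assoc)
    qed
    have "(\<Sum>n. mehler_mixed u v (Suc n) * r ^ n)
        = 2 * v * (\<Sum>n. mehler_coeff u v (Suc n) * r ^ n) - (\<Sum>n. mehler_mixed v u n * r ^ n)"
      unfolding cS
      by (subst suminf_diff[symmetric])
        (auto intro!: summable_mult head(2) sc summable_mehler_mixed r simp: suminf_mult[OF head(2)[OF sc]])
    then show ?thesis
      using head(1)[OF summable_mehler_mixed[OF r, of u v]] head(1)[OF sc] c0 by algebra
  qed
  have diffs_eq: "diffs (mehler_coeff u v) n = (hermite_fun (Suc n) u * hermite_fun (Suc n) v) / hermite_norm n / 2" for u v n
  proof -
    have "a * (p / (2 * a * w)) = p / w / 2" if "a \<noteq> 0" for a p w :: real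
      using that by simp
    then show ?thesis
      unfolding diffs_def mehler_coeff_def hermite_norm_Suc by (metis of_nat_eq_0_iff nat.distinct(1))
  qed
  have K'_eq: "2 * K' r = 2 * x * (\<Sum>n. mehler_mixed x y n * r ^ n)
      - r * (2 * y * (\<Sum>n. mehler_mixed x y n * r ^ n) - 2 * mehler_kernel x y r - 2 * r * K' r)"
    if r: "\<bar>r\<bar> < 1" for r
  proof -
    have c0: "diffs (mehler_coeff x y) 0 = x * mehler_mixed x y 0"
      by (simp add: diffs_eq mehler_mixed_def hermite_fun_0 hermite_fun_1)
    have cS: "diffs (mehler_coeff x y) (Suc n) = x * mehler_mixed x y (Suc n) - y * mehler_mixed x y n
        + real (Suc n) * mehler_coeff x y n" for n
    proof -
      have "(2 * x * X1 - 2 * c * X0) * (2 * y * Y1 - 2 * c * Y0) / (2 * c * w) / 2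
          = x * (X1 * (2 * y * Y1 - 2 * c * Y0) / (2 * c * w)) - y * (X0 * Y1 / w) + c * (X0 * Y0 / w)"
        if "c \<noteq> 0" "w \<noteq> 0" for X0 X1 Y0 Y1 c w :: real
        using that by (simp add: field_simps)
      then show ?thesis
        unfolding diffs_eq mehler_mixed_def mehler_coeff_def hermite_fun_rec hermite_norm_Suc
        by (metis hermite_norm_pos(2) of_nat_eq_0_iff nat.distinct(1))
    qed
    have cS': "real (Suc n) * mehler_coeff x y n * r ^ n = mehler_coeff x y n * r ^ n + real n * mehler_coeff x y n * r ^ n" for n
      by (simp add: algebra_simps)
    have sn: "(\<lambda>n. real n * mehler_coeff x y n * r ^ n) sums (r * K' r)"
    proof -
      have "(\<lambda>n. r * (diffs (mehler_coeff x y) n * r ^ n)) sums (r * K' r)"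
        unfolding K'_def by (intro sums_mult summable_sums summable_K' r)
      then have "(\<lambda>n. real (Suc n) * mehler_coeff x y (Suc n) * r ^ Suc n) sums (r * K' r)"
        by (simp add: diffs_def mult_ac)
      then show ?thesis by (subst (asm) sums_Suc_iff) simp
    qed
    let ?P = "\<Sum>n. mehler_mixed x y n * r ^ n" and ?S = "\<Sum>n. mehler_mixed x y (Suc n) * r ^ n"
    have "(\<lambda>n. x * (mehler_mixed x y (Suc n) * r ^ n) - y * (mehler_mixed x y n * r ^ n)
        + (mehler_coeff x y n * r ^ n + real n * mehler_coeff x y n * r ^ n))
        sums (x * ?S - y * ?P + (mehler_kernel x y r + r * K' r))"
      unfolding mehler_kernel_def
      by (intro sums_add sums_diff sums_mult summable_sums head(2) summable_mehler_mixed summable_K r sn)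
    also have "(\<lambda>n. x * (mehler_mixed x y (Suc n) * r ^ n) - y * (mehler_mixed x y n * r ^ n)
        + (mehler_coeff x y n * r ^ n + real n * mehler_coeff x y n * r ^ n))
        = (\<lambda>n. diffs (mehler_coeff x y) (Suc n) * r ^ n)"
      unfolding cS by (simp add: algebra_simps)
    finally have S: "(\<Sum>n. diffs (mehler_coeff x y) (Suc n) * r ^ n) = x * ?S - y * ?P + (mehler_kernel x y r + r * K' r)"
      by (rule sums_unique[symmetric])
    have "K' r = x * mehler_mixed x y 0 + r * (x * ?S - y * ?P + (mehler_kernel x y r + r * K' r))"
      unfolding K'_def[of r] using head(1)[OF summable_K'[OF r]] S c0 by (simp add: K'_def)
    moreover have "?P = mehler_mixed x y 0 + r * ?S"
      by (rule head(1)[OF summable_mehler_mixed[OF r]])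
    ultimately show ?thesis by (simp add: algebra_simps)
  qed
  have ode: "K' r * (1 - r\<^sup>2)\<^sup>2 = (2 * (x - r * y) * (y - r * x) + r * (1 - r\<^sup>2)) * mehler_kernel x y r"
    if r: "\<bar>r\<bar> < 1" for r
  proof -
    have comm: "mehler_coeff y x = mehler_coeff x y"
      by (auto simp: mehler_coeff_def mult.commute)
    define P where "P = (\<Sum>n. mehler_mixed x y n * r ^ n)"
    define Q where "Q = (\<Sum>n. mehler_mixed y x n * r ^ n)"
    have "P = 2 * y * mehler_kernel x y r - r * Q" "Q = 2 * x * mehler_kernel x y r - r * P"
      using mixed[OF r, of x y] mixed[OF r, of y x] by (auto simp: P_def Q_def mehler_kernel_def comm)
    then have P: "P * (1 - r\<^sup>2) = 2 * (y - r * x) * mehler_kernel x y r"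
      by algebra
    have "K' r * (1 - r\<^sup>2) = (x - r * y) * P + r * mehler_kernel x y r"
      using K'_eq[OF r] unfolding P_def[symmetric] by algebra
    with P show ?thesis by algebra
  qed
  \<comment> \<open>The reciprocal of the claimed value; it solves the adjoint equation, so the product with the
    series is constant.\<close>
  define E where "E r = exp ((x\<^sup>2 + y\<^sup>2 - 2 * r * x * y) / (1 - r\<^sup>2)) * sqrt (1 - r\<^sup>2)" for r
  have "\<exists>c. \<forall>r\<in>{-1<..<1}. mehler_kernel x y r * E r = c"
  proof (rule has_field_derivative_zero_constant)
    fix r :: real assume "r \<in> {-1<..<1}"
    then have r: "\<bar>r\<bar> < 1" by auto
    then have r2: "1 - r\<^sup>2 > 0" by (simp add: abs_square_less_1)
    have "(E has_real_derivative E r * ((- 2 * x * y * (1 - r\<^sup>2) + 2 * r * (x\<^sup>2 + y\<^sup>2 - 2 * r * x * y)) / (1 - r\<^sup>2)\<^sup>2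
        - r / (1 - r\<^sup>2))) (at r)"
    proof -
      let ?q = "\<lambda>r. (x\<^sup>2 + y\<^sup>2 - 2 * r * x * y) / (1 - r\<^sup>2)"
      let ?q' = "(- 2 * x * y * (1 - r\<^sup>2) + 2 * r * (x\<^sup>2 + y\<^sup>2 - 2 * r * x * y)) / (1 - r\<^sup>2)\<^sup>2"
      have num: "((\<lambda>r. x\<^sup>2 + y\<^sup>2 - 2 * r * x * y) has_real_derivative - 2 * x * y) (at r)"
        and den: "((\<lambda>r. 1 - r\<^sup>2) has_real_derivative - 2 * r) (at r)"
        by (auto intro!: derivative_eq_intros)
      have q: "(?q has_real_derivative ?q') (at r)"
        by (rule DERIV_cong[OF DERIV_divide[OF num den]])
          (use r2 in \<open>simp_all add: power2_eq_square algebra_simps\<close>)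
      have "((\<lambda>r. sqrt (1 - r\<^sup>2)) has_real_derivative inverse (sqrt (1 - r\<^sup>2)) / 2 * (- 2 * r)) (at r)"
        by (rule DERIV_chain2[OF DERIV_real_sqrt den]) (rule r2)
      moreover have "inverse (sqrt (1 - r\<^sup>2)) / 2 * (- 2 * r) = sqrt (1 - r\<^sup>2) * (- r / (1 - r\<^sup>2))"
        using r2 real_sqrt_mult_self[of "1 - r\<^sup>2"] by (simp add: divide_simps)
      ultimately have root: "((\<lambda>r. sqrt (1 - r\<^sup>2)) has_real_derivative sqrt (1 - r\<^sup>2) * (- r / (1 - r\<^sup>2))) (at r)"
        by (simp only:)
      have "((\<lambda>r. exp (?q r) * sqrt (1 - r\<^sup>2)) has_real_derivative
          exp (?q r) * ?q' * sqrt (1 - r\<^sup>2) + sqrt (1 - r\<^sup>2) * (- r / (1 - r\<^sup>2)) * exp (?q r)) (at r)"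
        by (rule DERIV_mult[OF DERIV_chain2[OF DERIV_exp q] root])
      then show ?thesis
        unfolding E_def[abs_def] by (rule DERIV_cong) (simp add: algebra_simps)
    qed
    from DERIV_mult[OF K_deriv[OF r] this]
    have "((\<lambda>r. mehler_kernel x y r * E r) has_real_derivative E r * (K' r + mehler_kernel x y r * 
       ((- 2 * x * y * (1 - r\<^sup>2) + 2 * r * (x\<^sup>2 + y\<^sup>2 - 2 * r * x * y)) / (1 - r\<^sup>2)\<^sup>2 - r / (1 - r\<^sup>2)))) (at r)"
      by (simp add: algebra_simps)
    also have "K' r + mehler_kernel x y r * 
       ((- 2 * x * y * (1 - r\<^sup>2) + 2 * r * (x\<^sup>2 + y\<^sup>2 - 2 * r * x * y)) / (1 - r\<^sup>2)\<^sup>2 - r / (1 - r\<^sup>2))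
       = (K' r * (1 - r\<^sup>2)\<^sup>2 + mehler_kernel x y r * (- 2 * x * y * (1 - r\<^sup>2) + 2 * r * (x\<^sup>2 + y\<^sup>2 - 2 * r * x * y) - r * (1 - r\<^sup>2))) / (1 - r\<^sup>2)\<^sup>2"
      using r2 by (simp add: divide_simps) (simp add: power2_eq_square algebra_simps)
    also have "\<dots> = 0"
      unfolding ode[OF r] by (simp add: power2_eq_square algebra_simps)
    finally show "((\<lambda>r. mehler_kernel x y r * E r) has_real_derivative 0) (at r within {-1<..<1})"
      by (simp add: has_field_derivative_at_within)
  qed simp
  then obtain c where "\<forall>r\<in>{-1<..<1}. mehler_kernel x y r * E r = c" ..
  moreover have "r \<in> {-1<..<1}" using assms by auto
  ultimately have "mehler_kernel x y r * E r = mehler_kernel x y 0 * E 0" by simp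
  also have "mehler_kernel x y 0 = exp (- (x\<^sup>2 + y\<^sup>2))"
    unfolding mehler_kernel_def powser_zero
    by (simp add: mehler_coeff_def hermite_fun_0 hermite_norm_def flip: exp_add)
  also have "exp (- (x\<^sup>2 + y\<^sup>2)) * E 0 = 1"
    by (simp add: E_def flip: exp_add)
  finally have inverse: "mehler_kernel x y r * E r = 1" .
  have "sqrt (1 - r\<^sup>2) > 0" using assms by (simp add: abs_square_less_1)
  moreover have "k = exp (- q) / s" if "k * (exp q * s) = 1" "s > 0" for k q s :: real
    using that by (simp add: exp_minus field_simps)
  ultimately show ?thesis
    using inverse unfolding E_def minus_divide_left[symmetric] by blast
qed

corollary mehler_kernel_pos: "\<bar>r\<bar> < 1 \<Longrightarrow> mehler_kernel x y r > 0"
  by (simp add: mehler_formula abs_square_less_1)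

section \<open>Hermite functions in several variables\<close>

lemma sets_inv_gauss [simp, measurable_cong]: "sets inv_gauss = sets borel"
  by (simp add: inv_gauss_def)

lemma space_inv_gauss [simp]: "space inv_gauss = UNIV"
  by (simp add: inv_gauss_def)

lemma sigma_finite_inv_gauss: "sigma_finite_measure (inv_gauss :: (real ^ 'n) measure)"
  unfolding inv_gauss_def by (subst sigma_finite_measure.sigma_finite_iff_density_finite[OF sigma_finite_lborel]) auto

interpretation inv_gauss: sigma_finite_measure "inv_gauss :: (real ^ 'n) measure"
  by (rule sigma_finite_inv_gauss)

lemma lborel_prod_integral:
  fixes f :: "'a::euclidean_space \<Rightarrow> real \<Rightarrow> real"
  assumes "\<And>b. b \<in> Basis \<Longrightarrow> integrable lborel (f b)"
  shows "integrable lborel (\<lambda>x::'a. \<Prod>b\<in>Basis. f b (x \<bullet> b))"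
    and "(LINT x::'a|lborel. (\<Prod>b\<in>Basis. f b (x \<bullet> b))) = (\<Prod>b\<in>Basis. LINT s|lborel. f b s)"
proof -
  interpret product_sigma_finite "\<lambda>_::'a. lborel :: real measure" ..
  have meas [measurable]: "f b \<in> borel_measurable borel" if "b \<in> Basis" for b
    using borel_measurable_integrable[OF assms[OF that]] by simp
  have inner: "(\<Sum>c\<in>Basis. g c *\<^sub>R c) \<bullet> b = g b" if "b \<in> Basis" for g and b :: 'a
    using that by (simp add: inner_sum_left inner_Basis if_distrib cong: if_cong)
  have eq: "(\<Prod>b\<in>Basis. f b ((\<Sum>c\<in>Basis. g c *\<^sub>R c) \<bullet> b)) = (\<Prod>b\<in>Basis. f b (g b))" for g
    by (intro prod.cong refl) (simp add: inner)
  have [measurable]: "(\<lambda>x::'a. \<Prod>b\<in>Basis. f b (x \<bullet> b)) \<in> borel_measurable borel"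
    by (intro borel_measurable_prod measurable_compose[OF _ meas]) auto
  show "integrable lborel (\<lambda>x::'a. \<Prod>b\<in>Basis. f b (x \<bullet> b))"
    by (subst lborel_eq, subst integrable_distr_eq) (auto simp: eq intro!: product_integrable_prod assms)
  show "(LINT x::'a|lborel. (\<Prod>b\<in>Basis. f b (x \<bullet> b))) = (\<Prod>b\<in>Basis. LINT s|lborel. f b s)"
    by (subst lborel_eq, subst integral_distr) (auto simp: eq intro!: product_integral_prod assms)
qed

lemma lborel_vec_prod_integral:
  fixes f :: "'n::finite \<Rightarrow> real \<Rightarrow> real"
  assumes "\<And>j. integrable lborel (f j)"
  shows "integrable lborel (\<lambda>x::real^'n. \<Prod>j\<in>UNIV. f j (x $ j))"
    and "(LINT x::real^'n|lborel. (\<Prod>j\<in>UNIV. f j (x $ j))) = (\<Prod>j\<in>UNIV. LINT s|lborel. f j s)"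
proof -
  have inj: "inj (\<lambda>j::'n. axis j (1::real))"
    by (auto simp: inj_on_def axis_eq_axis)
  have B: "(Basis :: (real^'n) set) = range (\<lambda>j. axis j 1)"
    by (auto simp: Basis_vec_def)
  have prodB: "(\<Prod>b\<in>Basis. G b) = (\<Prod>j\<in>UNIV. G (axis j 1))" for G :: "real^'n \<Rightarrow> real"
    unfolding B by (subst prod.reindex[OF inj]) simp
  let ?f = "\<lambda>b. f (inv (\<lambda>j::'n. axis j (1::real)) b)"
  have "(\<Prod>b\<in>Basis. ?f b (x \<bullet> b)) = (\<Prod>j\<in>UNIV. f j (x $ j))" for x :: "real^'n"
    unfolding prodB by (simp add: inv_f_f[OF inj] inner_axis)
  moreover have "(\<Prod>b\<in>Basis. LINT s|lborel. ?f b s) = (\<Prod>j\<in>UNIV. LINT s|lborel. f j s)"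
    unfolding prodB by (simp add: inv_f_f[OF inj])
  ultimately show "integrable lborel (\<lambda>x::real^'n. \<Prod>j\<in>UNIV. f j (x $ j))"
    and "(LINT x::real^'n|lborel. (\<Prod>j\<in>UNIV. f j (x $ j))) = (\<Prod>j\<in>UNIV. LINT s|lborel. f j s)"
    using lborel_prod_integral[of ?f, OF assms] by simp_all
qed

definition inv_gauss_density :: "real ^ 'n \<Rightarrow> real" where
  "inv_gauss_density x = pi powr (real CARD('n) / 2) * exp ((norm x)\<^sup>2)"

lemma inv_gauss_eq: "inv_gauss = density lborel (\<lambda>x. ennreal (inv_gauss_density x))"
  by (simp add: inv_gauss_def inv_gauss_density_def)

lemma inv_gauss_density_measurable [measurable]: "inv_gauss_density \<in> borel_measurable borel"
  unfolding inv_gauss_density_def by measurable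

lemma inv_gauss_density_pos: "inv_gauss_density x > 0"
  by (simp add: inv_gauss_density_def)

lemma eigenfun_measurable [measurable]: "eigenfun k \<in> borel_measurable borel"
  by (intro borel_measurable_continuous_onI continuous_eigenfun)

lemma norm_vec_sq: "(norm x)\<^sup>2 = (\<Sum>j\<in>UNIV. (x $ j)\<^sup>2)" for x :: "real ^ 'n"
  by (simp add: norm_vec_def L2_set_def sum_nonneg)

definition eigenfun_norm :: "('n::finite \<Rightarrow> nat) \<Rightarrow> real" where
  "eigenfun_norm k = (\<Prod>j\<in>UNIV. pi * hermite_norm (k j))"

lemma eigenfun_norm_pos: "eigenfun_norm k > 0"
  by (auto simp: eigenfun_norm_def intro!: prod_pos mult_pos_pos)

text \<open>
  The density is itself a product, with \<open>\<pi>\<^bsup>d/2\<^esup>\<close> distributed as one factor \<open>\<pi>\<^bsup>1/2\<^esup>\<close> to each coordinate.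
\<close>

lemma eigenfun_orthogonal:
  fixes k l :: "'n::finite \<Rightarrow> nat"
  shows "integrable inv_gauss (\<lambda>x. eigenfun k x * eigenfun l x)"
    and "(LINT x|inv_gauss. eigenfun k x * eigenfun l x) = (if k = l then eigenfun_norm k else 0)"
proof -
  let ?g = "\<lambda>j s. sqrt pi * hermite_weighted (k j) (l j) s"
  have eq: "inv_gauss_density x * (eigenfun k x * eigenfun l x) = (\<Prod>j\<in>UNIV. ?g j (x $ j))" for x :: "real ^ 'n"
  proof -
    have "pi powr (real CARD('n) / 2) = (\<Prod>j\<in>(UNIV::'n set). sqrt pi)"
      by (simp add: powr_half_sqrt[symmetric] powr_powr flip: powr_realpow)
    moreover have "exp ((norm x)\<^sup>2) = (\<Prod>j\<in>UNIV. exp ((x $ j)\<^sup>2))"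
      unfolding norm_vec_sq by (rule exp_sum) simp
    ultimately show ?thesis
      by (simp add: inv_gauss_density_def eigenfun_eq hermite_weighted_def prod.distrib)
  qed
  have int: "integrable lborel (?g j)" for j
    by (intro integrable_mult_right integrable_hermite_weighted)
  show "integrable inv_gauss (\<lambda>x. eigenfun k x * eigenfun l x)"
    unfolding inv_gauss_eq
    by (subst integrable_density) (auto simp: eq inv_gauss_density_pos less_imp_le intro!: lborel_vec_prod_integral int)
  have "(LINT x|inv_gauss. eigenfun k x * eigenfun l x) = (LINT x::real^'n|lborel. (\<Prod>j\<in>UNIV. ?g j (x $ j)))"
    unfolding inv_gauss_eq
    by (subst integral_density) (auto simp: eq inv_gauss_density_pos less_imp_le)
  also have "\<dots> = (\<Prod>j\<in>UNIV. LINT s|lborel. ?g j s)"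
    by (intro lborel_vec_prod_integral int)
  also have "\<dots> = (\<Prod>j\<in>UNIV. if k j = l j then pi * hermite_norm (k j) else 0)"
    by (intro prod.cong refl) (auto simp: LINT_hermite_weighted hermite_norm_def)
  also have "\<dots> = (if k = l then eigenfun_norm k else 0)"
    by (auto simp: eigenfun_norm_def fun_eq_iff intro!: prod_zero)
  finally show "(LINT x|inv_gauss. eigenfun k x * eigenfun l x) = (if k = l then eigenfun_norm k else 0)" .
qed

text \<open>
  The multi-indices that belong to one eigenvalue. Grouping expansions by levels turns functions of \<open>A\<close>
  into multipliers on sequences, and \<open>e\<^bsup>-tA\<^esup> f(x)\<close> into a power series in \<open>e\<^bsup>-2t\<^esup>\<close>.
\<close>

definition level :: "nat \<Rightarrow> ('n::finite \<Rightarrow> nat) set" where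
  "level n = {k. (\<Sum>j\<in>UNIV. k j) = n}"

lemma level_le: "k \<in> level n \<Longrightarrow> k j \<le> n"
  by (auto simp: level_def intro: member_le_sum)

lemma finite_level [simp]: "finite (level n :: ('n::finite \<Rightarrow> nat) set)"
  and card_level_le: "card (level n :: ('n::finite \<Rightarrow> nat) set) \<le> (n + 1) ^ CARD('n)"
proof -
  have sub: "(level n :: ('n \<Rightarrow> nat) set) \<subseteq> PiE UNIV (\<lambda>_. {..n})"
    using level_le by auto
  moreover have fin: "finite (PiE (UNIV::'n set) (\<lambda>_. {..n}))" by (intro finite_PiE) auto
  ultimately show "finite (level n :: ('n \<Rightarrow> nat) set)" by (rule finite_subset)
  from card_mono[OF fin sub] show "card (level n :: ('n::finite \<Rightarrow> nat) set) \<le> (n + 1) ^ CARD('n)"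
    by (simp add: card_PiE)
qed

lemma eigenval_level: "k \<in> level n \<Longrightarrow> eigenval (k :: 'n::finite \<Rightarrow> nat) = 2 * real n + 2 * real CARD('n)"
  by (simp add: eigenval_def level_def)

lemma eigenfun_bound:
  fixes k :: "'n::finite \<Rightarrow> nat"
  assumes "k \<in> level n"
  shows "(eigenfun k x)\<^sup>2 \<le> eigenfun_norm k * (2 * real n + 3) ^ CARD('n)"
proof -
  have "(eigenfun k x)\<^sup>2 = (\<Prod>j\<in>UNIV. (hermite_fun (k j) (x $ j))\<^sup>2)"
    by (simp add: eigenfun_eq prod_power_distrib)
  also have "\<dots> \<le> (\<Prod>j\<in>(UNIV::'n set). pi * hermite_norm (k j) * (2 * real n + 3))"
  proof (intro prod_mono conjI)
    fix j
    have "(hermite_fun (k j) (x $ j))\<^sup>2 \<le> sqrt pi * hermite_norm (k j) * (2 * real (k j) + 3)"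
      using hermite_fun_sup_bound[of "k j" "x $ j"] by (simp add: hermite_norm_def)
    also have "\<dots> \<le> pi * hermite_norm (k j) * (2 * real n + 3)"
      using level_le[OF assms, of j] pi_gt3
      by (intro mult_mono) (auto simp: less_imp_le real_le_lsqrt power2_eq_square intro!: real_le_lsqrt)
    finally show "(hermite_fun (k j) (x $ j))\<^sup>2 \<le> pi * hermite_norm (k j) * (2 * real n + 3)" .
  qed simp
  also have "\<dots> = eigenfun_norm k * (2 * real n + 3) ^ CARD('n)"
    by (simp add: eigenfun_norm_def prod.distrib)
  finally show ?thesis .
qed

definition below :: "nat \<Rightarrow> ('n::finite \<Rightarrow> nat) set" where
  "below N = {k. (\<Sum>j\<in>UNIV. k j) < N}"

lemma below_eq: "below N = (\<Union>n<N. level n)"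
  by (auto simp: below_def level_def)

lemma finite_below [simp]: "finite (below N :: ('n::finite \<Rightarrow> nat) set)"
  unfolding below_eq by (intro finite_UN_I finite_lessThan finite_level)

lemma sum_below:
  fixes f :: "('n::finite \<Rightarrow> nat) \<Rightarrow> 'b::comm_monoid_add"
  shows "(\<Sum>k\<in>below N. f k) = (\<Sum>n<N. \<Sum>k\<in>level n. f k)"
  unfolding below_eq by (rule sum.UNION_disjoint) (simp_all, auto simp: level_def)

lemma filterlim_below:
  "filterlim (below :: nat \<Rightarrow> ('n::finite \<Rightarrow> nat) set) (finite_subsets_at_top UNIV) sequentially"
  unfolding filterlim_finite_subsets_at_top
proof safe
  fix X :: "('n \<Rightarrow> nat) set" assume "finite X"
  have "X \<subseteq> below N" if "N > Max ((\<lambda>k. \<Sum>j\<in>UNIV. k j) ` X)" for N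
    using that \<open>finite X\<close> by (auto simp: below_def dest!: Max_less_iff[THEN iffD1, rotated 2])
  then show "\<forall>\<^sub>F N in sequentially. finite (below N) \<and> X \<subseteq> below N \<and> below N \<subseteq> UNIV"
    by (auto intro!: eventually_mono[OF eventually_gt_at_top])
qed

text \<open>
  The kernel of the orthogonal projection onto the eigenspace of level \<open>n\<close>.
\<close>

definition level_kernel :: "nat \<Rightarrow> real ^ 'n \<Rightarrow> real ^ 'n \<Rightarrow> real" where
  "level_kernel n x y = (\<Sum>k\<in>level n. eigenfun k x * eigenfun k y / eigenfun_norm k)"

text \<open>
  The sum over all multi-indices is the product over the coordinates of the sums in one variable.
\<close>

lemma level_kernel_sums:
  fixes x y :: "real ^ 'n"
  assumes "\<bar>r\<bar> < 1"
  shows "(\<lambda>n. level_kernel n x y * r ^ n) sums (\<Prod>j\<in>UNIV. mehler_kernel (x $ j) (y $ j) r / pi)"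
proof -
  define f where "f j n = mehler_coeff (x $ j) (y $ j) n * r ^ n / pi" for j and n :: nat
  let ?F = "\<lambda>k. \<Prod>j\<in>UNIV. f j (k j)"
  have abs: "(\<lambda>n. norm (f j n)) summable_on UNIV" for j
    unfolding f_def summable_on_UNIV_nonneg_real_iff[OF norm_ge_zero]
    using summable_divide[OF mehler_coeff_abs_summable[OF assms], of "x $ j" "y $ j" pi]
    by (simp add: abs_mult power_abs)
  have inf: "infsum (f j) UNIV = mehler_kernel (x $ j) (y $ j) r / pi" for j
  proof -
    have "f j summable_on UNIV" using abs by (rule abs_summable_summable)
    then have "(f j has_sum infsum (f j) UNIV) UNIV" by simp
    then have "f j sums infsum (f j) UNIV" by (rule has_sum_imp_sums)
    moreover have "f j sums (mehler_kernel (x $ j) (y $ j) r / pi)"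
      unfolding f_def mehler_kernel_def
      by (intro sums_divide summable_sums summable_norm_cancel[of "\<lambda>n. mehler_coeff (x $ j) (y $ j) n * r ^ n"])
        (use mehler_coeff_abs_summable[OF assms, of "x $ j" "y $ j"] in \<open>simp add: abs_mult power_abs\<close>)
    ultimately show ?thesis by (rule sums_unique2)
  qed
  have eq: "infsum ?F UNIV = (\<Prod>j\<in>UNIV. mehler_kernel (x $ j) (y $ j) r / pi)"
    using infsum_prod_PiE_abs[of UNIV f "\<lambda>_. UNIV", OF _ abs] by (simp add: inf PiE_UNIV)
  \<comment> \<open>The value of a family that is not summable is \<open>0\<close> by convention; the value of the product is
    positive by Mehler's formula, so this family is summable.\<close>
  have "infsum ?F UNIV > 0"
    unfolding eq using mehler_kernel_pos[OF assms] by (intro prod_pos) simp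
  then have "?F summable_on UNIV"
    using infsum_not_exists by fastforce
  then have "(?F has_sum (\<Prod>j\<in>UNIV. mehler_kernel (x $ j) (y $ j) r / pi)) UNIV"
    unfolding eq[symmetric] by simp
  then have "((\<lambda>N. sum ?F (below N)) \<longlonglongrightarrow> (\<Prod>j\<in>UNIV. mehler_kernel (x $ j) (y $ j) r / pi))"
    unfolding has_sum_def by (rule filterlim_compose[OF _ filterlim_below])
  also have "(\<lambda>N. sum ?F (below N)) = (\<lambda>N. \<Sum>n<N. level_kernel n x y * r ^ n)"
  proof (intro ext)
    fix N
    have "?F k = eigenfun k x * eigenfun k y / eigenfun_norm k * r ^ n" if "k \<in> level n" for k n
    proof -
      have "(\<Prod>j\<in>UNIV. r ^ k j) = r ^ n" using that by (simp add: level_def flip: power_sum)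
      then show ?thesis
        by (simp add: f_def eigenfun_eq eigenfun_norm_def mehler_coeff_def prod.distrib prod_dividef)
    qed
    then show "sum ?F (below N) = (\<Sum>n<N. level_kernel n x y * r ^ n)"
      unfolding sum_below level_kernel_def sum_distrib_right by (intro sum.cong refl) auto
  qed
  finally show ?thesis unfolding sums_def .
qed

section \<open>A maximal theorem for symmetric positive semigroups\<close>

definition sqnorm :: "'a measure \<Rightarrow> ('a \<Rightarrow> ennreal) \<Rightarrow> ennreal" where
  "sqnorm M g = (\<integral>\<^sup>+x. (g x)\<^sup>2 \<partial>M)"

lemma sqnorm_cmult: "g \<in> borel_measurable M \<Longrightarrow> sqnorm M (\<lambda>x. c * g x) = c\<^sup>2 * sqnorm M g"
  by (simp add: sqnorm_def power_mult_distrib nn_integral_cmult)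

lemma ennreal_sq_mono_iff: "(a::ennreal)\<^sup>2 \<le> b\<^sup>2 \<longleftrightarrow> a \<le> b"
proof
  assume *: "a\<^sup>2 \<le> b\<^sup>2"
  show "a \<le> b"
  proof (rule ccontr)
    assume "\<not> a \<le> b"
    then have "b < a" by simp
    then have "b * b < a * a"
      by (cases a; cases b)
        (auto simp: ennreal_top_mult ennreal_mult_less_top less_top ennreal_less_iff mult_strict_mono
           ennreal_mult_top simp flip: ennreal_mult)
    with * show False by (simp add: power2_eq_square)
  qed
qed (rule power_mono, simp_all)

lemma ennreal_sq_add_le: "((a::ennreal) + b)\<^sup>2 \<le> 2 * a\<^sup>2 + 2 * b\<^sup>2"
proof (cases a; cases b)
  fix x y assume ab: "a = ennreal x" "x \<ge> 0" "b = ennreal y" "y \<ge> 0"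
  have "(x + y)\<^sup>2 \<le> 2 * x\<^sup>2 + 2 * y\<^sup>2"
    using sum_squares_bound[of x y] by (simp add: power2_sum)
  then have "ennreal ((x + y)\<^sup>2) \<le> ennreal (2 * x\<^sup>2 + 2 * y\<^sup>2)"
    by (rule ennreal_leI)
  also have "\<dots> = ennreal (2 * x\<^sup>2) + ennreal (2 * y\<^sup>2)"
    by (rule ennreal_plus) simp_all
  also have "\<dots> = 2 * (ennreal x)\<^sup>2 + 2 * (ennreal y)\<^sup>2"
    using ab by (simp add: ennreal_power ennreal_mult'')
  also have "ennreal ((x + y)\<^sup>2) = (ennreal x + ennreal y)\<^sup>2"
    using ab by (simp add: ennreal_power flip: ennreal_plus)
  finally show ?thesis using ab by simp
qed (auto simp: power2_eq_square ennreal_mult_top ennreal_top_mult top_add)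

text \<open>
  Squaring commutes with suprema because every extended nonnegative number is the square of \<^const>\<open>ennsqrt\<close>.
\<close>

lemma Sup_sq_le:
  assumes "\<And>i. i \<in> I \<Longrightarrow> (f i)\<^sup>2 \<le> (Z::ennreal)"
  shows "(SUP i\<in>I. f i)\<^sup>2 \<le> Z"
proof -
  have "(SUP i\<in>I. f i) \<le> ennsqrt Z"
    using assms by (intro SUP_least) (simp add: ennsqrt_power2 ennreal_sq_mono_iff[of _ "ennsqrt Z", symmetric])
  then have "(SUP i\<in>I. f i)\<^sup>2 \<le> (ennsqrt Z)\<^sup>2" by (simp add: ennreal_sq_mono_iff)
  then show ?thesis by (simp add: ennsqrt_power2)
qed

text \<open>
  Everything is stated for functions with values in \<open>[0,\<infinity>]\<close>, so that sums and integrals may be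
  interchanged freely. The semigroup law and the contraction property are only assumed on \<open>L\<^sup>2\<close>, where
  they can be read off from an orthogonal expansion. The index \<open>0\<close> is excluded from both since the
  identity has no kernel.
\<close>

locale symmetric_positive_semigroup = sigma_finite_measure M for M :: "'a measure" +
  fixes K :: "nat \<Rightarrow> 'a \<Rightarrow> 'a \<Rightarrow> ennreal"
  assumes K_measurable [measurable]: "(\<lambda>(x, y). K n x y) \<in> borel_measurable (M \<Otimes>\<^sub>M M)"
    and K_sym: "K n x y = K n y x"
    and K_semigroup: "\<lbrakk>m \<ge> 1; n \<ge> 1; g \<in> borel_measurable M; sqnorm M g < \<infinity>\<rbrakk> \<Longrightarrow>
      (\<integral>\<^sup>+y. K m x y * (\<integral>\<^sup>+z. K n y z * g z \<partial>M) \<partial>M) = (\<integral>\<^sup>+z. K (m + n) x z * g z \<partial>M)"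
    and K_contraction: "\<lbrakk>n \<ge> 1; g \<in> borel_measurable M; sqnorm M g < \<infinity>\<rbrakk> \<Longrightarrow>
      sqnorm M (\<lambda>x. \<integral>\<^sup>+y. K n x y * g y \<partial>M) \<le> sqnorm M g"
begin

definition kernel_op :: "nat \<Rightarrow> ('a \<Rightarrow> ennreal) \<Rightarrow> 'a \<Rightarrow> ennreal" where
  "kernel_op n g x = (\<integral>\<^sup>+y. K n x y * g y \<partial>M)"

definition avg :: "nat \<Rightarrow> ('a \<Rightarrow> ennreal) \<Rightarrow> 'a \<Rightarrow> ennreal" where
  "avg n g x = ennreal (1 / real n) * (\<Sum>j=1..n. kernel_op j g x)"

definition pairing :: "('a \<Rightarrow> ennreal) \<Rightarrow> ('a \<Rightarrow> ennreal) \<Rightarrow> ennreal" where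
  "pairing g h = (\<integral>\<^sup>+x. g x * h x \<partial>M)"

lemma kernel_op_measurable [measurable]:
  assumes [measurable]: "g \<in> borel_measurable M"
  shows "kernel_op n g \<in> borel_measurable M"
  unfolding kernel_op_def[abs_def] by measurable

lemma avg_measurable [measurable]: "g \<in> borel_measurable M \<Longrightarrow> avg n g \<in> borel_measurable M"
  unfolding avg_def[abs_def] by measurable

lemma K_section_measurable [measurable]: "x \<in> space M \<Longrightarrow> K n x \<in> borel_measurable M"
  using measurable_compose[OF measurable_Pair1' K_measurable[of n], of x] by (simp add: comp_def)

lemma pairing_kernel_op_sym:
  assumes [measurable]: "g \<in> borel_measurable M" "h \<in> borel_measurable M"
  shows "pairing (kernel_op n g) h = pairing g (kernel_op n h)"
proof -
  interpret pair_sigma_finite M M ..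
  have "pairing (kernel_op n g) h = (\<integral>\<^sup>+x. (\<integral>\<^sup>+y. K n x y * g y * h x \<partial>M) \<partial>M)"
    unfolding pairing_def kernel_op_def by (intro nn_integral_cong nn_integral_multc[symmetric]) measurable
  also have "\<dots> = (\<integral>\<^sup>+y. (\<integral>\<^sup>+x. K n x y * g y * h x \<partial>M) \<partial>M)"
    by (rule Fubini') measurable
  also have "\<dots> = (\<integral>\<^sup>+y. g y * (\<integral>\<^sup>+x. K n y x * h x \<partial>M) \<partial>M)"
    by (intro nn_integral_cong) (subst nn_integral_cmult[symmetric], auto simp: K_sym[of n] mult_ac intro!: nn_integral_cong)
  finally show ?thesis by (simp add: pairing_def kernel_op_def)
qed

lemma kernel_op_sum:
  assumes [measurable]: "\<And>i. i \<in> I \<Longrightarrow> f i \<in> borel_measurable M" and "x \<in> space M"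
  shows "kernel_op n (\<lambda>y. \<Sum>i\<in>I. f i y) x = (\<Sum>i\<in>I. kernel_op n (f i) x)"
  unfolding kernel_op_def using assms by (subst nn_integral_sum[symmetric]) (auto simp: sum_distrib_left)

lemma kernel_op_cmult:
  assumes [measurable]: "f \<in> borel_measurable M" and "x \<in> space M"
  shows "kernel_op n (\<lambda>y. c * f y) x = c * kernel_op n f x"
  unfolding kernel_op_def using assms by (subst nn_integral_cmult[symmetric]) (auto simp: mult_ac)

lemma avg_sum:
  assumes [measurable]: "\<And>i. i \<in> I \<Longrightarrow> f i \<in> borel_measurable M" and "x \<in> space M"
  shows "avg n (\<lambda>y. \<Sum>i\<in>I. f i y) x = (\<Sum>i\<in>I. avg n (f i) x)"
proof -
  have "(\<Sum>j=1..n. kernel_op j (\<lambda>y. \<Sum>i\<in>I. f i y) x) = (\<Sum>j=1..n. \<Sum>i\<in>I. kernel_op j (f i) x)"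
    by (intro sum.cong refl kernel_op_sum assms)
  also have "\<dots> = (\<Sum>i\<in>I. \<Sum>j=1..n. kernel_op j (f i) x)" by (rule sum.swap)
  finally show ?thesis by (simp add: avg_def sum_distrib_left)
qed

lemma pairing_sum_left:
  assumes "\<And>i. i \<in> I \<Longrightarrow> f i \<in> borel_measurable M" "h \<in> borel_measurable M"
  shows "pairing (\<lambda>x. \<Sum>i\<in>I. f i x) h = (\<Sum>i\<in>I. pairing (f i) h)"
  unfolding pairing_def sum_distrib_right using assms by (intro nn_integral_sum) auto

lemma pairing_commute: "pairing f h = pairing h f"
  by (simp add: pairing_def mult.commute)

lemma pairing_cong: "(\<And>x. x \<in> space M \<Longrightarrow> f x = f' x) \<Longrightarrow> (\<And>x. x \<in> space M \<Longrightarrow> h x = h' x) \<Longrightarrow> pairing f h = pairing f' h'"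
  unfolding pairing_def by (intro nn_integral_cong) simp

lemma pairing_cmult_left: "f \<in> borel_measurable M \<Longrightarrow> h \<in> borel_measurable M \<Longrightarrow> pairing (\<lambda>x. c * f x) h = c * pairing f h"
  unfolding pairing_def by (subst nn_integral_cmult[symmetric]) (auto simp: mult_ac)

lemma pairing_avg_sym:
  assumes [measurable]: "g \<in> borel_measurable M" "h \<in> borel_measurable M"
  shows "pairing (avg n g) h = pairing g (avg n h)"
proof -
  have "pairing (avg n g) h = ennreal (1 / real n) * (\<Sum>j=1..n. pairing (kernel_op j g) h)"
    unfolding avg_def[abs_def] by (simp add: pairing_cmult_left pairing_sum_left)
  also have "\<dots> = ennreal (1 / real n) * (\<Sum>j=1..n. pairing (kernel_op j h) g)"
    by (simp add: pairing_kernel_op_sym pairing_commute[of _ g])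
  also have "\<dots> = pairing (avg n h) g"
    unfolding avg_def[abs_def] by (simp add: pairing_cmult_left pairing_sum_left)
  finally show ?thesis by (simp add: pairing_commute)
qed

lemma avg_avg_le_aux:
  assumes [measurable]: "g \<in> borel_measurable M" and "sqnorm M g < \<infinity>" and x: "x \<in> space M"
    and mn: "1 \<le> m" "m \<le> n"
  shows "ennreal (1 / real n) * (ennreal (1 / real m) * (\<Sum>i=1..n. \<Sum>j=1..m. kernel_op (i + j) g x)) \<le> 2 * avg (2 * n) g x"
proof -
  have "(\<Sum>i=1..n. \<Sum>j=1..m. kernel_op (i + j) g x) = (\<Sum>j=1..m. \<Sum>i=1..n. kernel_op (i + j) g x)"
    by (rule sum.swap)
  also have "\<dots> \<le> (\<Sum>j=1..m. \<Sum>l=1..2 * n. kernel_op l g x)"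
  proof (rule sum_mono)
    fix j assume j: "j \<in> {1..m}"
    have "(\<Sum>i=1..n. kernel_op (i + j) g x) = (\<Sum>l\<in>(\<lambda>i. i + j) ` {1..n}. kernel_op l g x)"
      by (subst sum.reindex) (auto simp: inj_on_def)
    also have "\<dots> \<le> (\<Sum>l=1..2 * n. kernel_op l g x)"
      using j mn by (intro sum_mono2) auto
    finally show "(\<Sum>i=1..n. kernel_op (i + j) g x) \<le> (\<Sum>l=1..2 * n. kernel_op l g x)" .
  qed
  also have "\<dots> = ennreal (real m) * (\<Sum>l=1..2 * n. kernel_op l g x)"
    by (simp add: ennreal_of_nat_eq_real_of_nat)
  finally have "ennreal (1 / real n) * (ennreal (1 / real m) * (\<Sum>i=1..n. \<Sum>j=1..m. kernel_op (i + j) g x))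
      \<le> ennreal (1 / real n) * (ennreal (1 / real m) * (ennreal (real m) * (\<Sum>l=1..2 * n. kernel_op l g x)))"
    by (intro mult_left_mono) auto
  also have "\<dots> = (ennreal (1 / real n) * (ennreal (1 / real m) * ennreal (real m))) * (\<Sum>l=1..2 * n. kernel_op l g x)"
    by (simp add: mult.assoc)
  also have "ennreal (1 / real n) * (ennreal (1 / real m) * ennreal (real m)) = 2 * ennreal (1 / real (2 * n))"
  proof -
    have "ennreal (1 / real m) * ennreal (real m) = 1"
      using mn by (simp flip: ennreal_mult')
    moreover have "ennreal (2 * (1 / real (2 * n))) = 2 * ennreal (1 / real (2 * n))"
      by (subst ennreal_mult') simp_all
    ultimately show ?thesis by simp
  qed
  finally show ?thesis by (simp add: avg_def mult.assoc)
qed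

lemma avg_avg:
  assumes [measurable]: "g \<in> borel_measurable M" and fin: "sqnorm M g < \<infinity>" and x: "x \<in> space M"
    and mn: "1 \<le> m" "1 \<le> n"
  shows "avg n (avg m g) x = ennreal (1 / real n) * (ennreal (1 / real m) * (\<Sum>i=1..n. \<Sum>j=1..m. kernel_op (i + j) g x))"
proof -
  have "kernel_op i (avg m g) x = ennreal (1 / real m) * (\<Sum>j=1..m. kernel_op (i + j) g x)" if "i \<in> {1..n}" for i
  proof -
    have "kernel_op i (avg m g) x = ennreal (1 / real m) * kernel_op i (\<lambda>y. \<Sum>j=1..m. kernel_op j g y) x"
      unfolding avg_def[abs_def] by (rule kernel_op_cmult[OF _ x]) measurable
    also have "kernel_op i (\<lambda>y. \<Sum>j=1..m. kernel_op j g y) x = (\<Sum>j=1..m. kernel_op i (kernel_op j g) x)"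
      by (rule kernel_op_sum[OF _ x]) measurable
    also have "\<dots> = (\<Sum>j=1..m. kernel_op (i + j) g x)"
      unfolding kernel_op_def using that by (intro sum.cong refl K_semigroup fin) auto
    finally show ?thesis .
  qed
  then show ?thesis
    unfolding avg_def[of n] by (simp add: sum_distrib_left)
qed

text \<open>
  The product of the averages over \<open>n\<close> and \<open>m \<le> n\<close> steps is the mean of the \<open>T\<^bsup>i+j\<^esup>\<close> with \<open>i \<le> n\<close> and
  \<open>j \<le> m\<close>. Each power \<open>T\<^sup>l\<close> with \<open>l \<le> 2 n\<close> occurs at most \<open>m\<close> times, hence with weight at most \<open>1 / n\<close>.
  Positivity allows the missing powers to be added.
\<close>

lemma avg_avg_le:
  assumes [measurable]: "g \<in> borel_measurable M" and fin: "sqnorm M g < \<infinity>" and x: "x \<in> space M"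
    and mn: "1 \<le> m" "1 \<le> n"
  shows "avg n (avg m g) x \<le> 2 * avg (2 * n) g x + 2 * avg (2 * m) g x"
proof (cases "m \<le> n")
  case True
  have "avg n (avg m g) x \<le> 2 * avg (2 * n) g x"
    unfolding avg_avg[OF assms] by (rule avg_avg_le_aux) (use assms True in auto)
  then show ?thesis by (rule order_trans) simp
next
  case False
  have "avg n (avg m g) x = ennreal (1 / real m) * (ennreal (1 / real n) * (\<Sum>i=1..m. \<Sum>j=1..n. kernel_op (i + j) g x))"
    unfolding avg_avg[OF assms] by (subst sum.swap) (simp add: add.commute mult.left_commute)
  also have "\<dots> \<le> 2 * avg (2 * m) g x"
    by (rule avg_avg_le_aux) (use assms False in auto)
  finally show ?thesis by (rule order_trans) simp
qed

lemma sqnorm_sum_le: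
  assumes "finite I" "\<And>i. i \<in> I \<Longrightarrow> f i \<in> borel_measurable M" "\<And>i. i \<in> I \<Longrightarrow> sqnorm M (f i) \<le> B"
  shows "sqnorm M (\<lambda>x. \<Sum>i\<in>I. f i x) \<le> (of_nat (card I))\<^sup>2 * B"
proof -
  have "sqnorm M (\<lambda>x. \<Sum>i\<in>I. f i x) = (\<integral>\<^sup>+x. (\<Sum>i\<in>I. \<Sum>j\<in>I. f i x * f j x) \<partial>M)"
    unfolding sqnorm_def power2_eq_square sum_product by simp
  also have "\<dots> = (\<Sum>i\<in>I. \<Sum>j\<in>I. pairing (f i) (f j))"
    unfolding pairing_def using assms by (subst nn_integral_sum) (auto simp: nn_integral_sum)
  also have "\<dots> \<le> (\<Sum>i\<in>I. \<Sum>j\<in>I. B)"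
  proof (intro sum_mono)
    fix i j assume ij: "i \<in> I" "j \<in> I"
    have "(pairing (f i) (f j))\<^sup>2 \<le> sqnorm M (f i) * sqnorm M (f j)"
      unfolding pairing_def sqnorm_def using assms ij by (intro Cauchy_Schwarz_nn_integral) auto
    also have "\<dots> \<le> B * B" using assms ij by (intro mult_mono) auto
    finally show "pairing (f i) (f j) \<le> B"
      by (simp add: ennreal_sq_mono_iff flip: power2_eq_square)
  qed
  also have "\<dots> = (of_nat (card I))\<^sup>2 * B"
    by (simp add: power2_eq_square mult.assoc)
  finally show ?thesis .
qed

lemma sqnorm_avg_le:
  assumes [measurable]: "g \<in> borel_measurable M" and "sqnorm M g < \<infinity>" "n \<ge> 1"
  shows "sqnorm M (avg n g) \<le> sqnorm M g"
proof -
  have "sqnorm M (avg n g) = (ennreal (1 / real n))\<^sup>2 * sqnorm M (\<lambda>x. \<Sum>j=1..n. kernel_op j g x)"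
    unfolding avg_def[abs_def] by (rule sqnorm_cmult) measurable
  also have "sqnorm M (\<lambda>x. \<Sum>j=1..n. kernel_op j g x) \<le> (of_nat (card {1..n}))\<^sup>2 * sqnorm M g"
    using K_contraction[OF _ assms(1,2)] by (intro sqnorm_sum_le) (auto simp: kernel_op_def[abs_def])
  also have "(ennreal (1 / real n))\<^sup>2 * ((of_nat (card {1..n}))\<^sup>2 * sqnorm M g)
      = (ennreal (1 / real n) * ennreal (real n))\<^sup>2 * sqnorm M g"
    by (simp add: power_mult_distrib mult.assoc ennreal_of_nat_eq_real_of_nat)
  also have "ennreal (1 / real n) * ennreal (real n) = 1"
    using assms by (simp flip: ennreal_mult')
  finally show ?thesis by (simp add: mult_left_mono)
qed

text \<open>
  A linear operator that applies to the points of \<open>E\<^sub>i\<close> the average over \<open>t\<^sub>i\<close> steps. For suitable \<open>E\<close> it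
  returns the maximum of finitely many averages.
\<close>

definition linearized_avg :: "nat \<Rightarrow> (nat \<Rightarrow> nat) \<Rightarrow> (nat \<Rightarrow> 'a set) \<Rightarrow> ('a \<Rightarrow> ennreal) \<Rightarrow> 'a \<Rightarrow> ennreal" where
  "linearized_avg N t E g x = (\<Sum>i<N. indicator (E i) x * avg (t i) g x)"

lemma linearized_avg_measurable [measurable]:
  assumes "\<And>i. E i \<in> sets M" "g \<in> borel_measurable M"
  shows "linearized_avg N t E g \<in> borel_measurable M"
proof -
  note [measurable] = assms
  show ?thesis unfolding linearized_avg_def[abs_def] by measurable
qed

text \<open>
  A crude bound that depends on the number \<open>N\<close> of sets. It serves only as the starting point of the
  iteration below.
\<close>

lemma sqnorm_linearized_avg_le:
  assumes "\<And>i. E i \<in> sets M" "\<And>i. t i \<ge> 1" "g \<in> borel_measurable M" "sqnorm M g < \<infinity>"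
  shows "sqnorm M (linearized_avg N t E g) \<le> ennreal ((real N)\<^sup>2) * sqnorm M g"
proof -
  note [measurable] = assms(1,3)
  have "sqnorm M (linearized_avg N t E g) \<le> (of_nat (card {..<N}))\<^sup>2 * sqnorm M g"
    unfolding linearized_avg_def[abs_def]
  proof (rule sqnorm_sum_le)
    fix i
    have "sqnorm M (\<lambda>x. indicator (E i) x * avg (t i) g x) \<le> sqnorm M (avg (t i) g)"
      unfolding sqnorm_def by (intro nn_integral_mono power_mono) (auto simp: indicator_def)
    also have "\<dots> \<le> sqnorm M g" by (intro sqnorm_avg_le assms)
    finally show "sqnorm M (\<lambda>x. indicator (E i) x * avg (t i) g x) \<le> sqnorm M g" .
  qed simp_all
  then show ?thesis by (simp add: ennreal_of_nat_eq_real_of_nat ennreal_power)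
qed

text \<open>
  This is the method of \<open>T T\<^sup>*\<close>. Let \<open>L\<close> be the linearized operator, \<open>\<phi> = L g\<close>, and let \<open>\<psi>\<close> be the image of
  \<open>\<phi>\<close> under the adjoint of \<open>L\<close>. Then the squared norm of \<open>\<phi>\<close> is the inner product of \<open>\<psi>\<close> and \<open>g\<close>. The
  squared norm of \<open>\<psi>\<close> is a double sum of inner products with products of averages; by the estimate for
  these products it is at most four times the inner product of \<open>\<phi>\<close> with \<open>L' \<phi>\<close>, where \<open>L'\<close> has the same
  sets \<open>E\<close> and doubled times. A bound \<open>C\<close> for \<open>L'\<close> therefore yields the bound \<open>2 C\<^bsup>1/2\<^esup>\<close> for \<open>L\<close>. Doubling
  the times does not change the number of sets, which makes iteration possible.
\<close>

lemma linearized_avg_improve: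
  assumes E: "\<And>i. E i \<in> sets M" "disjoint_family E" and t: "\<And>i. t i \<ge> 1" and "C \<ge> 0"
    and bound: "\<And>h. h \<in> borel_measurable M \<Longrightarrow> sqnorm M h < \<infinity> \<Longrightarrow>
      sqnorm M (linearized_avg N (\<lambda>i. 2 * t i) E h) \<le> (ennreal C)\<^sup>2 * sqnorm M h"
    and g: "g \<in> borel_measurable M" "sqnorm M g < \<infinity>"
  shows "sqnorm M (linearized_avg N t E g) \<le> ennreal (4 * C) * sqnorm M g"
proof -
  note [measurable] = E(1) g(1)
  define \<phi> where "\<phi> = linearized_avg N t E g"
  define \<phi>i where "\<phi>i i x = indicator (E i) x * \<phi> x" for i x
  define \<psi> where "\<psi> x = (\<Sum>i<N. avg (t i) (\<phi>i i) x)" for x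
  have [measurable]: "\<phi> \<in> borel_measurable M" unfolding \<phi>_def by measurable
  have [measurable]: "\<phi>i i \<in> borel_measurable M" for i unfolding \<phi>i_def by measurable
  have [measurable]: "\<psi> \<in> borel_measurable M" unfolding \<psi>_def[abs_def] by measurable
  have "sqnorm M \<phi> \<le> ennreal ((real N)\<^sup>2) * sqnorm M g"
    unfolding \<phi>_def by (rule sqnorm_linearized_avg_le) (use E t g in auto)
  also have "\<dots> < \<infinity>" using g(2) by (simp add: ennreal_mult_less_top)
  finally have fin: "sqnorm M \<phi> < \<infinity>" .
  have fini: "sqnorm M (\<phi>i i) < \<infinity>" for i
  proof -
    have "sqnorm M (\<phi>i i) \<le> sqnorm M \<phi>"
      unfolding sqnorm_def \<phi>i_def by (intro nn_integral_mono power_mono) (auto simp: indicator_def)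
    with fin show ?thesis by simp
  qed
  have sum_\<phi>i: "(\<Sum>i<N. \<phi>i i x) = \<phi> x" for x
  proof (cases "\<exists>i<N. x \<in> E i")
    case True
    then obtain i where i: "i < N" "x \<in> E i" by blast
    have "x \<in> E j \<longleftrightarrow> j = i" for j
      using i E(2) by (auto simp: disjoint_family_on_def)
    then have "(\<Sum>j<N. \<phi>i j x) = (\<Sum>j<N. if j = i then \<phi> x else 0)"
      by (intro sum.cong) (auto simp: \<phi>i_def)
    with i show ?thesis by simp
  next
    case False
    then show ?thesis by (auto simp: \<phi>i_def \<phi>_def linearized_avg_def)
  qed
  have sq_pairing: "sqnorm M h = pairing h h" for h
    by (simp add: sqnorm_def pairing_def power2_eq_square)
  have "sqnorm M \<phi> = (\<Sum>i<N. pairing (\<lambda>x. indicator (E i) x * avg (t i) g x) \<phi>)"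
    unfolding sq_pairing by (subst (1) \<phi>_def, subst linearized_avg_def[abs_def], rule pairing_sum_left) auto
  also have "\<dots> = (\<Sum>i<N. pairing (avg (t i) g) (\<phi>i i))"
    by (simp add: pairing_def \<phi>i_def mult_ac)
  also have "\<dots> = (\<Sum>i<N. pairing (avg (t i) (\<phi>i i)) g)"
    by (intro sum.cong refl) (simp add: pairing_avg_sym pairing_commute[of g])
  also have "\<dots> = pairing \<psi> g"
    unfolding \<psi>_def[abs_def] by (rule pairing_sum_left[symmetric]) auto
  finally have "(sqnorm M \<phi>)\<^sup>2 = (pairing \<psi> g)\<^sup>2" by simp
  also have "\<dots> \<le> sqnorm M \<psi> * sqnorm M g"
    unfolding pairing_def sqnorm_def by (intro Cauchy_Schwarz_nn_integral) auto
  finally have dual: "(sqnorm M \<phi>)\<^sup>2 \<le> sqnorm M \<psi> * sqnorm M g" .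
  \<comment> \<open>The inner product of \<open>\<phi>\<close> with the linearized operator for the doubled times.\<close>
  define S where "S = pairing (linearized_avg N (\<lambda>i. 2 * t i) E \<phi>) \<phi>"
  have S_eq: "S = (\<Sum>i<N. pairing (\<phi>i i) (avg (2 * t i) \<phi>))"
  proof -
    have "S = (\<Sum>i<N. pairing (\<lambda>x. indicator (E i) x * avg (2 * t i) \<phi> x) \<phi>)"
      unfolding S_def linearized_avg_def[abs_def] by (rule pairing_sum_left) auto
    then show ?thesis by (simp add: pairing_def \<phi>i_def mult_ac)
  qed
  have S1: "(\<Sum>i<N. \<Sum>j<N. pairing (\<phi>i i) (avg (2 * t i) (\<phi>i j))) = S"
    unfolding S_eq
  proof (intro sum.cong refl)
    fix i
    have "(\<Sum>j<N. pairing (\<phi>i i) (avg (2 * t i) (\<phi>i j))) = (\<Sum>j<N. pairing (avg (2 * t i) (\<phi>i j)) (\<phi>i i))"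
      by (simp add: pairing_commute)
    also have "\<dots> = pairing (\<lambda>x. \<Sum>j<N. avg (2 * t i) (\<phi>i j) x) (\<phi>i i)"
      by (rule pairing_sum_left[symmetric]) auto
    also have "\<dots> = pairing (avg (2 * t i) \<phi>) (\<phi>i i)"
      by (intro pairing_cong refl) (simp add: avg_sum[symmetric] sum_\<phi>i)
    finally show "(\<Sum>j<N. pairing (\<phi>i i) (avg (2 * t i) (\<phi>i j))) = pairing (\<phi>i i) (avg (2 * t i) \<phi>)"
      by (simp add: pairing_commute)
  qed
  have S2: "(\<Sum>i<N. \<Sum>j<N. pairing (\<phi>i i) (avg (2 * t j) (\<phi>i j))) = S"
  proof -
    have "(\<Sum>i<N. \<Sum>j<N. pairing (\<phi>i i) (avg (2 * t j) (\<phi>i j)))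
        = (\<Sum>j<N. \<Sum>i<N. pairing (\<phi>i j) (avg (2 * t j) (\<phi>i i)))"
    proof (subst sum.swap, intro sum.cong refl)
      fix i j
      have "pairing (\<phi>i i) (avg (2 * t j) (\<phi>i j)) = pairing (avg (2 * t j) (\<phi>i i)) (\<phi>i j)"
        by (rule pairing_avg_sym[symmetric]) auto
      then show "pairing (\<phi>i i) (avg (2 * t j) (\<phi>i j)) = pairing (\<phi>i j) (avg (2 * t j) (\<phi>i i))"
        by (simp only: pairing_commute[of _ "\<phi>i j"])
    qed
    with S1 show ?thesis by simp
  qed
  have "sqnorm M \<psi> = (\<Sum>i<N. pairing (avg (t i) (\<phi>i i)) \<psi>)"
    unfolding sq_pairing by (subst (1) \<psi>_def[abs_def], rule pairing_sum_left) auto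
  also have "\<dots> = (\<Sum>i<N. \<Sum>j<N. pairing (avg (t j) (\<phi>i j)) (avg (t i) (\<phi>i i)))"
    by (subst pairing_commute, unfold \<psi>_def[abs_def], intro sum.cong refl pairing_sum_left) auto
  also have "\<dots> = (\<Sum>i<N. \<Sum>j<N. pairing (\<phi>i i) (avg (t i) (avg (t j) (\<phi>i j))))"
    by (intro sum.cong refl) (simp add: pairing_commute[of "avg _ _" "avg _ _"] pairing_avg_sym)
  also have "\<dots> \<le> (\<Sum>i<N. \<Sum>j<N. 2 * pairing (\<phi>i i) (avg (2 * t i) (\<phi>i j)) + 2 * pairing (\<phi>i i) (avg (2 * t j) (\<phi>i j)))"
  proof (intro sum_mono)
    fix i j
    have "pairing (\<phi>i i) (avg (t i) (avg (t j) (\<phi>i j)))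
        \<le> (\<integral>\<^sup>+x. \<phi>i i x * (2 * avg (2 * t i) (\<phi>i j) x + 2 * avg (2 * t j) (\<phi>i j) x) \<partial>M)"
      unfolding pairing_def using t fini by (intro nn_integral_mono mult_left_mono avg_avg_le) auto
    also have "\<dots> = (\<integral>\<^sup>+x. 2 * (\<phi>i i x * avg (2 * t i) (\<phi>i j) x) + 2 * (\<phi>i i x * avg (2 * t j) (\<phi>i j) x) \<partial>M)"
      by (simp add: distrib_left mult_ac)
    also have "\<dots> = 2 * pairing (\<phi>i i) (avg (2 * t i) (\<phi>i j)) + 2 * pairing (\<phi>i i) (avg (2 * t j) (\<phi>i j))"
      unfolding pairing_def by (subst nn_integral_add) (auto simp: nn_integral_cmult)
    finally show "pairing (\<phi>i i) (avg (t i) (avg (t j) (\<phi>i j)))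
        \<le> 2 * pairing (\<phi>i i) (avg (2 * t i) (\<phi>i j)) + 2 * pairing (\<phi>i i) (avg (2 * t j) (\<phi>i j))" .
  qed
  also have "\<dots> = 2 * S + 2 * S"
    unfolding sum.distrib sum_distrib_left[symmetric] S1 S2 ..
  also have "\<dots> = 4 * S" by (simp flip: distrib_right)
  finally have \<psi>_le: "sqnorm M \<psi> \<le> 4 * S" .
  have "S\<^sup>2 \<le> sqnorm M (linearized_avg N (\<lambda>i. 2 * t i) E \<phi>) * sqnorm M \<phi>"
    unfolding S_def pairing_def sqnorm_def by (intro Cauchy_Schwarz_nn_integral) auto
  also have "\<dots> \<le> ((ennreal C)\<^sup>2 * sqnorm M \<phi>) * sqnorm M \<phi>"
    using fin by (intro mult_right_mono bound) auto
  also have "\<dots> = (ennreal C * sqnorm M \<phi>)\<^sup>2" by (simp add: power2_eq_square mult_ac)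
  finally have "S \<le> ennreal C * sqnorm M \<phi>" by (simp only: ennreal_sq_mono_iff)
  with \<psi>_le have "sqnorm M \<psi> \<le> 4 * (ennreal C * sqnorm M \<phi>)"
    by (meson mult_left_mono order_trans zero_le)
  also have "4 * (ennreal C * sqnorm M \<phi>) = ennreal (4 * C) * sqnorm M \<phi>"
    using \<open>C \<ge> 0\<close> by (simp add: ennreal_mult' mult.assoc)
  finally have "(sqnorm M \<phi>)\<^sup>2 \<le> (ennreal (4 * C) * sqnorm M \<phi>) * sqnorm M g"
    using dual by (meson mult_right_mono order_trans zero_le)
  then have "sqnorm M \<phi> * sqnorm M \<phi> \<le> sqnorm M \<phi> * (ennreal (4 * C) * sqnorm M g)"
    by (simp add: power2_eq_square mult_ac)
  then have "sqnorm M \<phi> \<le> ennreal (4 * C) * sqnorm M g"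
    using fin by (cases "sqnorm M \<phi> = 0") (auto simp: ennreal_mult_le_mult_iff)
  then show ?thesis by (simp add: \<phi>_def)
qed

text \<open>
  In terms of squared norms the improvement replaces a bound \<open>c\<close> by \<open>4 c\<^bsup>1/2\<^esup>\<close>, whose fixed point is
  \<open>16\<close>. Starting from \<open>16 b\<close>, the bound after \<open>k\<close> steps is \<open>16 b\<close> with \<open>b\<close> raised to the power \<open>2\<^bsup>-k\<^esup>\<close>.
\<close>

lemma sqnorm_linearized_avg_le_16:
  assumes E: "\<And>i. E i \<in> sets M" "disjoint_family E" and t: "\<And>i. t i \<ge> 1"
    and g: "g \<in> borel_measurable M" "sqnorm M g < \<infinity>"
  shows "sqnorm M (linearized_avg N t E g) \<le> 16 * sqnorm M g"
proof -
  \<comment> \<open>Any positive number with \<open>N\<^sup>2 \<le> 16 b\<close> would do; the summand \<open>1\<close> keeps it positive for \<open>N = 0\<close>.\<close>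
  define b where "b = ((real N)\<^sup>2 + 1) / 16"
  have b: "b > 0" by (simp add: b_def add_nonneg_pos)
  have iter: "sqnorm M (linearized_avg N t E g) \<le> ennreal (16 * b powr (1 / 2 ^ k)) * sqnorm M g"
    if "\<And>i. t i \<ge> 1" "g \<in> borel_measurable M" "sqnorm M g < \<infinity>" for k t g
    using that
  proof (induction k arbitrary: t g)
    case 0
    have "sqnorm M (linearized_avg N t E g) \<le> ennreal ((real N)\<^sup>2) * sqnorm M g"
      by (rule sqnorm_linearized_avg_le[OF E(1) 0])
    also have "\<dots> \<le> ennreal (16 * b powr (1 / 2 ^ 0)) * sqnorm M g"
      using b by (intro mult_right_mono ennreal_leI) (auto simp: b_def)
    finally show ?case .
  next
    case (Suc k)
    have "sqnorm M (linearized_avg N t E g) \<le> ennreal (4 * (4 * b powr (1 / 2 ^ Suc k))) * sqnorm M g"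
    proof (rule linearized_avg_improve[OF E Suc.prems(1)])
      fix h assume h: "h \<in> borel_measurable M" "sqnorm M h < \<infinity>"
      have "16 * b powr (1 / 2 ^ k) = (4 * b powr (1 / 2 ^ Suc k))\<^sup>2"
        unfolding power_mult_distrib by (simp add: power2_eq_square powr_add[symmetric])
      then have "ennreal (16 * b powr (1 / 2 ^ k)) = (ennreal (4 * b powr (1 / 2 ^ Suc k)))\<^sup>2"
        by (simp only: ennreal_power[OF mult_nonneg_nonneg[OF _ powr_ge_zero]] zero_le_numeral)
      with Suc.IH[of "\<lambda>i. 2 * t i" h] h Suc.prems(1)
      show "sqnorm M (linearized_avg N (\<lambda>i. 2 * t i) E h) \<le> (ennreal (4 * b powr (1 / 2 ^ Suc k)))\<^sup>2 * sqnorm M h"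
        by (metis One_nat_def less_eq_Suc_le nat_0_less_mult_iff pos2)
    qed (use Suc.prems in auto)
    then show ?case by simp
  qed
  have "(\<lambda>k. (1 / 2 :: real) ^ k) \<longlonglongrightarrow> 0"
    by (rule LIMSEQ_power_zero) simp
  then have "(\<lambda>k. 1 / 2 ^ k :: real) \<longlonglongrightarrow> 0"
    by (simp add: power_one_over)
  then have "(\<lambda>k. 16 * b powr (1 / 2 ^ k)) \<longlonglongrightarrow> 16 * b powr 0"
    using b by (intro tendsto_mult_left tendsto_powr tendsto_const) auto
  then have "(\<lambda>k. ennreal (16 * b powr (1 / 2 ^ k)) * sqnorm M g) \<longlonglongrightarrow> ennreal (16 * b powr 0) * sqnorm M g"
    using g(2) by (intro tendsto_mult_ennreal tendsto_ennrealI tendsto_const) auto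
  then have "sqnorm M (linearized_avg N t E g) \<le> ennreal (16 * b powr 0) * sqnorm M g"
  proof (rule LIMSEQ_le_const, intro exI allI impI)
    show "sqnorm M (linearized_avg N t E g) \<le> ennreal (16 * b powr (1 / 2 ^ k)) * sqnorm M g" for k
      by (rule iter[OF t g])
  qed
  then show ?thesis using b by simp
qed

theorem maximal_ergodic:
  assumes g: "g \<in> borel_measurable M" "sqnorm M g < \<infinity>"
  shows "sqnorm M (\<lambda>x. SUP n. avg (Suc n) g x) \<le> 16 * sqnorm M g"
proof -
  note [measurable] = g(1)
  define m where "m N x = (SUP n\<in>{..N}. avg (Suc n) g x)" for N x
  have [measurable]: "m N \<in> borel_measurable M" for N unfolding m_def[abs_def] by measurable
  have bound: "sqnorm M (m N) \<le> 16 * sqnorm M g" for N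
  proof -
    define F where "F i = {x \<in> space M. avg (Suc i) g x = m N x}" for i
    have F: "F i \<in> sets M" for i unfolding F_def by measurable
    \<comment> \<open>Points where several averages are maximal are assigned to the first of them.\<close>
    define E where "E = disjointed F"
    have E: "E i \<in> sets M" for i
      unfolding E_def using F sets.range_disjointed_sets[of F M] by auto
    have "m N x \<le> linearized_avg (Suc N) Suc E g x" if x: "x \<in> space M" for x
    proof -
      have "m N x \<in> (\<lambda>n. avg (Suc n) g x) ` {..N}"
        unfolding m_def by (subst cSup_eq_Max) (auto intro!: Max_in)
      then obtain i where i: "i \<le> N" "x \<in> F i"
        using x by (auto simp: F_def)
      then have "x \<in> (\<Union>i\<in>{0..<Suc N}. E i)"
        unfolding E_def finite_UN_disjointed_eq by auto
      then obtain j where j: "j < Suc N" "x \<in> E j" by auto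
      then have "x \<in> F j" using disjointed_subset[of F j] by (auto simp: E_def)
      then have "m N x = indicator (E j) x * avg (Suc j) g x"
        using j by (simp add: F_def)
      also have "\<dots> \<le> linearized_avg (Suc N) Suc E g x"
        unfolding linearized_avg_def using j by (intro member_le_sum) auto
      finally show ?thesis .
    qed
    then have "sqnorm M (m N) \<le> sqnorm M (linearized_avg (Suc N) Suc E g)"
      unfolding sqnorm_def by (intro nn_integral_mono power_mono) auto
    also have "\<dots> \<le> 16 * sqnorm M g"
      by (intro sqnorm_linearized_avg_le_16 E g) (auto simp: E_def disjoint_family_disjointed)
    finally show ?thesis .
  qed
  have "sqnorm M (\<lambda>x. SUP n. avg (Suc n) g x) \<le> (\<integral>\<^sup>+x. (SUP N. (m N x)\<^sup>2) \<partial>M)"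
    unfolding sqnorm_def
  proof (intro nn_integral_mono Sup_sq_le)
    fix x n
    have "avg (Suc n) g x \<le> m n x" unfolding m_def by (intro SUP_upper) auto
    then have "(avg (Suc n) g x)\<^sup>2 \<le> (m n x)\<^sup>2" by (simp add: ennreal_sq_mono_iff)
    also have "\<dots> \<le> (SUP N. (m N x)\<^sup>2)" by (intro SUP_upper) auto
    finally show "(avg (Suc n) g x)\<^sup>2 \<le> (SUP N. (m N x)\<^sup>2)" .
  qed
  also have "\<dots> = (SUP N. sqnorm M (m N))"
    unfolding sqnorm_def
  proof (intro nn_integral_monotone_convergence_SUP)
    have "m N x \<le> m (Suc N) x" for N x
      unfolding m_def by (intro SUP_subset_mono) auto
    then show "incseq (\<lambda>N x. (m N x)\<^sup>2)"
      by (intro incseq_SucI le_funI power_mono) auto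
  qed measurable
  also have "\<dots> \<le> 16 * sqnorm M g" by (intro SUP_least bound)
  finally show ?thesis .
qed

end

section \<open>Orthogonal expansions\<close>

lemma product_sqnorm_bound:
  fixes f g :: "'a \<Rightarrow> complex"
  assumes [measurable]: "f \<in> borel_measurable M" "g \<in> borel_measurable M"
    and fin: "sqnorm M (modulus f) < \<infinity>" "sqnorm M (modulus g) < \<infinity>"
  shows "integrable M (\<lambda>x. f x * g x)"
    and "(ennreal (cmod (LINT x|M. f x * g x)))\<^sup>2 \<le> sqnorm M (modulus f) * sqnorm M (modulus g)"
proof -
  have le: "(\<integral>\<^sup>+x. ennreal (cmod (f x * g x)) \<partial>M)\<^sup>2 \<le> sqnorm M (modulus f) * sqnorm M (modulus g)"
    using Cauchy_Schwarz_nn_integral[of "modulus f" M "modulus g"]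
    by (simp add: sqnorm_def norm_mult ennreal_mult)
  also have "\<dots> < \<infinity>" using fin by (simp add: ennreal_mult_less_top)
  finally have "(\<integral>\<^sup>+x. ennreal (cmod (f x * g x)) \<partial>M) < \<infinity>"
    by (cases "\<integral>\<^sup>+x. ennreal (cmod (f x * g x)) \<partial>M") (auto simp: power2_eq_square ennreal_top_mult)
  then show int: "integrable M (\<lambda>x. f x * g x)"
    by (intro integrableI_bounded) auto
  have "ennreal (cmod (LINT x|M. f x * g x)) \<le> (\<integral>\<^sup>+x. ennreal (cmod (f x * g x)) \<partial>M)"
    using integral_norm_bound_ennreal[OF int] by simp
  with le show "(ennreal (cmod (LINT x|M. f x * g x)))\<^sup>2 \<le> sqnorm M (modulus f) * sqnorm M (modulus g)"
    by (meson ennreal_sq_mono_iff order_trans)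
qed

lemma sqnorm_modulus_Fatou:
  fixes S :: "nat \<Rightarrow> 'a \<Rightarrow> complex"
  assumes [measurable]: "\<And>n. S n \<in> borel_measurable M" "G \<in> borel_measurable M"
    and lim: "AE x in M. (\<lambda>n. S n x) \<longlonglongrightarrow> G x"
    and bound: "\<forall>\<^sub>F n in sequentially. sqnorm M (modulus (S n)) \<le> B"
  shows "sqnorm M (modulus G) \<le> B"
proof -
  have "sqnorm M (modulus G) = (\<integral>\<^sup>+x. liminf (\<lambda>n. (modulus (S n) x)\<^sup>2) \<partial>M)"
    unfolding sqnorm_def
  proof (rule nn_integral_cong_AE, use lim in eventually_elim)
    fix x assume "(\<lambda>n. S n x) \<longlonglongrightarrow> G x"
    then have "(\<lambda>n. ennreal ((cmod (S n x))\<^sup>2)) \<longlonglongrightarrow> ennreal ((cmod (G x))\<^sup>2)"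
      by (intro tendsto_intros)
    then show "(modulus G x)\<^sup>2 = liminf (\<lambda>n. (modulus (S n) x)\<^sup>2)"
      by (subst lim_imp_Liminf) (auto simp: ennreal_power)
  qed
  also have "\<dots> \<le> liminf (\<lambda>n. sqnorm M (modulus (S n)))"
    unfolding sqnorm_def by (rule nn_integral_liminf) measurable
  also have "\<dots> \<le> liminf (\<lambda>n. B)"
    by (rule Liminf_mono[OF bound])
  finally show ?thesis by (simp add: Liminf_const)
qed

text \<open>
  The weights \<open>2\<^sup>n\<close> grow more slowly than the squared increments decay, so the weighted sum of the
  squared increments is still integrable; at every point where it is finite, the increments are
  dominated by a geometric series.
\<close>

lemma rapidly_Cauchy_AE_convergent:
  fixes S :: "nat \<Rightarrow> 'a \<Rightarrow> complex"
  assumes [measurable]: "\<And>n. S n \<in> borel_measurable M"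
    and cauchy: "\<And>n. sqnorm M (modulus (\<lambda>x. S (Suc n) x - S n x)) \<le> ennreal ((1/4) ^ n)"
  shows "AE x in M. convergent (\<lambda>n. S n x)"
proof -
  let ?D = "\<lambda>n x. S (Suc n) x - S n x"
  define H where "H x = (\<Sum>n. ennreal (2 ^ n) * (modulus (?D n) x)\<^sup>2)" for x
  have [measurable]: "H \<in> borel_measurable M" unfolding H_def by measurable
  have "(\<integral>\<^sup>+x. H x \<partial>M) = (\<Sum>n. ennreal (2 ^ n) * sqnorm M (modulus (?D n)))"
    unfolding H_def sqnorm_def by (simp add: nn_integral_suminf nn_integral_cmult)
  also have "\<dots> \<le> (\<Sum>n. ennreal ((1/2) ^ n))"
  proof (rule suminf_le)
    fix n
    have "ennreal (2 ^ n) * sqnorm M (modulus (?D n)) \<le> ennreal (2 ^ n) * ennreal ((1/4) ^ n)"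
      by (intro mult_left_mono cauchy) auto
    also have "\<dots> = ennreal ((1/2) ^ n)"
      by (simp flip: ennreal_mult power_mult_distrib)
    finally show "ennreal (2 ^ n) * sqnorm M (modulus (?D n)) \<le> ennreal ((1/2) ^ n)" .
  qed auto
  also have "\<dots> = ennreal (\<Sum>n. (1/2) ^ n)"
    by (rule suminf_ennreal2) (auto intro: summable_geometric)
  finally have "(\<integral>\<^sup>+x. H x \<partial>M) < \<infinity>" by (simp add: le_less_trans)
  then have "AE x in M. H x \<noteq> \<infinity>"
    by (intro nn_integral_noteq_infinite) auto
  then show ?thesis
  proof eventually_elim
    fix x assume fin: "H x \<noteq> \<infinity>"
    define h where "h = enn2real (H x)"
    have h: "H x = ennreal h" "h \<ge> 0" using fin by (auto simp: h_def less_top)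
    have "cmod (?D n x) \<le> sqrt h * (1 / sqrt 2) ^ n" for n
    proof -
      have "ennreal (2 ^ n * (cmod (?D n x))\<^sup>2) = (\<Sum>i\<in>{n}. ennreal (2 ^ i) * (modulus (?D i) x)\<^sup>2)"
        by (simp add: ennreal_mult ennreal_power)
      also have "\<dots> \<le> H x" unfolding H_def by (intro sum_le_suminf) auto
      finally have "2 ^ n * (cmod (?D n x))\<^sup>2 \<le> h" using h by simp
      then have "(sqrt (2 ^ n) * cmod (?D n x))\<^sup>2 \<le> (sqrt h)\<^sup>2"
        using h by (simp add: power_mult_distrib)
      then have "sqrt (2 ^ n) * cmod (?D n x) \<le> sqrt h"
        by (rule power2_le_imp_le) (use h in simp)
      then have "cmod (?D n x) \<le> sqrt h / sqrt 2 ^ n"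
        by (subst pos_le_divide_eq) (simp_all add: real_sqrt_power mult.commute)
      then show ?thesis by (simp add: power_one_over)
    qed
    moreover have "summable (\<lambda>n. sqrt h * (1 / sqrt 2) ^ n)"
      by (intro summable_mult summable_geometric) simp
    ultimately have "summable (\<lambda>n. ?D n x)"
      by (blast intro: summable_comparison_test')
    then have "convergent (\<lambda>n. \<Sum>i<n. ?D i x)"
      by (simp add: summable_iff_convergent)
    then have "convergent (\<lambda>n. S 0 x + (\<Sum>i<n. ?D i x))"
      by (rule convergent_add[OF convergent_const])
    also have "(\<lambda>n. S 0 x + (\<Sum>i<n. ?D i x)) = (\<lambda>n. S n x)"
      by (subst sum_lessThan_telescope[of "\<lambda>i. S i x"]) simp
    finally show "convergent (\<lambda>n. S n x)" .
  qed
qed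

locale orthogonal_family =
  fixes M :: "'a measure" and E :: "'k \<Rightarrow> 'a \<Rightarrow> real" and N :: "'k \<Rightarrow> real"
  assumes E_measurable [measurable]: "E k \<in> borel_measurable M"
    and E_integrable: "integrable M (\<lambda>x. E k x * E l x)"
    and E_orthogonal: "(LINT x|M. E k x * E l x) = (if k = l then N k else 0)"
begin

lemma N_nonneg: "N k \<ge> 0"
proof -
  have "0 \<le> (LINT x|M. E k x * E k x)" by (rule Bochner_Integration.integral_nonneg) simp
  then show ?thesis by (simp add: E_orthogonal)
qed

definition comb :: "'k set \<Rightarrow> ('k \<Rightarrow> complex) \<Rightarrow> 'a \<Rightarrow> complex" where
  "comb K a x = (\<Sum>k\<in>K. a k * of_real (E k x))"

definition weight :: "('k \<Rightarrow> complex) \<Rightarrow> 'k \<Rightarrow> real" where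
  "weight a k = (cmod (a k))\<^sup>2 * N k"

lemma weight_nonneg [simp]: "weight a k \<ge> 0"
  by (simp add: weight_def N_nonneg)

lemma comb_measurable [measurable]: "comb K a \<in> borel_measurable M"
  unfolding comb_def[abs_def] by measurable

lemma comb_diff: "finite L \<Longrightarrow> K \<subseteq> L \<Longrightarrow> comb L a x - comb K a x = comb (L - K) a x"
  unfolding comb_def by (subst sum_diff) auto

lemma sqnorm_comb:
  assumes "finite K"
  shows "sqnorm M (modulus (comb K a)) = ennreal (\<Sum>k\<in>K. weight a k)"
proof -
  let ?f = "\<lambda>x. \<Sum>k\<in>K. \<Sum>l\<in>K. Re (a k * cnj (a l)) * (E k x * E l x)"
  have sq: "(cmod (comb K a x))\<^sup>2 = ?f x" for x
  proof -
    have "(cmod (comb K a x))\<^sup>2 = Re (comb K a x * cnj (comb K a x))"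
      by (simp add: complex_norm_square[symmetric] del: of_real_power)
    also have "comb K a x * cnj (comb K a x) = (\<Sum>k\<in>K. \<Sum>l\<in>K. a k * cnj (a l) * of_real (E k x * E l x))"
      unfolding comb_def cnj_sum sum_product by (intro sum.cong refl) (simp add: mult_ac)
    also have "Re \<dots> = ?f x"
      unfolding Re_sum by (intro sum.cong refl) simp
    finally show ?thesis .
  qed
  have int: "integrable M ?f"
    by (intro Bochner_Integration.integrable_sum integrable_mult_right E_integrable)
  have "sqnorm M (modulus (comb K a)) = (\<integral>\<^sup>+x. ennreal (?f x) \<partial>M)"
    unfolding sqnorm_def by (simp add: ennreal_power sq)
  also have "\<dots> = ennreal (LINT x|M. ?f x)"
    by (intro nn_integral_eq_integral int AE_I2) (subst sq[symmetric], simp)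
  also have "(LINT x|M. ?f x) = (\<Sum>k\<in>K. \<Sum>l\<in>K. Re (a k * cnj (a l)) * (if k = l then N k else 0))"
    by (simp add: Bochner_Integration.integral_sum E_integrable E_orthogonal)
  also have "\<dots> = (\<Sum>k\<in>K. Re (a k * cnj (a k)) * N k)"
    using assms by (intro sum.cong refl) (simp add: if_distrib cong: if_cong)
  also have "\<dots> = (\<Sum>k\<in>K. weight a k)"
    by (simp add: weight_def complex_norm_square[symmetric] del: of_real_power)
  finally show ?thesis .
qed

lemma sqnorm_E: "sqnorm M (modulus (\<lambda>x. of_real (E k x))) = ennreal (N k)"
  using sqnorm_comb[of "{k}" "\<lambda>_. 1"] by (simp add: comb_def[abs_def] weight_def)

lemma integrable_mult_E:
  assumes "f \<in> borel_measurable M" "sqnorm M (modulus f) < \<infinity>"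
  shows "integrable M (\<lambda>x. f x * of_real (E k x))"
proof (rule product_sqnorm_bound)
  show "sqnorm M (modulus (\<lambda>x. of_real (E k x))) < \<infinity>" by (subst sqnorm_E) simp
qed (use assms in auto)

definition coeff :: "('a \<Rightarrow> complex) \<Rightarrow> 'k \<Rightarrow> complex" where
  "coeff f k = (LINT x|M. f x * of_real (E k x)) / of_real (N k)"

text \<open>
  Pairing \<open>f\<close> with its own partial sum gives the sum \<open>Q\<close> of the weights, and by Parseval \<open>Q\<close> is also the
  squared norm of the partial sum. The Cauchy-Schwarz inequality becomes \<open>Q\<^sup>2 \<le> \<parallel>f\<parallel>\<^sup>2 Q\<close>.
\<close>

theorem Bessel:
  assumes [measurable]: "f \<in> borel_measurable M" and fin: "sqnorm M (modulus f) < \<infinity>"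
    and "finite K" and pos: "\<And>k. N k > 0"
  shows "ennreal (\<Sum>k\<in>K. weight (coeff f) k) \<le> sqnorm M (modulus f)"
proof -
  define Q where "Q = (\<Sum>k\<in>K. weight (coeff f) k)"
  have Q: "Q \<ge> 0" unfolding Q_def by (intro sum_nonneg) auto
  let ?g = "comb K (\<lambda>k. cnj (coeff f k))"
  have g: "sqnorm M (modulus ?g) = ennreal Q"
    unfolding Q_def by (subst sqnorm_comb[OF \<open>finite K\<close>]) (simp add: weight_def)
  have int: "integrable M (\<lambda>x. f x * of_real (E k x))" for k
    by (rule integrable_mult_E) (use fin in auto)
  have "(LINT x|M. f x * ?g x) = (LINT x|M. (\<Sum>k\<in>K. cnj (coeff f k) * (f x * of_real (E k x))))"
    by (simp add: comb_def sum_distrib_left mult_ac)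
  also have "\<dots> = (\<Sum>k\<in>K. cnj (coeff f k) * (LINT x|M. f x * of_real (E k x)))"
    by (subst Bochner_Integration.integral_sum) (auto intro!: int)
  also have "\<dots> = (\<Sum>k\<in>K. of_real (weight (coeff f) k))"
  proof (intro sum.cong refl)
    fix k
    have "(LINT x|M. f x * of_real (E k x)) = coeff f k * of_real (N k)"
      using pos[of k] by (simp add: coeff_def)
    then show "cnj (coeff f k) * (LINT x|M. f x * of_real (E k x)) = of_real (weight (coeff f) k)"
      unfolding weight_def of_real_mult complex_norm_square by (simp add: mult_ac)
  qed
  finally have "(LINT x|M. f x * ?g x) = of_real Q" by (simp add: Q_def)
  then have "(ennreal Q)\<^sup>2 \<le> sqnorm M (modulus f) * ennreal Q"
    using product_sqnorm_bound(2)[of f M ?g] fin g Q by simp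
  then have "ennreal Q * ennreal Q \<le> ennreal Q * sqnorm M (modulus f)"
    by (simp add: power2_eq_square mult.commute)
  then have "ennreal Q \<le> sqnorm M (modulus f)"
    by (cases "Q = 0") (use Q in \<open>auto simp: ennreal_mult_le_mult_iff\<close>)
  then show ?thesis by (simp add: Q_def)
qed

text \<open>
  The defect is the inner product of \<open>E k\<close> with \<open>G\<close> minus any partial sum that contains \<open>k\<close>, so it
  is bounded by quantities that tend to \<open>0\<close>.
\<close>

lemma coeff_of_limit:
  assumes [measurable]: "G \<in> borel_measurable M" and fin: "sqnorm M (modulus G) < \<infinity>"
    and lim: "((\<lambda>K. sqnorm M (modulus (\<lambda>x. G x - comb K a x))) \<longlongrightarrow> 0) (finite_subsets_at_top UNIV)"
    and pos: "N k > 0"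
  shows "coeff G k = a k"
proof -
  define z where "z = (LINT x|M. G x * of_real (E k x)) - a k * of_real (N k)"
  have bound: "(ennreal (cmod z))\<^sup>2 \<le> sqnorm M (modulus (\<lambda>x. G x - comb K a x)) * ennreal (N k)"
    if K: "finite K" "k \<in> K" "sqnorm M (modulus (\<lambda>x. G x - comb K a x)) < \<infinity>" for K
  proof -
    have int: "integrable M (\<lambda>x. complex_of_real (E l x) * of_real (E k x))" for l
      using E_integrable[of l k] by (simp flip: of_real_mult)
    have orth: "(LINT x|M. complex_of_real (E l x) * of_real (E k x)) = (if l = k then of_real (N k) else 0)" for l
      unfolding of_real_mult[symmetric] integral_complex_of_real E_orthogonal by simp
    have "(LINT x|M. comb K a x * of_real (E k x))
        = (LINT x|M. (\<Sum>l\<in>K. a l * (complex_of_real (E l x) * of_real (E k x))))"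
      by (simp add: comb_def sum_distrib_right mult.assoc)
    also have "\<dots> = (\<Sum>l\<in>K. a l * (if l = k then of_real (N k) else 0))"
      by (subst Bochner_Integration.integral_sum) (auto simp: int orth)
    also have "\<dots> = a k * of_real (N k)"
      using K by (simp add: if_distrib cong: if_cong)
    finally have c: "(LINT x|M. comb K a x * of_real (E k x)) = a k * of_real (N k)" .
    have i1: "integrable M (\<lambda>x. comb K a x * of_real (E k x))"
      by (rule integrable_mult_E) (auto simp: sqnorm_comb[OF K(1)])
    have "(LINT x|M. (G x - comb K a x) * of_real (E k x)) = z"
      unfolding left_diff_distrib z_def
      by (subst Bochner_Integration.integral_diff) (auto simp: c i1 intro!: integrable_mult_E fin)
    then show ?thesis
      using product_sqnorm_bound(2)[of "\<lambda>x. G x - comb K a x" M "\<lambda>x. of_real (E k x)", OF _ _ K(3)]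
      unfolding sqnorm_E by simp
  qed
  have "((\<lambda>K. sqnorm M (modulus (\<lambda>x. G x - comb K a x)) * ennreal (N k)) \<longlongrightarrow> 0 * ennreal (N k)) (finite_subsets_at_top UNIV)"
    by (intro tendsto_mult_ennreal lim tendsto_const) auto
  moreover have "\<forall>\<^sub>F K in finite_subsets_at_top UNIV. (ennreal (cmod z))\<^sup>2 \<le> sqnorm M (modulus (\<lambda>x. G x - comb K a x)) * ennreal (N k)"
  proof -
    have "\<forall>\<^sub>F K in finite_subsets_at_top UNIV. sqnorm M (modulus (\<lambda>x. G x - comb K a x)) < \<infinity>"
      by (rule order_tendstoD(2)[OF lim]) simp
    moreover have "\<forall>\<^sub>F K in finite_subsets_at_top UNIV. finite K \<and> {k} \<subseteq> K"
      unfolding eventually_finite_subsets_at_top by (intro exI[of _ "{k}"]) auto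
    ultimately show ?thesis by eventually_elim (auto intro: bound)
  qed
  ultimately have "(ennreal (cmod z))\<^sup>2 \<le> 0 * ennreal (N k)"
    by (rule tendsto_lowerbound) simp
  then have "z = 0" by (simp add: ennreal_power)
  then show ?thesis using pos by (simp add: z_def coeff_def)
qed

context
  fixes a :: "'k \<Rightarrow> complex" and Kn :: "nat \<Rightarrow> 'k set"
  assumes summable: "weight a summable_on UNIV"
    and finite_Kn: "\<And>n. finite (Kn n)"
    and Kn: "filterlim Kn (finite_subsets_at_top UNIV) sequentially"
begin

lemma weight_sum_le: "finite K \<Longrightarrow> sum (weight a) K \<le> infsum (weight a) UNIV"
  by (rule finite_sum_le_infsum[OF summable]) auto

text \<open>
  A limit almost everywhere along one exhausting sequence is, by Fatou, also the limit in the mean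
  along all finite index sets: the remainder is controlled by the tail of the weights.
\<close>

lemma sqnorm_limit_minus_comb:
  assumes [measurable]: "G \<in> borel_measurable M"
    and lim: "AE x in M. (\<lambda>n. comb (Kn n) a x) \<longlonglongrightarrow> G x" and "finite K"
  shows "sqnorm M (modulus (\<lambda>x. G x - comb K a x)) \<le> ennreal (infsum (weight a) UNIV - sum (weight a) K)"
proof (rule sqnorm_modulus_Fatou[where S = "\<lambda>n x. comb (Kn n) a x - comb K a x"])
  show "AE x in M. (\<lambda>n. comb (Kn n) a x - comb K a x) \<longlonglongrightarrow> G x - comb K a x"
    using lim by eventually_elim (intro tendsto_intros)
  have "\<forall>\<^sub>F n in sequentially. K \<subseteq> Kn n"
    using Kn \<open>finite K\<close> unfolding filterlim_finite_subsets_at_top by (auto elim!: allE eventually_mono)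
  then show "\<forall>\<^sub>F n in sequentially. sqnorm M (modulus (\<lambda>x. comb (Kn n) a x - comb K a x))
      \<le> ennreal (infsum (weight a) UNIV - sum (weight a) K)"
  proof eventually_elim
    case (elim n)
    have "sqnorm M (modulus (\<lambda>x. comb (Kn n) a x - comb K a x)) = sqnorm M (modulus (comb (Kn n - K) a))"
      using elim by (simp add: comb_diff finite_Kn)
    also have "\<dots> = ennreal (sum (weight a) (Kn n) - sum (weight a) K)"
      using elim by (subst sqnorm_comb) (auto simp: finite_Kn sum_diff)
    also have "\<dots> \<le> ennreal (infsum (weight a) UNIV - sum (weight a) K)"
      by (intro ennreal_leI diff_right_mono weight_sum_le finite_Kn)
    finally show ?case .
  qed
qed measurable

lemma sqnorm_limit_le:
  assumes "G \<in> borel_measurable M" "AE x in M. (\<lambda>n. comb (Kn n) a x) \<longlonglongrightarrow> G x"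
  shows "sqnorm M (modulus G) \<le> ennreal (infsum (weight a) UNIV)"
  using sqnorm_limit_minus_comb[OF assms, of "{}"] by (simp add: comb_def)

lemma comb_tendsto_limit:
  assumes "G \<in> borel_measurable M" "AE x in M. (\<lambda>n. comb (Kn n) a x) \<longlonglongrightarrow> G x"
  shows "((\<lambda>K. sqnorm M (modulus (\<lambda>x. G x - comb K a x))) \<longlongrightarrow> 0) (finite_subsets_at_top UNIV)"
proof (rule tendsto_sandwich[where f = "\<lambda>_. 0" and h = "\<lambda>K. ennreal (infsum (weight a) UNIV - sum (weight a) K)"])
  have "(sum (weight a) \<longlongrightarrow> infsum (weight a) UNIV) (finite_subsets_at_top UNIV)"
    using summable by (simp add: has_sum_infsum flip: has_sum_def)
  then have "((\<lambda>K. infsum (weight a) UNIV - sum (weight a) K) \<longlongrightarrow> infsum (weight a) UNIV - infsum (weight a) UNIV) (finite_subsets_at_top UNIV)"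
    by (intro tendsto_intros)
  then show "((\<lambda>K. ennreal (infsum (weight a) UNIV - sum (weight a) K)) \<longlongrightarrow> 0) (finite_subsets_at_top UNIV)"
    using tendsto_ennrealI by fastforce
  show "\<forall>\<^sub>F K in finite_subsets_at_top UNIV. sqnorm M (modulus (\<lambda>x. G x - comb K a x)) \<le> ennreal (infsum (weight a) UNIV - sum (weight a) K)"
    by (rule eventually_finite_subsets_at_top_weakI) (rule sqnorm_limit_minus_comb[OF assms])
qed auto

text \<open>
  The subsequence is chosen so that the tails of the weights decay geometrically.
\<close>

theorem Riesz_Fischer:
  obtains r G where "strict_mono r" "G \<in> borel_measurable M"
    "AE x in M. (\<lambda>n. comb (Kn (r n)) a x) \<longlonglongrightarrow> G x"
proof -
  have sum_lim: "(\<lambda>n. sum (weight a) (Kn n)) \<longlonglongrightarrow> infsum (weight a) UNIV"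
    using summable by (intro filterlim_compose[OF _ Kn]) (simp add: has_sum_infsum flip: has_sum_def)
  have ev: "\<exists>n>m. Kn m \<subseteq> Kn n \<and> infsum (weight a) UNIV - sum (weight a) (Kn n) < (1/4) ^ i" for m i
  proof -
    have "\<forall>\<^sub>F n in sequentially. infsum (weight a) UNIV - (1/4) ^ i < sum (weight a) (Kn n)"
      by (rule order_tendstoD[OF sum_lim]) simp
    moreover have "\<forall>\<^sub>F n in sequentially. Kn m \<subseteq> Kn n"
      using Kn finite_Kn[of m] unfolding filterlim_finite_subsets_at_top by (auto elim!: allE eventually_mono)
    ultimately have "\<forall>\<^sub>F n in sequentially. n > m \<and> Kn m \<subseteq> Kn n \<and> infsum (weight a) UNIV - sum (weight a) (Kn n) < (1/4) ^ i"
      using eventually_gt_at_top[of m] by eventually_elim auto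
    then show ?thesis by (auto dest: eventually_happens)
  qed
  have "\<exists>r. \<forall>i. infsum (weight a) UNIV - sum (weight a) (Kn (r i)) < (1/4) ^ i \<and>
      r i < r (Suc i) \<and> Kn (r i) \<subseteq> Kn (r (Suc i))"
    by (rule dependent_nat_choice) (use ev in blast)+
  then obtain r where r: "\<And>i. infsum (weight a) UNIV - sum (weight a) (Kn (r i)) < (1/4) ^ i"
    "\<And>i. r i < r (Suc i)" "\<And>i. Kn (r i) \<subseteq> Kn (r (Suc i))" by blast
  let ?S = "\<lambda>i. comb (Kn (r i)) a"
  have "AE x in M. convergent (\<lambda>i. ?S i x)"
  proof (rule rapidly_Cauchy_AE_convergent)
    fix i
    have "sqnorm M (modulus (\<lambda>x. ?S (Suc i) x - ?S i x)) = sqnorm M (modulus (comb (Kn (r (Suc i)) - Kn (r i)) a))"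
      using r(3) by (simp add: comb_diff finite_Kn)
    also have "\<dots> = ennreal (sum (weight a) (Kn (r (Suc i))) - sum (weight a) (Kn (r i)))"
      using r(3) by (subst sqnorm_comb) (auto simp: finite_Kn sum_diff)
    also have "\<dots> \<le> ennreal ((1/4) ^ i)"
      using r(1)[of i] weight_sum_le[OF finite_Kn, of "r (Suc i)"] by (intro ennreal_leI) simp
    finally show "sqnorm M (modulus (\<lambda>x. ?S (Suc i) x - ?S i x)) \<le> ennreal ((1/4) ^ i)" .
  qed measurable
  then have "AE x in M. (\<lambda>n. ?S n x) \<longlonglongrightarrow> lim (\<lambda>n. ?S n x)"
    by eventually_elim (simp add: convergent_LIMSEQ_iff)
  moreover have "strict_mono r" using r(2) by (simp add: strict_mono_Suc_iff)
  moreover have "(\<lambda>x. lim (\<lambda>n. ?S n x)) \<in> borel_measurable M"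
    by (rule borel_measurable_lim_metric) measurable
  ultimately show thesis using that by blast
qed

end

end

section \<open>The semigroup\<close>

interpretation eig: orthogonal_family inv_gauss "eigenfun :: ('n::finite \<Rightarrow> nat) \<Rightarrow> real ^ 'n \<Rightarrow> real" eigenfun_norm
  by unfold_locales (simp_all add: eigenfun_orthogonal)

lemma borel_measurable_inv_gauss [simp]: "borel_measurable inv_gauss = borel_measurable borel"
  by (rule measurable_cong_sets) simp_all

abbreviation norm2 :: "(real ^ 'n \<Rightarrow> complex) \<Rightarrow> ennreal" where
  "norm2 f \<equiv> sqnorm inv_gauss (modulus f)"

lemma L2_norm_power2: "(L2_norm g)\<^sup>2 = sqnorm inv_gauss g"
  by (simp add: L2_norm_def ennsqrt_power2 sqnorm_def)

lemma ennreal_sq_less_top: "(y::ennreal)\<^sup>2 < \<infinity> \<longleftrightarrow> y < \<infinity>"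
  by (cases y) (auto simp: power2_eq_square simp flip: ennreal_mult)

lemma L2_iff: "f \<in> L2 \<longleftrightarrow> f \<in> borel_measurable borel \<and> norm2 f < \<infinity>"
  unfolding L2_norm_power2[symmetric] ennreal_sq_less_top by (simp add: L2_def)

lemma L2_norm_tendsto_0:
  assumes "((\<lambda>K. sqnorm inv_gauss (h K)) \<longlongrightarrow> 0) F"
  shows "((\<lambda>K. L2_norm (h K)) \<longlongrightarrow> 0) F"
proof (rule order_tendstoI)
  fix e :: ennreal assume "0 < e"
  then have "0 < e\<^sup>2" by (simp add: zero_less_iff_neq_zero)
  from order_tendstoD(2)[OF assms this] show "\<forall>\<^sub>F K in F. L2_norm (h K) < e"
  proof eventually_elim
    case (elim K)
    then have "\<not> e\<^sup>2 \<le> (L2_norm (h K))\<^sup>2" by (simp add: L2_norm_power2)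
    then show ?case by (simp add: ennreal_sq_mono_iff)
  qed
qed simp

lemma L2_boundedI:
  fixes T :: "(real ^ 'n \<Rightarrow> complex) \<Rightarrow> (real ^ 'n \<Rightarrow> ennreal) \<Rightarrow> bool"
  assumes "C \<ge> 0"
    and "\<And>f. f \<in> L2 \<Longrightarrow> \<exists>g. T f g \<and> g \<in> borel_measurable borel \<and> sqnorm inv_gauss g \<le> ennreal (C\<^sup>2) * norm2 f"
  shows "L2_bounded T"
  unfolding L2_bounded_def
proof (rule exI[of _ C], intro conjI ballI)
  fix f :: "real ^ 'n \<Rightarrow> complex" assume "f \<in> L2"
  then obtain g where g: "T f g" "g \<in> borel_measurable borel" "sqnorm inv_gauss g \<le> ennreal (C\<^sup>2) * norm2 f"
    using assms by blast
  then have "(L2_norm g)\<^sup>2 \<le> (ennreal C * L2_norm (modulus f))\<^sup>2"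
    using \<open>C \<ge> 0\<close> by (simp add: L2_norm_power2 power_mult_distrib ennreal_power)
  with g show "\<exists>g. T f g \<and> g \<in> borel_measurable borel \<and> L2_norm g \<le> ennreal C * L2_norm (modulus f)"
    by (auto simp: ennreal_sq_mono_iff)
qed fact

lemma eigenval_nonneg: "eigenval k \<ge> 0"
  unfolding eigenval_def by (intro add_nonneg_nonneg mult_nonneg_nonneg of_nat_0_le_iff) simp_all

lemma coefficient_eq: "coefficient k f = eig.coeff f k"
  using eigenfun_orthogonal(2)[of k k] by (simp add: coefficient_def eig.coeff_def power2_eq_square)

lemma Bessel_coefficient:
  assumes "f \<in> L2" "finite K"
  shows "ennreal (\<Sum>k\<in>K. eig.weight (\<lambda>k. coefficient k f) k) \<le> norm2 f"
  using eig.Bessel[of f K] assms by (simp add: L2_iff coefficient_eq eigenfun_norm_pos)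

lemma weight_multiplier:
  fixes f :: "real ^ 'n \<Rightarrow> complex" and N :: "('n \<Rightarrow> nat) \<Rightarrow> real"
  assumes f: "f \<in> L2" and le: "\<And>k. w k \<le> eig.weight (\<lambda>k. coefficient k f) k" and nonneg: "\<And>k. w k \<ge> 0"
  shows "w summable_on UNIV" "ennreal (infsum w UNIV) \<le> norm2 f"
proof -
  obtain q where q: "norm2 f = ennreal q" "q \<ge> 0"
    using f by (cases "norm2 f") (auto simp: L2_iff)
  have bound: "sum w K \<le> q" if "finite K" for K
  proof -
    have "sum w K \<le> (\<Sum>k\<in>K. eig.weight (\<lambda>k. coefficient k f) k)" by (intro sum_mono le)
    also have "ennreal \<dots> \<le> ennreal q" using Bessel_coefficient[OF f that] q by simp
    then have "(\<Sum>k\<in>K. eig.weight (\<lambda>k. coefficient k f) k) \<le> q" using q by simp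
    finally show ?thesis .
  qed
  show *: "w summable_on UNIV"
    by (rule nonneg_bdd_above_summable_on) (use nonneg bound in \<open>auto intro!: bdd_aboveI[of _ q]\<close>)
  have "infsum w UNIV \<le> q"
    by (rule infsum_le_finite_sums[OF *]) (use bound in auto)
  then show "ennreal (infsum w UNIV) \<le> norm2 f" by (simp add: q ennreal_leI)
qed

text \<open>
  An almost everywhere limit along one sequence of index sets represents \<open>\<phi>(A) f\<close>. The functions \<open>\<phi>\<close>
  needed here are bounded by \<open>1\<close> on the spectrum, which contains only numbers \<open>\<ge> 2\<close>.
\<close>

lemma spectralI:
  fixes f g :: "real ^ 'n \<Rightarrow> complex" and Kn :: "nat \<Rightarrow> ('n \<Rightarrow> nat) set"
  assumes f: "f \<in> L2" and \<phi>: "\<And>k :: 'n \<Rightarrow> nat. \<bar>\<phi> (eigenval k)\<bar> \<le> 1"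
    and g [measurable]: "g \<in> borel_measurable borel"
    and Kn: "\<And>n. finite (Kn n)" "filterlim Kn (finite_subsets_at_top UNIV) sequentially"
    and lim: "AE x in inv_gauss. (\<lambda>n. eig.comb (Kn n) (\<lambda>k. of_real (\<phi> (eigenval k)) * coefficient k f) x) \<longlonglongrightarrow> g x"
  shows "spectral \<phi> f g" "norm2 g \<le> norm2 f"
proof -
  let ?a = "\<lambda>k. of_real (\<phi> (eigenval k)) * coefficient k f"
  have "(cmod (?a k))\<^sup>2 \<le> (cmod (coefficient k f))\<^sup>2" for k
    using \<phi>[of k] by (intro power_mono) (auto simp: norm_mult mult_left_le_one_le)
  then have le: "eig.weight ?a k \<le> eig.weight (\<lambda>k. coefficient k f) k" for k
    unfolding eig.weight_def by (intro mult_right_mono) (auto simp: eigenfun_norm_pos less_imp_le)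
  note w = weight_multiplier[OF f le eig.weight_nonneg]
  have "norm2 g \<le> ennreal (infsum (eig.weight ?a) UNIV)"
    by (rule eig.sqnorm_limit_le[OF w(1) Kn _ lim]) simp
  with w(2) show "norm2 g \<le> norm2 f" by simp
  also have "\<dots> < \<infinity>" using f by (simp add: L2_iff)
  finally have "g \<in> L2" by (simp add: L2_iff)
  moreover have "((\<lambda>K. L2_norm (modulus (\<lambda>x. g x - eig.comb K ?a x))) \<longlongrightarrow> 0) (finite_subsets_at_top UNIV)"
    by (intro L2_norm_tendsto_0 eig.comb_tendsto_limit[OF w(1) Kn _ lim]) simp
  ultimately show "spectral \<phi> f g"
    by (simp add: spectral_def eig.comb_def)
qed

text \<open>
  The component of \<open>f\<close> in the eigenspace of level \<open>n\<close>, and the square of its norm.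
\<close>

definition level_part :: "(real ^ 'n \<Rightarrow> complex) \<Rightarrow> nat \<Rightarrow> real ^ 'n \<Rightarrow> complex" where
  "level_part f n x = (\<Sum>k\<in>level n. coefficient k f * of_real (eigenfun k x))"

definition level_weight :: "(real ^ 'n \<Rightarrow> complex) \<Rightarrow> nat \<Rightarrow> real" where
  "level_weight f n = (\<Sum>k\<in>level n. eig.weight (\<lambda>k. coefficient k f) k)"

lemma level_part_measurable [measurable]: "level_part f n \<in> borel_measurable borel"
  unfolding level_part_def[abs_def] by measurable

lemma level_weight_nonneg [simp]: "level_weight f n \<ge> 0"
  by (simp add: level_weight_def sum_nonneg)

lemma level_weight_suminf_le:
  assumes "f \<in> L2"
  shows "(\<Sum>n. ennreal (level_weight f n)) \<le> norm2 f"
proof (rule suminf_le_const[OF summableI])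
  fix N
  have "(\<Sum>n<N. ennreal (level_weight f n)) = ennreal (\<Sum>k\<in>below N. eig.weight (\<lambda>k. coefficient k f) k)"
    by (simp add: sum_below level_weight_def[symmetric])
  also have "\<dots> \<le> norm2 f" by (rule Bessel_coefficient[OF assms finite_below])
  finally show "(\<Sum>n<N. ennreal (level_weight f n)) \<le> norm2 f" .
qed

lemma coefficient_bound:
  assumes "f \<in> L2"
  shows "(cmod (coefficient k f))\<^sup>2 * eigenfun_norm k \<le> enn2real (norm2 f)"
proof -
  have "ennreal ((cmod (coefficient k f))\<^sup>2 * eigenfun_norm k) \<le> norm2 f"
    using Bessel_coefficient[OF assms, of "{k}"] by (simp add: eig.weight_def)
  from enn2real_mono[OF this] show ?thesis
    using assms by (simp add: L2_iff eigenfun_norm_pos less_imp_le)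
qed

text \<open>
  The number of multi-indices in a level and the suprema of the normalized eigenfunctions both grow at most
  like \<open>(2 n + 3)\<^sup>d\<close>. The bound is uniform in \<open>x\<close>, so that series with geometric factors converge
  uniformly on all of space.
\<close>

lemma level_sum_bound:
  fixes x :: "real ^ 'n"
  assumes "\<And>k. k \<in> level n \<Longrightarrow> (cmod (c k))\<^sup>2 * eigenfun_norm k \<le> q"
  shows "cmod (\<Sum>k\<in>level n. c k * of_real (eigenfun k x)) \<le> sqrt q * (2 * real n + 3) ^ (2 * CARD('n))"
proof -
  let ?p = "(2 * real n + 3) ^ CARD('n)"
  have p: "?p \<ge> 1" by simp
  have each: "cmod (c k * of_real (eigenfun k x)) \<le> sqrt q * ?p" if k: "k \<in> level n" for k
  proof -
    have "(cmod (c k * of_real (eigenfun k x)))\<^sup>2 = (cmod (c k))\<^sup>2 * (eigenfun k x)\<^sup>2"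
      by (simp add: norm_mult power_mult_distrib)
    also have "\<dots> \<le> (cmod (c k))\<^sup>2 * (eigenfun_norm k * ?p)"
      by (intro mult_left_mono eigenfun_bound k) auto
    also have "\<dots> = ((cmod (c k))\<^sup>2 * eigenfun_norm k) * ?p" by simp
    also have "\<dots> \<le> q * (?p * ?p)"
      using p assms[OF k] eigenfun_norm_pos[of k]
      by (intro mult_mono) (auto intro: order_trans[OF _ assms[OF k]] simp: less_imp_le mult_le_cancel_left1)
    finally have "(cmod (c k * of_real (eigenfun k x)))\<^sup>2 \<le> q * ?p\<^sup>2" by (simp add: power2_eq_square)
    from real_sqrt_le_mono[OF this] show ?thesis by (simp add: real_sqrt_mult)
  qed
  have "cmod (\<Sum>k\<in>level n. c k * of_real (eigenfun k x)) \<le> (\<Sum>k\<in>level n. cmod (c k * of_real (eigenfun k x)))"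
    by (rule norm_sum)
  also have "\<dots> \<le> of_nat (card (level n :: ('n \<Rightarrow> nat) set)) * (sqrt q * ?p)"
    by (rule sum_bounded_above) (rule each)
  also have "\<dots> \<le> ?p * (sqrt q * ?p)"
  proof (rule mult_right_mono)
    have "real (card (level n :: ('n \<Rightarrow> nat) set)) \<le> real ((n + 1) ^ CARD('n))"
      by (rule of_nat_mono[OF card_level_le])
    also have "\<dots> \<le> ?p" unfolding of_nat_power by (intro power_mono) auto
    finally show "real (card (level n :: ('n \<Rightarrow> nat) set)) \<le> ?p" .
    obtain k where "k \<in> (level n :: ('n \<Rightarrow> nat) set)"
      using that[of "(\<lambda>_. 0)(undefined := n)"] by (auto simp: level_def sum.If_cases fun_upd_def)
    then have "0 \<le> q"
      using assms[of k] eigenfun_norm_pos[of k] by (meson less_imp_le mult_nonneg_nonneg order_trans zero_le_power2)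
    then show "0 \<le> sqrt q * ?p" by simp
  qed
  also have "\<dots> = sqrt q * (2 * real n + 3) ^ (2 * CARD('n))"
  proof -
    have "y ^ (2 * d) = y ^ d * y ^ d" for y :: real and d
      by (simp add: mult_2 power_add)
    then show ?thesis by (simp only: mult.left_commute)
  qed
  finally show ?thesis .
qed

lemma level_part_bound:
  fixes f :: "real ^ 'n \<Rightarrow> complex"
  assumes "f \<in> L2"
  shows "cmod (level_part f n x) \<le> sqrt (enn2real (norm2 f)) * (2 * real n + 3) ^ (2 * CARD('n))"
  unfolding level_part_def by (rule level_sum_bound) (rule coefficient_bound[OF assms])

lemma level_part_summable:
  fixes f :: "real ^ 'n \<Rightarrow> complex"
  assumes "f \<in> L2" "\<bar>r\<bar> < 1"
  shows "summable (\<lambda>n. (2 * real n + 3) ^ p * \<bar>r\<bar> ^ n)"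
    and "summable (\<lambda>n. cmod (level_part f n x) * \<bar>r\<bar> ^ n)"
proof -
  have *: "summable (\<lambda>n. (2 * real n + 3) ^ p * \<bar>r\<bar> ^ n)" for p
  proof -
    have "norm ((2 * real n + 3) ^ p) \<le> 2 ^ p * (real n + 3 / 2) ^ p" for n
      by (simp flip: power_mult_distrib)
    from summable_poly_times_geometric[OF assms(2) this] show ?thesis by simp
  qed
  show "summable (\<lambda>n. (2 * real n + 3) ^ p * \<bar>r\<bar> ^ n)" by (rule *)
  show "summable (\<lambda>n. cmod (level_part f n x) * \<bar>r\<bar> ^ n)"
    by (rule summable_comparison_test'[OF summable_mult[OF *[of "2 * CARD('n)"], of "sqrt (enn2real (norm2 f))"], of 0])
      (use level_part_bound[OF assms(1), of _ x] in \<open>auto simp: mult.assoc[symmetric] intro!: mult_right_mono\<close>)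
qed

text \<open>
  The eigenvalue of level \<open>n\<close>; the type argument carries the dimension.
\<close>

definition rate :: "'n itself \<Rightarrow> nat \<Rightarrow> real" where
  "rate TYPE('n) n = 2 * real n + 2 * real CARD('n)"

text \<open>
  Orthogonality bounds the norms of the partial sums, and Fatou's lemma passes to the pointwise limit.
\<close>

lemma multiplier_bound:
  fixes f :: "real ^ 'n \<Rightarrow> complex"
  assumes "f \<in> L2" and sums: "\<And>x. (\<lambda>n. of_real (m n) * level_part f n x) sums G x"
  shows "norm2 G \<le> (\<Sum>n. ennreal ((m n)\<^sup>2) * ennreal (level_weight f n))"
proof -
  define S where "S N x = (\<Sum>n<N. of_real (m n) * level_part f n x)" for N x
  have [measurable]: "S N \<in> borel_measurable borel" for N
    unfolding S_def[abs_def] by measurable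
  have lim: "(\<lambda>N. S N x) \<longlonglongrightarrow> G x" for x using sums by (simp add: sums_def S_def)
  have [measurable]: "G \<in> borel_measurable borel"
    by (rule borel_measurable_LIMSEQ_metric[where f = S]) (use lim in auto)
  have "norm2 (S N) \<le> (\<Sum>n. ennreal ((m n)\<^sup>2) * ennreal (level_weight f n))" for N
  proof -
    let ?a = "\<lambda>k. of_real (m (\<Sum>j\<in>UNIV. k j)) * coefficient k f"
    have "S N = eig.comb (below N) ?a"
      unfolding S_def[abs_def] eig.comb_def[abs_def] sum_below level_part_def sum_distrib_left
      by (intro ext sum.cong refl) (auto simp: level_def mult.assoc)
    then have "norm2 (S N) = ennreal (\<Sum>k\<in>below N. eig.weight ?a k)"
      by (simp only: eig.sqnorm_comb[OF finite_below])
    also have "(\<Sum>k\<in>below N. eig.weight ?a k) = (\<Sum>n<N. (m n)\<^sup>2 * level_weight f n)"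
      unfolding sum_below level_weight_def sum_distrib_left
      by (intro sum.cong refl) (auto simp: level_def eig.weight_def norm_mult power_mult_distrib)
    also have "ennreal \<dots> = (\<Sum>n<N. ennreal ((m n)\<^sup>2) * ennreal (level_weight f n))"
      by (subst sum_ennreal[symmetric]) (auto simp: ennreal_mult)
    also have "\<dots> \<le> (\<Sum>n. ennreal ((m n)\<^sup>2) * ennreal (level_weight f n))"
      by (intro sum_le_suminf summableI) auto
    finally show ?thesis .
  qed
  then show ?thesis
    by (intro sqnorm_modulus_Fatou[where S = S]) (simp_all add: lim)
qed

definition heat :: "(real ^ 'n \<Rightarrow> complex) \<Rightarrow> real \<Rightarrow> real ^ 'n \<Rightarrow> complex" where
  "heat f t x = (\<Sum>n. of_real (exp (- t * rate TYPE('n) n)) * level_part f n x)"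

lemma exp_rate: "exp (- t * rate TYPE('n) n) = exp (- 2 * real CARD('n) * t) * exp (- 2 * t) ^ n"
  by (simp add: rate_def algebra_simps flip: exp_of_nat_mult exp_add)

lemma heat_summable:
  fixes f :: "real ^ 'n \<Rightarrow> complex"
  assumes "f \<in> L2" "t > 0"
  shows "summable (\<lambda>n. cmod (of_real (exp (- t * rate TYPE('n) n)) * level_part f n x))"
proof -
  have "summable (\<lambda>n. exp (- 2 * real CARD('n) * t) * (cmod (level_part f n x) * \<bar>exp (- 2 * t)\<bar> ^ n))"
    by (intro summable_mult level_part_summable(2) assms) (use assms in simp)
  also have "(\<lambda>n. exp (- 2 * real CARD('n) * t) * (cmod (level_part f n x) * \<bar>exp (- 2 * t)\<bar> ^ n))
      = (\<lambda>n. cmod (of_real (exp (- t * rate TYPE('n) n)) * level_part f n x))"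
    unfolding norm_mult norm_of_real exp_rate by (simp add: abs_mult power_abs mult_ac)
  finally show ?thesis .
qed

lemma heat_sums:
  fixes f :: "real ^ 'n \<Rightarrow> complex"
  assumes "f \<in> L2" "t > 0"
  shows "(\<lambda>n. of_real (exp (- t * rate TYPE('n) n)) * level_part f n x) sums heat f t x"
  unfolding heat_def by (intro summable_sums summable_norm_cancel[OF heat_summable] assms)

lemma heat_measurable [measurable]: "heat f t \<in> borel_measurable borel"
  unfolding heat_def[abs_def] by measurable

lemma heat_spectral:
  fixes f :: "real ^ 'n \<Rightarrow> complex"
  assumes f: "f \<in> L2" and t: "t > 0"
  shows "spectral (\<lambda>l. exp (- t * l)) f (heat f t)" "norm2 (heat f t) \<le> norm2 f"
proof -
  have le: "\<bar>exp (- t * eigenval k)\<bar> \<le> 1" for k :: "'n \<Rightarrow> nat"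
    using t eigenval_nonneg[of k] by simp
  have "eig.comb (below N) (\<lambda>k. of_real (exp (- t * eigenval k)) * coefficient k f) x
      = (\<Sum>n<N. of_real (exp (- t * rate TYPE('n) n)) * level_part f n x)" for N x
    unfolding eig.comb_def sum_below level_part_def sum_distrib_left
    by (intro sum.cong refl) (simp add: eigenval_level rate_def mult.assoc)
  then have lim: "AE x in inv_gauss. (\<lambda>N. eig.comb (below N) (\<lambda>k. of_real (exp (- t * eigenval k)) * coefficient k f) x) \<longlonglongrightarrow> heat f t x"
    using heat_sums[OF f t] by (simp add: sums_def)
  show "spectral (\<lambda>l. exp (- t * l)) f (heat f t)" "norm2 (heat f t) \<le> norm2 f"
    by (rule spectralI[OF f le _ finite_below filterlim_below lim], simp)+
qed

lemma heat_L2: "f \<in> L2 \<Longrightarrow> t > 0 \<Longrightarrow> heat f t \<in> L2"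
  using heat_spectral by (auto simp: spectral_def)

text \<open>
  Coefficients are continuous with respect to the convergence in the definition of \<^const>\<open>spectral\<close>. This
  gives the semigroup law on all of \<open>L\<^sup>2\<close>, whether or not \<open>f\<close> is the sum of its expansion.
\<close>

lemma coefficient_heat:
  assumes "f \<in> L2" "t > 0"
  shows "coefficient k (heat f t) = of_real (exp (- t * eigenval k)) * coefficient k f"
proof -
  have "((\<lambda>K. L2_norm (modulus (\<lambda>x. heat f t x - eig.comb K (\<lambda>k. of_real (exp (- t * eigenval k)) * coefficient k f) x))) \<longlongrightarrow> 0)
      (finite_subsets_at_top UNIV)"
    using heat_spectral(1)[OF assms] by (simp add: spectral_def eig.comb_def)
  from tendsto_mult_ennreal[OF this this]
  have "((\<lambda>K. norm2 (\<lambda>x. heat f t x - eig.comb K (\<lambda>k. of_real (exp (- t * eigenval k)) * coefficient k f) x)) \<longlongrightarrow> 0)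
      (finite_subsets_at_top UNIV)"
    by (simp add: L2_norm_power2[symmetric] power2_eq_square)
  from eig.coeff_of_limit[OF _ _ this] heat_L2[OF assms] show ?thesis
    by (simp add: coefficient_eq[symmetric] L2_iff eigenfun_norm_pos)
qed

lemma heat_semigroup:
  fixes f :: "real ^ 'n \<Rightarrow> complex"
  assumes "f \<in> L2" "s > 0"
  shows "heat (heat f s) t = heat f (t + s)"
proof -
  have "level_part (heat f s) n x = of_real (exp (- s * rate TYPE('n) n)) * level_part f n x" for n x
    unfolding level_part_def sum_distrib_left
    by (intro sum.cong refl) (simp add: coefficient_heat[OF assms] eigenval_level rate_def mult.assoc)
  moreover have "exp (- (t + s) * rate TYPE('n) n) = exp (- t * rate TYPE('n) n) * exp (- s * rate TYPE('n) n)" for n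
    by (simp add: algebra_simps flip: exp_add)
  ultimately show ?thesis
    unfolding heat_def[abs_def] by (simp add: mult.assoc)
qed

text \<open>
  On \<open>t > \<delta>\<close> the series converges uniformly in \<open>(t, x)\<close>, by comparison with a polynomial times \<open>e\<^bsup>-2\<delta>n\<^esup>\<close>.
\<close>

lemma heat_continuous:
  fixes f :: "real ^ 'n \<Rightarrow> complex"
  assumes f: "f \<in> L2"
  shows "continuous_on ({0<..} \<times> UNIV) (\<lambda>(t, x). heat f t x)"
proof -
  have part: "continuous_on A (level_part f n)" for A n
    unfolding level_part_def[abs_def]
    by (intro continuous_on_sum continuous_on_mult continuous_on_const continuous_on_of_real
        continuous_on_subset[OF continuous_eigenfun]) auto
  have on: "continuous_on ({\<delta><..} \<times> UNIV) (\<lambda>(t, x). heat f t x)" if \<delta>: "\<delta> > 0" for \<delta>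
  proof (rule uniform_limit_theorem)
    let ?B = "\<lambda>n. sqrt (enn2real (norm2 f)) * ((2 * real n + 3) ^ (2 * CARD('n)) * \<bar>exp (- 2 * \<delta>)\<bar> ^ n)"
    show "uniform_limit ({\<delta><..} \<times> UNIV) (\<lambda>N (t, x). \<Sum>n<N. of_real (exp (- t * rate TYPE('n) n)) * level_part f n x)
        (\<lambda>(t, x). heat f t x) sequentially"
      unfolding heat_def case_prod_unfold
    proof (rule Weierstrass_m_test)
      show "summable ?B"
        by (intro summable_mult level_part_summable(1)[OF f]) (use \<delta> in simp)
      fix n and p :: "real \<times> (real ^ 'n)" assume p: "p \<in> {\<delta><..} \<times> UNIV"
      then have t: "fst p > \<delta>" by auto
      have "exp (- fst p * rate TYPE('n) n) \<le> exp (- \<delta> * (2 * real n))"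
      proof -
        have "\<delta> * (2 * real n) \<le> fst p * rate TYPE('n) n"
          using t \<delta> by (intro mult_mono) (auto simp: rate_def)
        then show ?thesis by simp
      qed
      also have "\<dots> = \<bar>exp (- 2 * \<delta>)\<bar> ^ n" by (simp add: mult_ac flip: exp_of_nat_mult)
      finally have "exp (- fst p * rate TYPE('n) n) \<le> \<bar>exp (- 2 * \<delta>)\<bar> ^ n" .
      from mult_mono[OF this level_part_bound[OF f, of n "snd p"]]
      show "cmod (of_real (exp (- fst p * rate TYPE('n) n)) * level_part f n (snd p)) \<le> ?B n"
        by (simp add: norm_mult mult_ac)
    qed
    show "\<forall>\<^sub>F N in sequentially. continuous_on ({\<delta><..} \<times> UNIV) (\<lambda>(t, x). \<Sum>n<N. of_real (exp (- t * rate TYPE('n) n)) * level_part f n x)"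
      unfolding case_prod_unfold
      by (intro always_eventually allI continuous_on_sum continuous_on_mult continuous_on_of_real continuous_on_exp
          continuous_on_minus continuous_on_fst continuous_on_id continuous_on_const
          continuous_on_compose2[OF part continuous_on_snd[OF continuous_on_id]]) auto
  qed simp
  show ?thesis
  proof (rule continuous_at_imp_continuous_on, rule ballI)
    fix p :: "real \<times> (real ^ 'n)" assume "p \<in> {0<..} \<times> UNIV"
    then have "p \<in> {fst p / 2<..} \<times> UNIV" and "fst p / 2 > 0" by auto
    with on[of "fst p / 2"] show "isCont (\<lambda>(t, x). heat f t x) p"
      by (subst (asm) continuous_on_eq_continuous_at) (auto intro!: open_Times)
  qed
qed

lemma heat_semigroup_version: "f \<in> L2 \<Longrightarrow> semigroup_version f (heat f)"
  unfolding semigroup_version_def using heat_spectral heat_continuous by blast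

section \<open>The square function\<close>

lemma rate_pos: "rate TYPE('n::finite) n > 0"
  by (simp add: rate_def add_nonneg_pos)

text \<open>
  The series of the derivatives with respect to \<open>t\<close>.
\<close>

definition heat_dt :: "(real ^ 'n \<Rightarrow> complex) \<Rightarrow> real \<Rightarrow> real ^ 'n \<Rightarrow> complex" where
  "heat_dt f t x = (\<Sum>n. of_real (- rate TYPE('n) n * exp (- t * rate TYPE('n) n)) * level_part f n x)"

text \<open>
  For fixed \<open>x\<close> the function is \<open>e\<^bsup>-2dt\<^esup>\<close> times a power series in \<open>z = e\<^bsup>-2t\<^esup>\<close> with radius of convergence
  at least \<open>1\<close>, and power series may be differentiated term by term.
\<close>

lemma heat_derivative:
  fixes f :: "real ^ 'n \<Rightarrow> complex"
  assumes f: "f \<in> L2" and t: "t > 0"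
  shows "(\<lambda>n. of_real (- rate TYPE('n) n * exp (- t * rate TYPE('n) n)) * level_part f n x) sums heat_dt f t x"
    and "((\<lambda>s. heat f s x) has_vector_derivative heat_dt f t x) (at t)"
proof -
  let ?d = "real CARD('n)"
  define P where "P z = (\<Sum>n. level_part f n x * z ^ n)" for z :: complex
  define P' where "P' z = (\<Sum>n. diffs (\<lambda>n. level_part f n x) n * z ^ n)" for z :: complex
  have summable_P: "summable (\<lambda>n. level_part f n x * z ^ n)" if "norm z < 1" for z
    using level_part_summable(2)[OF f, of "norm z" x] that
    by (intro summable_norm_cancel[of "\<lambda>n. level_part f n x * z ^ n"]) (simp add: norm_mult norm_power)
  have summable_P': "summable (\<lambda>n. diffs (\<lambda>n. level_part f n x) n * z ^ n)" if "norm z < 1" for z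
    by (rule termdiff_converges[of z 1]) (use that summable_P in auto)
  have deriv_P: "(P has_field_derivative P' z) (at z)" if "norm z < 1" for z
    unfolding P_def[abs_def] P'_def by (rule termdiffs_strong'[of 1]) (use that summable_P in auto)
  define z where "z s = complex_of_real (exp (- 2 * s))" for s
  define w where "w s = complex_of_real (exp (- 2 * ?d * s))" for s
  have z_less: "norm (z s) < 1" if "s > 0" for s using that by (simp add: z_def)
  have expw: "of_real (exp (- s * rate TYPE('n) n)) = w s * z s ^ n" for s n
    unfolding exp_rate w_def z_def by simp
  have heat_P: "w s * P (z s) = heat f s x" if "s > 0" for s
    unfolding heat_def expw P_def
    by (subst suminf_mult[symmetric, OF summable_P[OF z_less[OF that]]]) (simp add: mult_ac)
  have nP: "(\<lambda>n. of_nat n * (level_part f n x * z t ^ n)) sums (z t * P' (z t))"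
  proof -
    have "(\<lambda>n. z t * (diffs (\<lambda>n. level_part f n x) n * z t ^ n)) sums (z t * P' (z t))"
      unfolding P'_def by (intro sums_mult summable_sums summable_P' z_less t)
    then have "(\<lambda>n. of_nat (Suc n) * (level_part f (Suc n) x * z t ^ Suc n)) sums (z t * P' (z t))"
      by (simp add: diffs_def mult_ac)
    then show ?thesis by (subst (asm) sums_Suc_iff) simp
  qed
  have "(\<lambda>n. - w t * (2 * (of_nat n * (level_part f n x * z t ^ n)) + 2 * of_real ?d * (level_part f n x * z t ^ n)))
      sums (- w t * (2 * (z t * P' (z t)) + 2 * of_real ?d * P (z t)))"
    unfolding P_def by (intro sums_mult sums_add nP summable_sums summable_P z_less t)
  moreover have "- w t * (2 * (of_nat n * (level_part f n x * z t ^ n)) + 2 * of_real ?d * (level_part f n x * z t ^ n))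
      = of_real (- rate TYPE('n) n * exp (- t * rate TYPE('n) n)) * level_part f n x" for n
    unfolding of_real_mult expw by (simp add: rate_def algebra_simps)
  ultimately have sums: "(\<lambda>n. of_real (- rate TYPE('n) n * exp (- t * rate TYPE('n) n)) * level_part f n x)
      sums (- w t * (2 * (z t * P' (z t)) + 2 * of_real ?d * P (z t)))" by simp
  then have eq: "heat_dt f t x = - w t * (2 * (z t * P' (z t)) + 2 * of_real ?d * P (z t))"
    unfolding heat_dt_def by (rule sums_unique[symmetric])
  show "(\<lambda>n. of_real (- rate TYPE('n) n * exp (- t * rate TYPE('n) n)) * level_part f n x) sums heat_dt f t x"
    unfolding eq by (rule sums)
  have "((\<lambda>s. exp (- 2 * s)) has_real_derivative (- 2 * exp (- 2 * t))) (at t)"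
    "((\<lambda>s. exp (- 2 * ?d * s)) has_real_derivative (- 2 * ?d * exp (- 2 * ?d * t))) (at t)"
    by (auto intro!: derivative_eq_intros)
  from this[THEN has_vector_derivative_of_real]
  have dz: "(z has_vector_derivative (- 2 * z t)) (at t)" and dw: "(w has_vector_derivative (- 2 * of_real ?d * w t)) (at t)"
    unfolding z_def[abs_def] w_def[abs_def] by simp_all
  have "((P \<circ> z) has_vector_derivative (- 2 * z t * P' (z t))) (at t)"
    by (rule field_vector_diff_chain_at[OF dz deriv_P[OF z_less[OF t]]])
  from has_vector_derivative_mult[OF dw this]
  have "((\<lambda>s. w s * P (z s)) has_vector_derivative heat_dt f t x) (at t)"
    unfolding eq by (simp add: algebra_simps)
  then show "((\<lambda>s. heat f s x) has_vector_derivative heat_dt f t x) (at t)"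
    by (rule has_vector_derivative_transform_within_open[where S = "{0<..}"]) (use t heat_P in auto)
qed

lemma heat_dt_measurable [measurable]:
  "(\<lambda>(t, x). heat_dt f t x) \<in> borel_measurable (lborel \<Otimes>\<^sub>M inv_gauss)"
proof -
  have [measurable]: "(\<lambda>p. level_part f n (snd p)) \<in> borel_measurable (lborel \<Otimes>\<^sub>M inv_gauss)" for n
    by (rule measurable_compose[OF measurable_snd]) simp
  show ?thesis unfolding heat_dt_def case_prod_unfold by measurable
qed

text \<open>
  The substitution \<open>t l = s\<close> shows that the value cannot depend on \<open>l\<close>.
\<close>

lemma nn_integral_t_exp:
  assumes l: "l > 0"
  shows "(\<integral>\<^sup>+t. ennreal (t * (l * exp (- t * l))\<^sup>2) * indicator {0..} t \<partial>lborel) = ennreal (1 / 4)"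
proof -
  let ?F = "\<lambda>t. - (t * l / 2 + 1 / 4) * exp (- 2 * l * t)"
  have "(\<integral>\<^sup>+t. ennreal (t * (l * exp (- t * l))\<^sup>2) * indicator {0..} t \<partial>lborel) = ennreal (0 - ?F 0)"
  proof (rule nn_integral_FTC_atLeast)
    show "(?F \<longlongrightarrow> 0) at_top" using l by real_asymp
    fix t :: real
    have e: "(exp (- t * l))\<^sup>2 = exp (- 2 * l * t)" by (simp add: power2_eq_square flip: exp_add)
    show "(?F has_real_derivative t * (l * exp (- t * l))\<^sup>2) (at t)"
      unfolding power_mult_distrib e
      by (auto intro!: derivative_eq_intros simp: power2_eq_square field_simps)
  qed (use l in auto)
  then show ?thesis by simp
qed

lemma ennsqrt_measurable [measurable]: "ennsqrt \<in> borel_measurable borel"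
  unfolding ennsqrt_def[abs_def] by measurable

theorem square_function_bounded:
  "L2_bounded (square_function :: (real ^ 'n \<Rightarrow> complex) \<Rightarrow> (real ^ 'n \<Rightarrow> ennreal) \<Rightarrow> bool)"
proof (rule L2_boundedI[of 1])
  fix f :: "real ^ 'n \<Rightarrow> complex" assume f: "f \<in> L2"
  interpret P: pair_sigma_finite "lborel :: real measure" "inv_gauss :: (real ^ 'n) measure" ..
  define h where "h x = (\<integral>\<^sup>+t\<in>{0<..}. ennreal ((cmod (of_real t * heat_dt f t x))\<^sup>2 / t) \<partial>lborel)" for x
  have [measurable]: "(\<lambda>(x, t). heat_dt f t x) \<in> borel_measurable (inv_gauss \<Otimes>\<^sub>M lborel)"
    using measurable_compose[OF measurable_pair_swap' heat_dt_measurable[of f]] by (simp add: case_prod_unfold)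
  have h [measurable]: "h \<in> borel_measurable borel"
    unfolding h_def borel_measurable_inv_gauss[symmetric] by measurable
  have "square_function f (\<lambda>x. ennsqrt (h x))"
    unfolding square_function_def h_def
    using heat_semigroup_version[OF f] heat_derivative(2)[OF f] by blast
  moreover have "(\<lambda>x. ennsqrt (h x)) \<in> borel_measurable borel" by measurable
  moreover have "sqnorm inv_gauss (\<lambda>x. ennsqrt (h x)) \<le> ennreal (1\<^sup>2) * norm2 f"
  proof -
    have sq: "ennreal ((cmod (of_real t * v))\<^sup>2 / t) * indicator {0<..} t = ennreal t * indicator {0<..} t * (ennreal (cmod v))\<^sup>2"
      for t and v :: complex
      by (auto simp: norm_mult power_mult_distrib indicator_def power2_eq_square ennreal_mult'' mult_ac)
    have "sqnorm inv_gauss (\<lambda>x. ennsqrt (h x)) = (\<integral>\<^sup>+x. (\<integral>\<^sup>+t. ennreal t * indicator {0<..} t * (modulus (heat_dt f t) x)\<^sup>2 \<partial>lborel) \<partial>inv_gauss)"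
      unfolding sqnorm_def ennsqrt_power2 h_def sq ..
    also have "\<dots> = (\<integral>\<^sup>+t. (\<integral>\<^sup>+x. ennreal t * indicator {0<..} t * (modulus (heat_dt f t) x)\<^sup>2 \<partial>inv_gauss) \<partial>lborel)"
      by (rule P.Fubini') measurable
    also have "\<dots> = (\<integral>\<^sup>+t. ennreal t * indicator {0<..} t * norm2 (heat_dt f t) \<partial>lborel)"
      unfolding sqnorm_def by (intro nn_integral_cong nn_integral_cmult) measurable
    also have "\<dots> \<le> (\<integral>\<^sup>+t. (\<Sum>n. ennreal (level_weight f n) *
        (ennreal (t * (rate TYPE('n) n * exp (- t * rate TYPE('n) n))\<^sup>2) * indicator {0..} t)) \<partial>lborel)"
    proof (intro nn_integral_mono)
      fix t :: real
      show "ennreal t * indicator {0<..} t * norm2 (heat_dt f t) \<le> (\<Sum>n. ennreal (level_weight f n) *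
        (ennreal (t * (rate TYPE('n) n * exp (- t * rate TYPE('n) n))\<^sup>2) * indicator {0..} t))"
      proof (cases "t > 0")
        case True
        have "norm2 (heat_dt f t) \<le> (\<Sum>n. ennreal ((- rate TYPE('n) n * exp (- t * rate TYPE('n) n))\<^sup>2) * ennreal (level_weight f n))"
          by (rule multiplier_bound[OF f heat_derivative(1)[OF f True]])
        then have "ennreal t * norm2 (heat_dt f t) \<le> ennreal t * (\<Sum>n. ennreal ((- rate TYPE('n) n * exp (- t * rate TYPE('n) n))\<^sup>2) * ennreal (level_weight f n))"
          by (rule mult_left_mono) simp
        also have "\<dots> = (\<Sum>n. ennreal t * (ennreal ((- rate TYPE('n) n * exp (- t * rate TYPE('n) n))\<^sup>2) * ennreal (level_weight f n)))"
          by (rule ennreal_suminf_cmult[symmetric])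
        also have "\<dots> = (\<Sum>n. ennreal (level_weight f n) * (ennreal (t * (rate TYPE('n) n * exp (- t * rate TYPE('n) n))\<^sup>2) * indicator {0..} t))"
          using True by (simp add: ennreal_mult' mult_ac)
        finally show ?thesis using True by simp
      qed simp
    qed
    also have "\<dots> = (\<Sum>n. \<integral>\<^sup>+t. ennreal (level_weight f n) *
        (ennreal (t * (rate TYPE('n) n * exp (- t * rate TYPE('n) n))\<^sup>2) * indicator {0..} t) \<partial>lborel)"
      by (rule nn_integral_suminf) measurable
    also have "\<dots> = (\<Sum>n. ennreal (level_weight f n) * ennreal (1 / 4))"
      by (subst nn_integral_cmult) (auto simp only: nn_integral_t_exp[OF rate_pos] intro!: measurable, measurable)
    also have "\<dots> \<le> (\<Sum>n. ennreal (level_weight f n))"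
      by (intro suminf_le summableI) (auto simp: ennreal_mult''[symmetric] intro!: ennreal_leI)
    also have "\<dots> \<le> norm2 f" by (rule level_weight_suminf_le[OF f])
    finally show ?thesis by simp
  qed
  ultimately show "\<exists>g. square_function f g \<and> g \<in> borel_measurable borel \<and> sqnorm inv_gauss g \<le> ennreal (1\<^sup>2) * norm2 f"
    by blast
qed simp

section \<open>The maximal function\<close>

lemma level_kernel_sym: "level_kernel n x y = level_kernel n y x"
  by (simp add: level_kernel_def mult.commute)

lemma level_kernel_measurable [measurable]:
  "(\<lambda>(x, y). level_kernel n x y) \<in> borel_measurable (inv_gauss \<Otimes>\<^sub>M inv_gauss)"
  "level_kernel n x \<in> borel_measurable borel"
proof -
  have [measurable]: "(\<lambda>p. eigenfun k (fst p)) \<in> borel_measurable (inv_gauss \<Otimes>\<^sub>M inv_gauss)"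
    "(\<lambda>p. eigenfun k (snd p)) \<in> borel_measurable (inv_gauss \<Otimes>\<^sub>M inv_gauss)" for k :: "'a \<Rightarrow> nat"
    by (rule measurable_compose[OF measurable_fst] measurable_compose[OF measurable_snd], simp)+
  show "(\<lambda>(x, y). level_kernel n x y) \<in> borel_measurable (inv_gauss \<Otimes>\<^sub>M inv_gauss)"
    unfolding level_kernel_def case_prod_unfold by measurable
  show "level_kernel n x \<in> borel_measurable borel"
    unfolding level_kernel_def[abs_def] by measurable
qed

definition heat_kernel :: "real \<Rightarrow> real ^ 'n \<Rightarrow> real ^ 'n \<Rightarrow> real" where
  "heat_kernel t x y = (\<Sum>n. exp (- t * rate TYPE('n) n) * level_kernel n x y)"

lemma heat_kernel_sym: "heat_kernel t x y = heat_kernel t y x"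
  by (simp add: heat_kernel_def level_kernel_sym[of _ x y])

lemma heat_kernel_measurable [measurable]:
  "(\<lambda>(x, y). heat_kernel t x y) \<in> borel_measurable (inv_gauss \<Otimes>\<^sub>M inv_gauss)"
  "heat_kernel t x \<in> borel_measurable borel"
proof -
  have [measurable]: "(\<lambda>p. level_kernel n (fst p) (snd p)) \<in> borel_measurable (inv_gauss \<Otimes>\<^sub>M inv_gauss)" for n
    using level_kernel_measurable(1)[of n] by (simp add: case_prod_unfold)
  show "(\<lambda>(x, y). heat_kernel t x y) \<in> borel_measurable (inv_gauss \<Otimes>\<^sub>M inv_gauss)"
    unfolding heat_kernel_def case_prod_unfold by measurable
  show "heat_kernel t x \<in> borel_measurable borel"
    unfolding heat_kernel_def[abs_def] by measurable
qed

text \<open>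
  Up to a positive factor the kernel is a product of Mehler kernels with parameter \<open>e\<^bsup>-2t\<^esup>\<close>.
\<close>

lemma heat_kernel_nonneg:
  fixes x y :: "real ^ 'n"
  assumes "t > 0"
  shows "heat_kernel t x y \<ge> 0"
proof -
  have r: "\<bar>exp (- 2 * t)\<bar> < 1" using assms by simp
  have "(\<lambda>n. exp (- 2 * real CARD('n) * t) * (level_kernel n x y * exp (- 2 * t) ^ n)) sums
      (exp (- 2 * real CARD('n) * t) * (\<Prod>j\<in>UNIV. mehler_kernel (x $ j) (y $ j) (exp (- 2 * t)) / pi))"
    by (intro sums_mult level_kernel_sums r)
  then have "heat_kernel t x y = exp (- 2 * real CARD('n) * t) * (\<Prod>j\<in>UNIV. mehler_kernel (x $ j) (y $ j) (exp (- 2 * t)) / pi)"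
    unfolding heat_kernel_def exp_rate by (intro sums_unique[symmetric]) (simp add: mult_ac)
  also have "\<dots> \<ge> 0"
    using mehler_kernel_pos[OF r] by (intro mult_nonneg_nonneg prod_nonneg) (auto simp: less_imp_le)
  finally show ?thesis .
qed

lemma cmod_of_real_divide_sq: "N > 0 \<Longrightarrow> (cmod (complex_of_real (a / N)))\<^sup>2 * N = a\<^sup>2 / N"
  unfolding norm_of_real power2_abs by (simp add: power_divide power2_eq_square)

lemma level_kernel_bound:
  fixes x y :: "real ^ 'n"
  shows "\<bar>level_kernel n x y\<bar> \<le> (2 * real n + 3) ^ (3 * CARD('n))"
proof -
  let ?p = "(2 * real n + 3) ^ CARD('n)"
  have p: "?p \<ge> 1" by simp
  have "cmod (\<Sum>k\<in>level n. of_real (eigenfun k x / eigenfun_norm k) * of_real (eigenfun k y)) \<le> sqrt ?p * (2 * real n + 3) ^ (2 * CARD('n))"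
  proof (rule level_sum_bound)
    fix k :: "'n \<Rightarrow> nat" assume "k \<in> level n"
    from eigenfun_bound[OF this, of x] show "(cmod (of_real (eigenfun k x / eigenfun_norm k)))\<^sup>2 * eigenfun_norm k \<le> ?p"
      unfolding cmod_of_real_divide_sq[OF eigenfun_norm_pos]
      by (simp add: pos_divide_le_eq[OF eigenfun_norm_pos] mult.commute)
  qed
  also have "(\<Sum>k\<in>level n. of_real (eigenfun k x / eigenfun_norm k) * of_real (eigenfun k y)) = complex_of_real (level_kernel n x y)"
    unfolding level_kernel_def of_real_sum by (intro sum.cong refl) simp
  also have "sqrt ?p \<le> ?p"
    using p by (intro real_le_lsqrt) (auto simp: power2_eq_square mult_le_cancel_left1)
  finally have "\<bar>level_kernel n x y\<bar> \<le> ?p * (2 * real n + 3) ^ (2 * CARD('n))"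
    by (simp add: mult_right_mono)
  also have "\<dots> = (2 * real n + 3) ^ (3 * CARD('n))"
    by (simp flip: power_add)
  finally show ?thesis .
qed

lemma level_kernel_norm2:
  fixes x :: "real ^ 'n"
  shows "norm2 (\<lambda>y. of_real (level_kernel n x y)) \<le> ennreal ((2 * real n + 3) ^ (3 * CARD('n)))"
proof -
  have "norm2 (\<lambda>y. of_real (level_kernel n x y)) = norm2 (eig.comb (level n) (\<lambda>k. of_real (eigenfun k x / eigenfun_norm k)))"
    by (simp add: eig.comb_def level_kernel_def)
  also have "\<dots> = ennreal (\<Sum>k\<in>level n. eig.weight (\<lambda>k. of_real (eigenfun k x / eigenfun_norm k)) k)"
    by (rule eig.sqnorm_comb) simp
  also have "(\<Sum>k\<in>level n. eig.weight (\<lambda>k. of_real (eigenfun k x / eigenfun_norm k)) k) = level_kernel n x x"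
    unfolding level_kernel_def eig.weight_def
    by (intro sum.cong refl) (subst cmod_of_real_divide_sq[OF eigenfun_norm_pos], simp add: power2_eq_square)
  also have "ennreal \<dots> \<le> ennreal ((2 * real n + 3) ^ (3 * CARD('n)))"
    using level_kernel_bound[of n x x] by (intro ennreal_leI) simp
  finally show ?thesis .
qed

lemma level_part_eq_kernel:
  assumes f: "f \<in> L2"
  shows "integrable inv_gauss (\<lambda>y. f y * of_real (level_kernel n x y))"
    and "(LINT y|inv_gauss. f y * of_real (level_kernel n x y)) = level_part f n x"
proof -
  have int: "integrable inv_gauss (\<lambda>y. f y * of_real (eigenfun k y))" for k
    using f by (intro eig.integrable_mult_E) (auto simp: L2_iff)
  have eq: "f y * of_real (level_kernel n x y)
      = (\<Sum>k\<in>level n. of_real (eigenfun k x / eigenfun_norm k) * (f y * of_real (eigenfun k y)))" for y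
    by (simp add: level_kernel_def sum_distrib_left mult_ac)
  show "integrable inv_gauss (\<lambda>y. f y * of_real (level_kernel n x y))"
    unfolding eq by (intro Bochner_Integration.integrable_sum integrable_mult_right int)
  have "(LINT y|inv_gauss. f y * of_real (level_kernel n x y))
      = (\<Sum>k\<in>level n. of_real (eigenfun k x / eigenfun_norm k) * (LINT y|inv_gauss. f y * of_real (eigenfun k y)))"
    unfolding eq by (subst Bochner_Integration.integral_sum) (auto intro!: int)
  also have "\<dots> = level_part f n x"
    unfolding level_part_def coefficient_eq eig.coeff_def by (intro sum.cong refl) simp
  finally show "(LINT y|inv_gauss. f y * of_real (level_kernel n x y)) = level_part f n x" .
qed

text \<open>
  Sum and integral may be interchanged because the norms of the level kernels in the second variable
  grow at most polynomially.
\<close>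

lemma heat_eq_kernel:
  fixes f :: "real ^ 'n \<Rightarrow> complex"
  assumes f: "f \<in> L2" and t: "t > 0"
  shows "integrable inv_gauss (\<lambda>y. f y * of_real (heat_kernel t x y))"
    and "(LINT y|inv_gauss. f y * of_real (heat_kernel t x y)) = heat f t x"
proof -
  let ?e = "\<lambda>n. exp (- t * rate TYPE('n) n)"
  let ?F = "\<lambda>n y. of_real (?e n) * (f y * of_real (level_kernel n x y))"
  let ?q = "enn2real (norm2 f)"
  have r: "\<bar>exp (- 2 * t)\<bar> < 1" using t by simp
  have fin: "norm2 f < \<infinity>" and [measurable]: "f \<in> borel_measurable borel" using f by (auto simp: L2_iff)
  have poly: "summable (\<lambda>n. (2 * real n + 3) ^ p * ?e n)" for p
    using summable_mult[OF level_part_summable(1)[OF f r, of p], of "exp (- 2 * real CARD('n) * t)"]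
    unfolding exp_rate by (simp add: mult_ac)
  have int: "integrable inv_gauss (?F n)" for n
    by (intro integrable_mult_right level_part_eq_kernel f)
  have summable_kernel: "summable (\<lambda>n. norm (?e n * level_kernel n x y))" for y
    by (rule summable_comparison_test'[OF poly[of "3 * CARD('n)"], of 0])
      (use level_kernel_bound[of _ x y] in \<open>auto simp: abs_mult mult.commute intro!: mult_right_mono\<close>)
  have sum_F: "(\<Sum>n. ?F n y) = f y * of_real (heat_kernel t x y)" for y
  proof -
    have "(\<lambda>n. ?e n * level_kernel n x y) sums heat_kernel t x y"
      unfolding heat_kernel_def by (intro summable_sums summable_norm_cancel[OF summable_kernel])
    then have "(\<lambda>n. f y * of_real (?e n * level_kernel n x y)) sums (f y * of_real (heat_kernel t x y))"
      by (intro sums_mult) (subst sums_of_real_iff)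
    then show ?thesis by (intro sums_unique[symmetric]) (simp add: mult_ac)
  qed
  have "AE y in inv_gauss. summable (\<lambda>n. norm (?F n y))"
  proof (rule AE_I2)
    fix y
    from summable_mult[OF summable_kernel[of y], of "cmod (f y)"]
    show "summable (\<lambda>n. norm (?F n y))" by (simp add: norm_mult abs_mult mult_ac)
  qed
  moreover have "summable (\<lambda>n. LINT y|inv_gauss. norm (?F n y))"
  proof (rule summable_comparison_test'[OF summable_mult[OF poly[of "3 * CARD('n)"], of "sqrt ?q"], of 0])
    fix n
    let ?p = "(2 * real n + 3) ^ (3 * CARD('n))"
    have "(ennreal (cmod (LINT y|inv_gauss. of_real (cmod (f y)) * of_real \<bar>level_kernel n x y\<bar>)))\<^sup>2
        \<le> norm2 (\<lambda>y. of_real (cmod (f y))) * norm2 (\<lambda>y. of_real \<bar>level_kernel n x y\<bar>)"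
      by (rule product_sqnorm_bound)
        (use fin level_kernel_norm2[of n x] in \<open>auto simp: ennreal_less_top[THEN le_less_trans[rotated]]\<close>)
    also have "\<dots> \<le> ennreal ?q * ennreal ?p"
      using fin level_kernel_norm2[of n x] by (intro mult_mono) auto
    also have "\<dots> \<le> ennreal (?q * ?p\<^sup>2)"
      by (auto simp: power2_eq_square mult_left_mono mult_le_cancel_left1 simp flip: ennreal_mult intro!: ennreal_leI)
    also have "\<dots> = (ennreal (sqrt ?q * ?p))\<^sup>2"
      by (simp add: ennreal_power power_mult_distrib)
    finally have "cmod (LINT y|inv_gauss. of_real (cmod (f y)) * of_real \<bar>level_kernel n x y\<bar>) \<le> sqrt ?q * ?p"
      unfolding ennreal_sq_mono_iff by simp
    then have le: "(LINT y|inv_gauss. cmod (f y) * \<bar>level_kernel n x y\<bar>) \<le> sqrt ?q * ?p"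
      by (simp flip: of_real_mult)
    have "(LINT y|inv_gauss. norm (?F n y)) = ?e n * (LINT y|inv_gauss. cmod (f y) * \<bar>level_kernel n x y\<bar>)"
      by (simp add: norm_mult)
    also have "\<dots> \<le> ?e n * (sqrt ?q * ?p)" by (intro mult_left_mono le) simp
    finally show "norm (LINT y|inv_gauss. norm (?F n y)) \<le> sqrt ?q * (?p * ?e n)"
      by (simp add: mult_ac integral_nonneg_AE)
  qed
  ultimately have "integrable inv_gauss (\<lambda>y. \<Sum>n. ?F n y)"
    "(LINT y|inv_gauss. (\<Sum>n. ?F n y)) = (\<Sum>n. LINT y|inv_gauss. ?F n y)"
    by (rule integrable_suminf[OF int] integral_suminf[OF int])+
  then show "integrable inv_gauss (\<lambda>y. f y * of_real (heat_kernel t x y))"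
    and "(LINT y|inv_gauss. f y * of_real (heat_kernel t x y)) = heat f t x"
    unfolding sum_F by (simp_all add: level_part_eq_kernel[OF f] heat_def)
qed

lemma heat_le_kernel:
  assumes f: "f \<in> L2" and t: "t > 0"
  shows "ennreal (cmod (heat f t x)) \<le> (\<integral>\<^sup>+y. ennreal (heat_kernel t x y) * modulus f y \<partial>inv_gauss)"
proof -
  have "ennreal (cmod (heat f t x)) \<le> (\<integral>\<^sup>+y. ennreal (cmod (f y * of_real (heat_kernel t x y))) \<partial>inv_gauss)"
    using integral_norm_bound_ennreal[OF heat_eq_kernel(1)[OF assms, of x]] heat_eq_kernel(2)[OF assms, of x] by simp
  also have "\<dots> = (\<integral>\<^sup>+y. ennreal (heat_kernel t x y) * modulus f y \<partial>inv_gauss)"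
    by (simp add: norm_mult ennreal_mult'' mult.commute heat_kernel_nonneg[OF t])
  finally show ?thesis .
qed

lemma kernel_apply_nonneg:
  fixes g :: "real ^ 'n \<Rightarrow> real"
  assumes g: "(\<lambda>y. of_real (g y)) \<in> L2" "\<And>y. g y \<ge> 0" and t: "t > 0"
  shows "(\<integral>\<^sup>+y. ennreal (heat_kernel t x y) * ennreal (g y) \<partial>inv_gauss) = modulus (heat (\<lambda>y. of_real (g y)) t) x"
    and "heat (\<lambda>y. of_real (g y)) t x = of_real (cmod (heat (\<lambda>y. of_real (g y)) t x))"
proof -
  have "integrable inv_gauss (\<lambda>y. complex_of_real (g y * heat_kernel t x y))"
    using heat_eq_kernel(1)[OF g(1) t] by simp
  then have int: "integrable inv_gauss (\<lambda>y. g y * heat_kernel t x y)"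
    unfolding complex_of_real_integrable_eq .
  have heat: "heat (\<lambda>y. of_real (g y)) t x = of_real (LINT y|inv_gauss. g y * heat_kernel t x y)"
    using heat_eq_kernel(2)[OF g(1) t, of x] by (simp flip: of_real_mult)
  have nonneg: "0 \<le> (LINT y|inv_gauss. g y * heat_kernel t x y)"
    by (intro Bochner_Integration.integral_nonneg) (simp add: g(2) heat_kernel_nonneg[OF t])
  show "heat (\<lambda>y. of_real (g y)) t x = of_real (cmod (heat (\<lambda>y. of_real (g y)) t x))"
    unfolding heat using nonneg by simp
  have "(\<integral>\<^sup>+y. ennreal (heat_kernel t x y) * ennreal (g y) \<partial>inv_gauss) = (\<integral>\<^sup>+y. ennreal (g y * heat_kernel t x y) \<partial>inv_gauss)"
    using g(2) by (simp add: ennreal_mult' mult.commute)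
  also have "\<dots> = ennreal (LINT y|inv_gauss. g y * heat_kernel t x y)"
    by (intro nn_integral_eq_integral int AE_I2) (simp add: g(2) heat_kernel_nonneg[OF t])
  finally show "(\<integral>\<^sup>+y. ennreal (heat_kernel t x y) * ennreal (g y) \<partial>inv_gauss) = modulus (heat (\<lambda>y. of_real (g y)) t) x"
    unfolding heat using nonneg by simp
qed

text \<open>
  A function with values in \<open>[0,\<infinity>]\<close> and finite norm is finite almost everywhere, and the kernel
  operator does not see the exceptional null set.
\<close>

lemma kernel_apply:
  fixes g :: "real ^ 'n \<Rightarrow> ennreal"
  assumes [measurable]: "g \<in> borel_measurable borel" and fin: "sqnorm inv_gauss g < \<infinity>"
  obtains f where "f \<in> L2" "norm2 f = sqnorm inv_gauss g"
    "\<And>t x. t > 0 \<Longrightarrow> (\<integral>\<^sup>+y. ennreal (heat_kernel t x y) * g y \<partial>inv_gauss) = modulus (heat f t) x"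
    "\<And>t x. t > 0 \<Longrightarrow> heat f t x = of_real (cmod (heat f t x))"
proof -
  define h where "h y = enn2real (g y)" for y
  have [measurable]: "h \<in> borel_measurable borel" unfolding h_def[abs_def] by measurable
  have "AE y in inv_gauss. (g y)\<^sup>2 \<noteq> \<infinity>"
    by (rule nn_integral_noteq_infinite) (use fin in \<open>auto simp: sqnorm_def\<close>)
  then have ae: "AE y in inv_gauss. g y = ennreal (h y)"
  proof eventually_elim
    case (elim y)
    then show ?case by (cases "g y") (auto simp: h_def power2_eq_square)
  qed
  have eq: "norm2 (\<lambda>y. of_real (h y)) = sqnorm inv_gauss g"
    unfolding sqnorm_def by (rule nn_integral_cong_AE, use ae in eventually_elim) (simp add: h_def)
  with fin have L2: "(\<lambda>y. of_real (h y)) \<in> L2" by (simp add: L2_iff)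
  have "(\<integral>\<^sup>+y. ennreal (heat_kernel t x y) * g y \<partial>inv_gauss) = (\<integral>\<^sup>+y. ennreal (heat_kernel t x y) * ennreal (h y) \<partial>inv_gauss)" for t x
    by (rule nn_integral_cong_AE, use ae in eventually_elim) simp
  with that[OF L2 eq] kernel_apply_nonneg[OF L2] show thesis by (simp add: h_def)
qed

lemma heat_symmetric_positive_semigroup:
  assumes "\<tau> > 0"
  shows "symmetric_positive_semigroup inv_gauss (\<lambda>n x y :: real ^ 'n. ennreal (heat_kernel (real n * \<tau>) x y))"
proof (intro symmetric_positive_semigroup.intro sigma_finite_inv_gauss symmetric_positive_semigroup_axioms.intro)
  show "(\<lambda>(x, y :: real ^ 'n). ennreal (heat_kernel (real n * \<tau>) x y)) \<in> borel_measurable (inv_gauss \<Otimes>\<^sub>M inv_gauss)" for n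
    using heat_kernel_measurable(1)[of "real n * \<tau>"] by (simp add: case_prod_unfold)
  show "ennreal (heat_kernel (real n * \<tau>) x y) = ennreal (heat_kernel (real n * \<tau>) y x)" for n and x y :: "real ^ 'n"
    by (simp add: heat_kernel_sym[of _ x y])
next
  fix n :: nat and g :: "real ^ 'n \<Rightarrow> ennreal" assume n: "1 \<le> n" and g: "g \<in> borel_measurable inv_gauss" "sqnorm inv_gauss g < \<infinity>"
  have t: "real n * \<tau> > 0" using n assms by simp
  obtain f where f: "f \<in> L2" "norm2 f = sqnorm inv_gauss g"
    "\<And>t x. t > 0 \<Longrightarrow> (\<integral>\<^sup>+y. ennreal (heat_kernel t x y) * g y \<partial>inv_gauss) = modulus (heat f t) x"
    by (rule kernel_apply[of g]) (use g in auto)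
  show "sqnorm inv_gauss (\<lambda>x. \<integral>\<^sup>+y. ennreal (heat_kernel (real n * \<tau>) x y) * g y \<partial>inv_gauss) \<le> sqnorm inv_gauss g"
    using heat_spectral(2)[OF f(1) t] by (simp add: f(2) f(3)[OF t])
  fix m x assume m: "1 \<le> (m::nat)"
  have s: "real m * \<tau> > 0" using m assms by simp
  obtain f where f: "f \<in> L2" "norm2 f = sqnorm inv_gauss g"
    "\<And>t x. t > 0 \<Longrightarrow> (\<integral>\<^sup>+y. ennreal (heat_kernel t x y) * g y \<partial>inv_gauss) = modulus (heat f t) x"
    "\<And>t x. t > 0 \<Longrightarrow> heat f t x = of_real (cmod (heat f t x))"
    by (rule kernel_apply[of g]) (use g in auto)
  define h where "h x = cmod (heat f (real n * \<tau>) x)" for x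
  have h: "(\<lambda>x. of_real (h x)) = heat f (real n * \<tau>)"
    unfolding h_def using f(4)[OF t] by auto
  have "(\<integral>\<^sup>+y. ennreal (heat_kernel (real m * \<tau>) x y) * modulus (heat f (real n * \<tau>)) y \<partial>inv_gauss)
      = modulus (heat (\<lambda>x. of_real (h x)) (real m * \<tau>)) x"
    unfolding h_def[symmetric]
  proof (rule kernel_apply_nonneg(1)[OF _ _ s])
    show "(\<lambda>x. of_real (h x)) \<in> L2" unfolding h by (rule heat_L2[OF f(1) t])
  qed (simp add: h_def)
  also have "\<dots> = modulus (heat f (real (m + n) * \<tau>)) x"
    unfolding h heat_semigroup[OF f(1) t] by (simp add: distrib_right)
  finally show "(\<integral>\<^sup>+y. ennreal (heat_kernel (real m * \<tau>) x y) * (\<integral>\<^sup>+z. ennreal (heat_kernel (real n * \<tau>) y z) * g z \<partial>inv_gauss) \<partial>inv_gauss)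
      = (\<integral>\<^sup>+z. ennreal (heat_kernel (real (m + n) * \<tau>) x z) * g z \<partial>inv_gauss)"
    using s t by (simp add: f(3) distrib_right)
qed

lemma ennreal_suminf_swap: "(\<Sum>i. \<Sum>j. f i j) = (\<Sum>j. \<Sum>i. f i j :: ennreal)"
  using nn_integral_suminf[of "\<lambda>j i. f i j" "count_space UNIV"] by (simp add: nn_integral_count_space_nat)

text \<open>
  Summation by parts. It expresses the difference between a term and the mean of the terms up to it through the
  increments.
\<close>

lemma mean_plus_increments:
  fixes a :: "nat \<Rightarrow> complex"
  shows "of_nat N * a N = (\<Sum>j=1..N. a j) + (\<Sum>j=1..<N. of_nat j * (a (Suc j) - a j))"
proof (induction N)
  case (Suc N)
  then show ?case
    by (cases "N = 0") (simp_all add: algebra_simps)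
qed simp

text \<open>
  The Cauchy-Schwarz inequality with the weights \<open>j\<close>: the sum of \<open>j\<close> below \<open>N\<close> is at most \<open>N\<^sup>2\<close>, which
  cancels the factor \<open>1 / N\<close> in front of the increments.
\<close>

lemma power2_le_mean_plus_square_function:
  fixes a :: "nat \<Rightarrow> complex"
  assumes "N \<ge> 1"
  shows "(ennreal (cmod (a N)))\<^sup>2 \<le> 2 * (ennreal (1 / real N) * (\<Sum>j=1..N. ennreal (cmod (a j))))\<^sup>2
      + 2 * (\<Sum>j. ennreal (real (Suc j) * (cmod (a (Suc (Suc j)) - a (Suc j)))\<^sup>2))"
proof -
  define d where "d j = cmod (a (Suc j) - a j)" for j
  define x where "x = 1 / real N * (\<Sum>j=1..N. cmod (a j))"
  define y where "y = 1 / real N * (\<Sum>j=1..<N. real j * d j)"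
  have N: "real N > 0" using assms by simp
  have "real N * cmod (a N) = cmod (of_nat N * a N)" by (simp add: norm_mult)
  also have "\<dots> \<le> (\<Sum>j=1..N. cmod (a j)) + (\<Sum>j=1..<N. real j * d j)"
    unfolding mean_plus_increments
    by (intro order_trans[OF norm_triangle_ineq] add_mono order_trans[OF norm_sum] sum_mono) (auto simp: norm_mult d_def)
  finally have "cmod (a N) \<le> x + y"
    using N by (simp add: x_def y_def field_simps)
  moreover have "x \<ge> 0" "y \<ge> 0" by (auto simp: x_def y_def d_def intro!: divide_nonneg_nonneg mult_nonneg_nonneg sum_nonneg)
  ultimately have "(ennreal (cmod (a N)))\<^sup>2 \<le> (ennreal x + ennreal y)\<^sup>2"
    unfolding ennreal_sq_mono_iff by (simp flip: ennreal_plus)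
  also have "\<dots> \<le> 2 * (ennreal x)\<^sup>2 + 2 * (ennreal y)\<^sup>2" by (rule ennreal_sq_add_le)
  finally have split: "(ennreal (cmod (a N)))\<^sup>2 \<le> 2 * (ennreal x)\<^sup>2 + 2 * (ennreal y)\<^sup>2" .
  have x_eq: "ennreal x = ennreal (1 / real N) * (\<Sum>j=1..N. ennreal (cmod (a j)))"
    unfolding x_def by (subst ennreal_mult', simp, subst sum_ennreal[symmetric], simp_all)
  have y_le: "(ennreal y)\<^sup>2 \<le> (\<Sum>j. ennreal (real (Suc j) * (cmod (a (Suc (Suc j)) - a (Suc j)))\<^sup>2))"
  proof -
    have "(\<Sum>j=1..<N. real j * d j)\<^sup>2 = (\<Sum>j=1..<N. sqrt (real j) * (sqrt (real j) * d j))\<^sup>2"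
      by (simp flip: mult.assoc)
    also have "\<dots> \<le> (\<Sum>j=1..<N. (sqrt (real j))\<^sup>2) * (\<Sum>j=1..<N. (sqrt (real j) * d j)\<^sup>2)"
      by (rule Cauchy_Schwarz_ineq_sum)
    also have "\<dots> = (\<Sum>j=1..<N. real j) * (\<Sum>j=1..<N. real j * (d j)\<^sup>2)"
      by (simp add: power_mult_distrib)
    also have "\<dots> \<le> (real N)\<^sup>2 * (\<Sum>j=1..<N. real j * (d j)\<^sup>2)"
    proof (intro mult_right_mono sum_nonneg)
      have "(\<Sum>j=1..<N. real j) \<le> of_nat (card {1..<N}) * real N"
        by (intro sum_bounded_above) auto
      also have "\<dots> \<le> (real N)\<^sup>2" unfolding power2_eq_square by (intro mult_right_mono) auto
      finally show "(\<Sum>j=1..<N. real j) \<le> (real N)\<^sup>2" .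
    qed auto
    finally have "y\<^sup>2 \<le> (\<Sum>j=1..<N. real j * (d j)\<^sup>2)"
      using N by (simp add: y_def power_mult_distrib power_divide pos_divide_le_eq mult.commute)
    also have "\<dots> = (\<Sum>j<N - 1. real (Suc j) * (d (Suc j))\<^sup>2)"
      using assms by (intro sum.reindex_bij_witness[of _ Suc "\<lambda>j. j - 1"]) auto
    finally have "ennreal (y\<^sup>2) \<le> ennreal (\<Sum>j<N - 1. real (Suc j) * (d (Suc j))\<^sup>2)" by (rule ennreal_leI)
    also have "\<dots> = (\<Sum>j<N - 1. ennreal (real (Suc j) * (d (Suc j))\<^sup>2))"
      by (rule sum_ennreal[symmetric]) simp
    also have "\<dots> \<le> (\<Sum>j. ennreal (real (Suc j) * (d (Suc j))\<^sup>2))"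
      by (intro sum_le_suminf summableI) auto
    finally show ?thesis using \<open>y \<ge> 0\<close> by (simp add: ennreal_power d_def)
  qed
  have "2 * (ennreal y)\<^sup>2 \<le> 2 * (\<Sum>j. ennreal (real (Suc j) * (cmod (a (Suc (Suc j)) - a (Suc j)))\<^sup>2))"
    by (rule mult_left_mono[OF y_le]) simp
  from order_trans[OF split add_left_mono[OF this]] show ?thesis
    unfolding x_eq .
qed

text \<open>
  The sum equals \<open>r\<^sup>2 / (1 + r)\<^sup>2\<close> by the series for \<open>1 / (1 - r\<^sup>2)\<^sup>2\<close>. It stays bounded as \<open>r\<close> tends to \<open>1\<close>,
  that is, as the step size of the discretization tends to \<open>0\<close>.
\<close>

lemma geometric_square_function_le:
  fixes r :: real
  assumes "0 < r" "r < 1"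
  shows "(\<Sum>j. ennreal (real (Suc j) * (r ^ Suc (Suc j) - r ^ Suc j)\<^sup>2)) \<le> 1"
proof -
  have r2: "norm (r\<^sup>2) < 1" using assms by (simp add: abs_square_less_1)
  have "(\<lambda>j. (1 - r)\<^sup>2 * r\<^sup>2 * (of_nat (Suc j) * (r\<^sup>2) ^ j)) sums ((1 - r)\<^sup>2 * r\<^sup>2 * (1 / (1 - r\<^sup>2)\<^sup>2))"
    by (intro sums_mult geometric_deriv_sums r2)
  also have "(\<lambda>j. (1 - r)\<^sup>2 * r\<^sup>2 * (of_nat (Suc j) * (r\<^sup>2) ^ j)) = (\<lambda>j. real (Suc j) * (r ^ Suc (Suc j) - r ^ Suc j)\<^sup>2)"
  proof
    fix j
    have "r ^ Suc (Suc j) - r ^ Suc j = - ((1 - r) * r * r ^ j)" by (simp add: algebra_simps)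
    then have "(r ^ Suc (Suc j) - r ^ Suc j)\<^sup>2 = (1 - r)\<^sup>2 * r\<^sup>2 * (r\<^sup>2) ^ j"
      by (simp only: power2_minus power_mult_distrib power_mult[symmetric] mult.commute[of _ 2])
    then show "(1 - r)\<^sup>2 * r\<^sup>2 * (of_nat (Suc j) * (r\<^sup>2) ^ j) = real (Suc j) * (r ^ Suc (Suc j) - r ^ Suc j)\<^sup>2"
      by (simp only: mult_ac)
  qed
  finally have sums: "(\<lambda>j. real (Suc j) * (r ^ Suc (Suc j) - r ^ Suc j)\<^sup>2) sums ((1 - r)\<^sup>2 * r\<^sup>2 * (1 / (1 - r\<^sup>2)\<^sup>2))" .
  have "1 - r\<^sup>2 = (1 - r) * (1 + r)" by (simp add: power2_eq_square algebra_simps)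
  then have "(1 - r)\<^sup>2 * r\<^sup>2 * (1 / (1 - r\<^sup>2)\<^sup>2) = r\<^sup>2 / (1 + r)\<^sup>2"
    using assms by (simp add: power_mult_distrib)
  also have "\<dots> \<le> 1" using assms by (auto simp: divide_le_eq_1 intro: power_mono)
  finally have "suminf (\<lambda>j. real (Suc j) * (r ^ Suc (Suc j) - r ^ Suc j)\<^sup>2) \<le> 1"
    using sums_unique[OF sums] by simp
  then show ?thesis
    by (subst suminf_ennreal2) (use sums in \<open>auto simp: sums_iff intro!: ennreal_leI simp del: power_Suc of_nat_Suc\<close>)
qed

lemma discrete_square_function:
  fixes f :: "real ^ 'n \<Rightarrow> complex"
  assumes f: "f \<in> L2" and \<tau>: "\<tau> > 0"
  shows "(\<integral>\<^sup>+x. (\<Sum>j. ennreal (real (Suc j) *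
      (cmod (heat f (real (Suc (Suc j)) * \<tau>) x - heat f (real (Suc j) * \<tau>) x))\<^sup>2)) \<partial>inv_gauss) \<le> norm2 f"
proof -
  let ?r = "\<lambda>n. exp (- \<tau> * rate TYPE('n) n)"
  have r: "exp (- (real m * \<tau>) * rate TYPE('n) n) = ?r n ^ m" for m n
    by (simp add: mult_ac flip: exp_of_nat_mult)
  have diff: "norm2 (\<lambda>x. heat f (real (Suc (Suc j)) * \<tau>) x - heat f (real (Suc j) * \<tau>) x)
      \<le> (\<Sum>n. ennreal ((?r n ^ Suc (Suc j) - ?r n ^ Suc j)\<^sup>2) * ennreal (level_weight f n))" for j
  proof (rule multiplier_bound[OF f])
    fix x
    have "real (Suc (Suc j)) * \<tau> > 0" "real (Suc j) * \<tau> > 0" using \<tau> by simp_all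
    from sums_diff[OF heat_sums[OF f this(1), of x] heat_sums[OF f this(2), of x]]
    show "(\<lambda>n. of_real (?r n ^ Suc (Suc j) - ?r n ^ Suc j) * level_part f n x) sums
        (heat f (real (Suc (Suc j)) * \<tau>) x - heat f (real (Suc j) * \<tau>) x)"
      unfolding r by (simp only: of_real_diff left_diff_distrib)
  qed
  have "(\<integral>\<^sup>+x. (\<Sum>j. ennreal (real (Suc j) *
      (cmod (heat f (real (Suc (Suc j)) * \<tau>) x - heat f (real (Suc j) * \<tau>) x))\<^sup>2)) \<partial>inv_gauss)
      = (\<Sum>j. ennreal (real (Suc j)) * norm2 (\<lambda>x. heat f (real (Suc (Suc j)) * \<tau>) x - heat f (real (Suc j) * \<tau>) x))"
    unfolding sqnorm_def
    by (simp add: nn_integral_suminf ennreal_mult ennreal_power nn_integral_cmult del: of_nat_Suc)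
  also have "\<dots> \<le> (\<Sum>j. ennreal (real (Suc j)) * (\<Sum>n. ennreal ((?r n ^ Suc (Suc j) - ?r n ^ Suc j)\<^sup>2) * ennreal (level_weight f n)))"
    by (intro suminf_le summableI mult_left_mono diff) auto
  also have "\<dots> = (\<Sum>j. \<Sum>n. ennreal (level_weight f n) * ennreal (real (Suc j) * (?r n ^ Suc (Suc j) - ?r n ^ Suc j)\<^sup>2))"
    by (subst ennreal_suminf_cmult[symmetric]) (simp add: ennreal_mult mult_ac del: of_nat_Suc power_Suc)
  also have "\<dots> = (\<Sum>n. ennreal (level_weight f n) * (\<Sum>j. ennreal (real (Suc j) * (?r n ^ Suc (Suc j) - ?r n ^ Suc j)\<^sup>2)))"
    by (subst ennreal_suminf_swap) (simp only: ennreal_suminf_cmult)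
  also have "\<dots> \<le> (\<Sum>n. ennreal (level_weight f n) * 1)"
    by (intro suminf_le summableI mult_left_mono geometric_square_function_le) (auto simp: \<tau> rate_pos)
  also have "\<dots> \<le> norm2 f" using level_weight_suminf_le[OF f] by simp
  finally show ?thesis .
qed

text \<open>
  The maximal theorem for averages contributes \<open>2 \<cdot> 16\<close> and the square function contributes \<open>2\<close>; the
  sum \<open>34\<close> is rounded up to a square. The constant does not depend on the step \<open>\<tau>\<close>.
\<close>

lemma discrete_maximal:
  fixes f :: "real ^ 'n \<Rightarrow> complex"
  assumes f: "f \<in> L2" and \<tau>: "\<tau> > 0"
  shows "sqnorm inv_gauss (\<lambda>x. SUP n. ennreal (cmod (heat f (real (Suc n) * \<tau>) x))) \<le> ennreal (6\<^sup>2) * norm2 f"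
proof -
  interpret heat: symmetric_positive_semigroup inv_gauss "\<lambda>n x y :: real ^ 'n. ennreal (heat_kernel (real n * \<tau>) x y)"
    by (rule heat_symmetric_positive_semigroup[OF \<tau>])
  have [measurable]: "f \<in> borel_measurable borel" using f by (simp add: L2_iff)
  let ?A = "\<lambda>x. SUP n. heat.avg (Suc n) (modulus f) x"
  let ?D = "\<lambda>x. \<Sum>j. ennreal (real (Suc j) * (cmod (heat f (real (Suc (Suc j)) * \<tau>) x - heat f (real (Suc j) * \<tau>) x))\<^sup>2)"
  have avg_meas: "heat.avg n (modulus f) \<in> borel_measurable borel" for n
    using heat.avg_measurable[of "modulus f" n] by simp
  note [measurable] = avg_meas
  have pt: "(SUP n. ennreal (cmod (heat f (real (Suc n) * \<tau>) x)))\<^sup>2 \<le> 2 * (?A x)\<^sup>2 + 2 * ?D x" for x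
  proof (rule Sup_sq_le)
    fix n
    have "(\<Sum>j=1..Suc n. ennreal (cmod (heat f (real j * \<tau>) x))) \<le> (\<Sum>j=1..Suc n. heat.kernel_op j (modulus f) x)"
      unfolding heat.kernel_op_def using \<tau> by (intro sum_mono heat_le_kernel f) auto
    then have "ennreal (1 / real (Suc n)) * (\<Sum>j=1..Suc n. ennreal (cmod (heat f (real j * \<tau>) x))) \<le> heat.avg (Suc n) (modulus f) x"
      unfolding heat.avg_def by (rule mult_left_mono) simp
    also have "\<dots> \<le> ?A x" by (rule SUP_upper) simp
    finally have "(ennreal (1 / real (Suc n)) * (\<Sum>j=1..Suc n. ennreal (cmod (heat f (real j * \<tau>) x))))\<^sup>2 \<le> (?A x)\<^sup>2"
      by (simp only: ennreal_sq_mono_iff)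
    then have "2 * (ennreal (1 / real (Suc n)) * (\<Sum>j=1..Suc n. ennreal (cmod (heat f (real j * \<tau>) x))))\<^sup>2 + 2 * ?D x
        \<le> 2 * (?A x)\<^sup>2 + 2 * ?D x"
      by (intro add_right_mono mult_left_mono) auto
    then show "(ennreal (cmod (heat f (real (Suc n) * \<tau>) x)))\<^sup>2 \<le> 2 * (?A x)\<^sup>2 + 2 * ?D x"
      by (rule order_trans[OF power2_le_mean_plus_square_function[of "Suc n" "\<lambda>j. heat f (real j * \<tau>) x"], rotated]) simp
  qed
  have "sqnorm inv_gauss (\<lambda>x. SUP n. ennreal (cmod (heat f (real (Suc n) * \<tau>) x))) \<le> (\<integral>\<^sup>+x. 2 * (?A x)\<^sup>2 + 2 * ?D x \<partial>inv_gauss)"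
    unfolding sqnorm_def by (intro nn_integral_mono pt)
  also have "\<dots> = 2 * sqnorm inv_gauss ?A + 2 * (\<integral>\<^sup>+x. ?D x \<partial>inv_gauss)"
    unfolding sqnorm_def by (subst nn_integral_add) (simp_all add: nn_integral_cmult)
  also have "\<dots> \<le> 2 * (16 * norm2 f) + 2 * norm2 f"
    using f by (intro add_mono mult_left_mono heat.maximal_ergodic discrete_square_function \<tau>) (auto simp: L2_iff)
  also have "\<dots> = ennreal 34 * norm2 f" by (simp add: distrib_right[symmetric] mult.assoc[symmetric])
  also have "\<dots> \<le> ennreal (6\<^sup>2) * norm2 f" by (intro mult_right_mono ennreal_leI) auto
  finally show ?thesis .
qed

text \<open>
  The multiples of \<open>2\<^bsup>-m\<^esup>\<close> form an increasing sequence of sets with dense union in \<open>t > 0\<close>, so by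
  continuity the discrete maximal functions increase to the full one, which is thereby measurable.
\<close>

theorem maximal_op_bounded:
  "L2_bounded (maximal_op :: (real ^ 'n \<Rightarrow> complex) \<Rightarrow> (real ^ 'n \<Rightarrow> ennreal) \<Rightarrow> bool)"
proof (rule L2_boundedI[of 6])
  fix f :: "real ^ 'n \<Rightarrow> complex" assume f: "f \<in> L2"
  define g where "g x = (SUP t\<in>{0<..}. ennreal (cmod (heat f t x)))" for x
  define G where "G m x = (SUP n. ennreal (cmod (heat f (real (Suc n) * (1 / 2 ^ m)) x)))" for m :: nat and x
  have [measurable]: "G m \<in> borel_measurable borel" for m unfolding G_def[abs_def] by measurable
  have g_eq: "g x = (SUP m. G m x)" for x
  proof (rule antisym)
    show "(SUP m. G m x) \<le> g x"
      unfolding G_def g_def by (intro SUP_least SUP_upper) auto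
    show "g x \<le> (SUP m. G m x)"
      unfolding g_def
    proof (rule SUP_least)
      fix t :: real assume "t \<in> {0<..}"
      then have t: "t > 0" by simp
      define s where "s m = real (Suc (nat \<lfloor>t * 2 ^ m\<rfloor>)) * (1 / 2 ^ m)" for m :: nat
      have "\<bar>s m - t\<bar> \<le> (1 / 2) ^ m" for m
      proof -
        define A where "A = real (Suc (nat \<lfloor>t * 2 ^ m\<rfloor>)) - t * 2 ^ m"
        have "real (nat \<lfloor>t * 2 ^ m\<rfloor>) = of_int \<lfloor>t * 2 ^ m\<rfloor>" using t by simp
        then have "\<bar>A\<bar> \<le> 1"
          unfolding A_def using floor_correct[of "t * 2 ^ m"] by simp linarith
        moreover have "s m - t = A * (1 / 2) ^ m"
          by (simp add: A_def s_def power_one_over field_simps)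
        ultimately show ?thesis
          using mult_right_mono[of "\<bar>A\<bar>" 1 "(1 / 2) ^ m"] by (simp add: abs_mult)
      qed
      then have "(\<lambda>m. s m - t) \<longlonglongrightarrow> 0"
        by (intro Lim_null_comparison[OF _ LIMSEQ_power_zero[of "1 / 2 :: real"]]) auto
      then have "s \<longlonglongrightarrow> t" by (rule LIM_zero_cancel)
      moreover have "isCont (\<lambda>s. heat f s x) t"
      proof -
        have "continuous_on {0<..} (\<lambda>s. (\<lambda>(t, x). heat f t x) (s, x))"
          by (rule continuous_on_compose2[OF heat_continuous[OF f]]) (auto intro!: continuous_intros)
        then show ?thesis using t by (simp add: continuous_on_eq_continuous_at)
      qed
      ultimately have "(\<lambda>m. heat f (s m) x) \<longlonglongrightarrow> heat f t x"
        by (rule isCont_tendsto_compose[rotated])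
      then have "(\<lambda>m. ennreal (cmod (heat f (s m) x))) \<longlonglongrightarrow> ennreal (cmod (heat f t x))"
        by (intro tendsto_ennrealI tendsto_norm)
      then show "ennreal (cmod (heat f t x)) \<le> (SUP m. G m x)"
      proof (rule LIMSEQ_le_const2, intro exI allI impI)
        fix m
        have "ennreal (cmod (heat f (s m) x)) \<le> G m x" unfolding G_def s_def by (rule SUP_upper) simp
        also have "\<dots> \<le> (SUP m. G m x)" by (rule SUP_upper) simp
        finally show "ennreal (cmod (heat f (s m) x)) \<le> (SUP m. G m x)" .
      qed
    qed
  qed
  have mono: "G m x \<le> G (Suc m) x" for m x
    unfolding G_def
  proof (rule SUP_least)
    fix n
    have "real (Suc n) * (1 / 2 ^ m) = real (Suc (2 * n + 1)) * (1 / 2 ^ Suc m)" by (simp add: field_simps)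
    then show "ennreal (cmod (heat f (real (Suc n) * (1 / 2 ^ m)) x)) \<le> (SUP n. ennreal (cmod (heat f (real (Suc n) * (1 / 2 ^ Suc m)) x)))"
      by (metis (no_types, lifting) SUP_upper UNIV_I)
  qed
  have "maximal_op f g"
    unfolding maximal_op_def using heat_semigroup_version[OF f] by (auto simp: g_def[abs_def])
  moreover have "g \<in> borel_measurable borel" unfolding g_eq[abs_def] by measurable
  moreover have "sqnorm inv_gauss g \<le> ennreal (6\<^sup>2) * norm2 f"
  proof -
    have "sqnorm inv_gauss g \<le> (\<integral>\<^sup>+x. (SUP m. (G m x)\<^sup>2) \<partial>inv_gauss)"
      unfolding sqnorm_def g_eq by (intro nn_integral_mono Sup_sq_le SUP_upper) auto
    also have "\<dots> = (SUP m. sqnorm inv_gauss (G m))"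
      unfolding sqnorm_def
    proof (intro nn_integral_monotone_convergence_SUP)
      show "incseq (\<lambda>m x. (G m x)\<^sup>2)"
        by (intro incseq_SucI le_funI power_mono mono) auto
    qed measurable
    also have "\<dots> \<le> ennreal (6\<^sup>2) * norm2 f"
      unfolding G_def[abs_def] by (intro SUP_least discrete_maximal f) auto
    finally show ?thesis .
  qed
  ultimately show "\<exists>g. maximal_op f g \<and> g \<in> borel_measurable borel \<and> sqnorm inv_gauss g \<le> ennreal (6\<^sup>2) * norm2 f"
    by blast
qed simp

section \<open>Weak derivatives of limits\<close>

text \<open>
  The weight \<open>e\<^bsup>|x|\<^sup>2\<^esup>\<close> has an integrable reciprocal; hence \<open>L\<^sup>2(\<gamma>\<^bsub>-d\<^esub>)\<close> is continuously embedded in the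
  unweighted \<open>L\<^sup>1\<close>.
\<close>

lemma norm2_lborel_bound:
  fixes f :: "real ^ 'n \<Rightarrow> complex"
  assumes [measurable]: "f \<in> borel_measurable borel"
  shows "(\<integral>\<^sup>+x. modulus f x \<partial>lborel)\<^sup>2 \<le> norm2 f * (\<integral>\<^sup>+x. ennreal (1 / inv_gauss_density (x :: real ^ 'n)) \<partial>lborel)"
proof -
  have w: "inv_gauss_density x > 0" for x :: "real ^ 'n" by (rule inv_gauss_density_pos)
  let ?s = "\<lambda>x :: real ^ 'n. ennreal (sqrt (inv_gauss_density x))" and ?r = "\<lambda>x :: real ^ 'n. ennreal (1 / sqrt (inv_gauss_density x))"
  have "(\<integral>\<^sup>+x. modulus f x \<partial>lborel) = (\<integral>\<^sup>+x. (?s x * modulus f x) * ?r x \<partial>lborel)"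
  proof (intro nn_integral_cong)
    fix x
    have "?s x * ?r x = 1" using w[of x] by (simp flip: ennreal_mult')
    then show "modulus f x = (?s x * modulus f x) * ?r x"
      by (metis mult.commute mult.left_commute mult_1)
  qed
  then have "(\<integral>\<^sup>+x. modulus f x \<partial>lborel)\<^sup>2 \<le> (\<integral>\<^sup>+x. (?s x * modulus f x)\<^sup>2 \<partial>lborel) * (\<integral>\<^sup>+x. (?r x)\<^sup>2 \<partial>lborel)"
    using Cauchy_Schwarz_nn_integral[of "\<lambda>x. ?s x * modulus f x" lborel ?r] by simp
  also have "(\<integral>\<^sup>+x. (?s x * modulus f x)\<^sup>2 \<partial>lborel) = norm2 f"
    unfolding sqnorm_def inv_gauss_eq
    by (subst nn_integral_density) (use w in \<open>auto simp: power_mult_distrib ennreal_power less_imp_le intro!: nn_integral_cong\<close>)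
  also have "(\<integral>\<^sup>+x. (?r x)\<^sup>2 \<partial>lborel) = (\<integral>\<^sup>+x. ennreal (1 / inv_gauss_density (x :: real ^ 'n)) \<partial>lborel)"
    by (intro nn_integral_cong) (use w in \<open>simp add: ennreal_power power_divide less_imp_le\<close>)
  finally show ?thesis .
qed

lemma inverse_density_finite:
  "(\<integral>\<^sup>+x. ennreal (1 / inv_gauss_density (x :: real ^ 'n)) \<partial>lborel) < \<infinity>"
proof -
  have eq: "1 / inv_gauss_density x = pi powr (- (real CARD('n) / 2)) * (\<Prod>j\<in>UNIV. exp (- 1 * (x $ j)\<^sup>2))" for x :: "real ^ 'n"
  proof -
    have "(\<Prod>j\<in>UNIV. exp (- 1 * (x $ j)\<^sup>2)) = exp (- (norm x)\<^sup>2)"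
      by (simp add: norm_vec_sq exp_sum flip: sum_negf)
    then show ?thesis
      unfolding inv_gauss_density_def by (simp only:) (simp add: powr_minus exp_minus field_simps)
  qed
  have "integrable lborel (\<lambda>x::real^'n. 1 / inv_gauss_density x)"
    unfolding eq by (intro integrable_mult_right lborel_vec_prod_integral(1) integrable_gaussian) simp
  then show ?thesis
    by (subst nn_integral_eq_integral) (auto simp: inv_gauss_density_pos less_imp_le)
qed

lemma L2_integrable_lborel:
  assumes "f \<in> L2"
  shows "integrable lborel f"
proof -
  have "(\<integral>\<^sup>+x. modulus f x \<partial>lborel)\<^sup>2 < \<infinity>"
    by (rule le_less_trans[OF norm2_lborel_bound])
      (use assms inverse_density_finite in \<open>auto simp: L2_iff ennreal_mult_less_top\<close>)
  then show ?thesis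
    using assms by (intro integrableI_bounded) (simp_all add: ennreal_sq_less_top[simplified] L2_iff)
qed

lemma L2_loc_integrable:
  assumes "f \<in> L2"
  shows "loc_integrable f"
  unfolding loc_integrable_def set_integrable_def
  using assms L2_integrable_lborel[OF assms]
  by (auto simp: L2_iff intro!: integrable_mult_indicator compact_imp_closed borel_closed)

lemma norm2_limit_imp_integral_limit:
  fixes S :: "nat \<Rightarrow> real ^ 'n \<Rightarrow> complex" and p :: "real ^ 'n \<Rightarrow> real"
  assumes S: "\<And>n. S n \<in> L2" and G: "G \<in> L2"
    and lim: "(\<lambda>n. norm2 (\<lambda>x. G x - S n x)) \<longlonglongrightarrow> 0"
    and p [measurable]: "p \<in> borel_measurable borel" and B: "\<And>x. \<bar>p x\<bar> \<le> B"
  shows "integrable lborel (\<lambda>x. G x * of_real (p x))"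
    and "(\<lambda>n. LINT x|lborel. S n x * of_real (p x)) \<longlonglongrightarrow> (LINT x|lborel. G x * of_real (p x))"
proof -
  have int: "integrable lborel (\<lambda>x. f x * of_real (p x))" if "f \<in> L2" for f
  proof (rule Bochner_Integration.integrable_bound)
    have [measurable]: "f \<in> borel_measurable borel" using that by (simp add: L2_iff)
    show "(\<lambda>x. f x * of_real (p x)) \<in> borel_measurable lborel" by measurable
    show "integrable lborel (\<lambda>x. of_real B * f x)" by (intro integrable_mult_right L2_integrable_lborel that)
    show "AE x in lborel. norm (f x * of_real (p x)) \<le> norm (of_real B * f x)"
      using B order_trans[OF abs_ge_zero B] by (auto simp: norm_mult mult.commute intro!: mult_right_mono)
  qed
  show "integrable lborel (\<lambda>x. G x * of_real (p x))" by (rule int[OF G])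
  have [measurable]: "S n \<in> borel_measurable borel" "G \<in> borel_measurable borel" for n
    using S G by (auto simp: L2_iff)
  have B0: "B \<ge> 0" using order_trans[OF abs_ge_zero B] .
  let ?I = "\<integral>\<^sup>+x. ennreal (1 / inv_gauss_density (x :: real ^ 'n)) \<partial>lborel"
  let ?d = "\<lambda>n. cmod ((LINT x|lborel. S n x * of_real (p x)) - (LINT x|lborel. G x * of_real (p x)))"
  have le: "(ennreal (?d n))\<^sup>2 \<le> (ennreal B)\<^sup>2 * (norm2 (\<lambda>x. G x - S n x) * ?I)" for n
  proof -
    have "?d n = cmod (LINT x|lborel. S n x * of_real (p x) - G x * of_real (p x))"
      by (simp add: int S G)
    also have "ennreal \<dots> \<le> (\<integral>\<^sup>+x. ennreal (cmod (S n x * of_real (p x) - G x * of_real (p x))) \<partial>lborel)"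
      by (intro integral_norm_bound_ennreal Bochner_Integration.integrable_diff int S G)
    also have "\<dots> \<le> (\<integral>\<^sup>+x. ennreal B * ennreal (cmod (G x - S n x)) \<partial>lborel)"
    proof (intro nn_integral_mono)
      fix x
      have "cmod (S n x * of_real (p x) - G x * of_real (p x)) = \<bar>p x\<bar> * cmod (G x - S n x)"
      proof -
        have "S n x * of_real (p x) - G x * of_real (p x) = - (of_real (p x) * (G x - S n x))"
          by (simp add: algebra_simps)
        then show ?thesis by (simp only: norm_minus_cancel norm_mult norm_of_real)
      qed
      also have "\<dots> \<le> B * cmod (G x - S n x)" by (intro mult_right_mono B) simp
      finally show "ennreal (cmod (S n x * of_real (p x) - G x * of_real (p x))) \<le> ennreal B * ennreal (cmod (G x - S n x))"
        using B0 by (simp add: ennreal_leI flip: ennreal_mult)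
    qed
    also have "\<dots> = ennreal B * (\<integral>\<^sup>+x. modulus (\<lambda>x. G x - S n x) x \<partial>lborel)"
      by (rule nn_integral_cmult) simp
    finally have "(ennreal (?d n))\<^sup>2 \<le> (ennreal B)\<^sup>2 * (\<integral>\<^sup>+x. modulus (\<lambda>x. G x - S n x) x \<partial>lborel)\<^sup>2"
      unfolding power_mult_distrib[symmetric] ennreal_sq_mono_iff .
    also have "\<dots> \<le> (ennreal B)\<^sup>2 * (norm2 (\<lambda>x. G x - S n x) * ?I)"
      by (intro mult_left_mono norm2_lborel_bound) simp_all
    finally show ?thesis .
  qed
  have "(\<lambda>n. (ennreal B)\<^sup>2 * (norm2 (\<lambda>x. G x - S n x) * ?I)) \<longlonglongrightarrow> (ennreal B)\<^sup>2 * (0 * ?I)"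
    using inverse_density_finite[where 'n = 'n]
    by (intro tendsto_mult_ennreal tendsto_const lim) (auto simp: ennreal_power[OF B0])
  then have "(\<lambda>n. (ennreal B)\<^sup>2 * (norm2 (\<lambda>x. G x - S n x) * ?I)) \<longlonglongrightarrow> 0" by simp
  from tendsto_sandwich[OF _ _ tendsto_const this, of "\<lambda>n. (ennreal (?d n))\<^sup>2"] le
  have "(\<lambda>n. ennreal ((?d n)\<^sup>2)) \<longlonglongrightarrow> ennreal 0" by (simp add: ennreal_power)
  then have "(\<lambda>n. (?d n)\<^sup>2) \<longlonglongrightarrow> 0" by (subst (asm) tendsto_ennreal_iff) auto
  from tendsto_real_sqrt[OF this] have "?d \<longlonglongrightarrow> 0" by simp
  then show "(\<lambda>n. LINT x|lborel. S n x * of_real (p x)) \<longlonglongrightarrow> (LINT x|lborel. G x * of_real (p x))"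
    by (rule LIM_zero_cancel[OF tendsto_norm_zero_cancel])
qed

lemma continuous_compact_support:
  fixes p :: "real ^ 'n \<Rightarrow> real"
  assumes c: "continuous_on UNIV p" and K: "compact K" "\<And>x. x \<notin> K \<Longrightarrow> p x = 0"
  shows "integrable lborel p" and "\<exists>B. \<forall>x. \<bar>p x\<bar> \<le> B"
proof -
  have "integrable lborel (\<lambda>x. indicator K x *\<^sub>R p x)"
    using borel_integrable_compact[OF K(1) continuous_on_subset[OF c]] by (simp add: set_integrable_def)
  also have "(\<lambda>x. indicator K x *\<^sub>R p x) = p"
    by (rule ext) (use K(2) in \<open>auto simp: indicator_def\<close>)
  finally show "integrable lborel p" .
  have "bounded (p ` K)"
    by (intro compact_imp_bounded compact_continuous_image continuous_on_subset[OF c] K) auto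
  then obtain B where "\<And>x. x \<in> K \<Longrightarrow> \<bar>p x\<bar> \<le> B" by (auto simp: bounded_iff)
  then have "\<bar>p x\<bar> \<le> max B 0" for x using K(2)[of x] by (cases "x \<in> K") (auto simp: le_max_iff_disj)
  then show "\<exists>B. \<forall>x. \<bar>p x\<bar> \<le> B" by blast
qed

text \<open>
  The difference quotients of \<open>w\<close> in direction \<open>i\<close> have integral \<open>0\<close> by translation invariance. They converge
  to \<open>D\<close> boundedly, and the steps are at most \<open>1\<close>, so they all vanish outside one fixed ball.
\<close>

lemma LINT_pdv_eq_0:
  fixes w :: "real ^ 'n \<Rightarrow> real"
  assumes deriv: "\<And>x. ((\<lambda>s. w (x + s *\<^sub>R axis i 1)) has_real_derivative D x) (at 0)"
    and contD: "continuous_on UNIV D" and contw: "continuous_on UNIV w"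
    and K: "compact K" "\<And>x. x \<notin> K \<Longrightarrow> w x = 0"
  shows "(LINT x|lborel. D x) = 0"
proof -
  let ?e = "axis i 1 :: real ^ 'n"
  have deriv_at: "((\<lambda>s. w (x + s *\<^sub>R ?e)) has_real_derivative D (x + s *\<^sub>R ?e)) (at s)" for x s
  proof -
    have "((\<lambda>u. w (x + (s + u) *\<^sub>R ?e)) has_real_derivative D (x + s *\<^sub>R ?e)) (at 0)"
      using deriv[of "x + s *\<^sub>R ?e"] by (simp add: scaleR_add_left add.assoc)
    then show ?thesis using DERIV_shift[of "\<lambda>u. w (x + u *\<^sub>R ?e)" _ 0 s] by (simp add: add.commute)
  qed
  obtain R where R: "\<And>x. x \<in> K \<Longrightarrow> norm x \<le> R"
    using compact_imp_bounded[OF K(1)] by (auto simp: bounded_iff)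
  define K' where "K' = cball (0 :: real ^ 'n) (R + 1)"
  have D0: "D x = 0" if "norm x > R" for x
  proof -
    have "open {y :: real ^ 'n. norm y > R}" by (intro open_Collect_less continuous_intros)
    moreover have "isCont (\<lambda>s. x + s *\<^sub>R ?e) 0" by (intro continuous_intros)
    ultimately have "\<forall>\<^sub>F s in nhds 0. norm (x + s *\<^sub>R ?e) > R"
      using that unfolding continuous_within tendsto_def by (auto simp: eventually_at_filter elim!: allE[of _ "{y. norm y > R}"] eventually_mono)
    then have "\<forall>\<^sub>F s in nhds 0. w (x + s *\<^sub>R ?e) = 0"
      by eventually_elim (use K(2) R in force)
    then have "((\<lambda>s. w (x + s *\<^sub>R ?e)) has_real_derivative 0) (at 0)"
      by (subst DERIV_cong_ev[OF refl _ refl, where g = "\<lambda>_. 0"]) auto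
    with deriv[of x] show ?thesis by (rule DERIV_unique)
  qed
  have "bounded (D ` K')"
    unfolding K'_def by (intro compact_imp_bounded compact_continuous_image continuous_on_subset[OF contD]) auto
  then obtain B where B: "\<And>x. x \<in> K' \<Longrightarrow> \<bar>D x\<bar> \<le> B" by (auto simp: bounded_iff)
  have B0: "B \<ge> 0 \<or> K' = {}" using B abs_ge_zero order_trans by (metis all_not_in_conv)
  have DB: "\<bar>D x\<bar> \<le> max B 0" for x
    using B[of x] D0[of x] by (cases "norm x > R") (auto simp: K'_def le_max_iff_disj)
  define s where "s n = 1 / real (Suc n)" for n
  have s: "s n > 0" "s n \<le> 1" for n by (auto simp: s_def)
  have [measurable]: "w \<in> borel_measurable borel" "D \<in> borel_measurable borel"
    using contw contD by (auto intro: borel_measurable_continuous_onI)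
  have int_w: "integrable lborel w"
    by (rule continuous_compact_support(1)[OF contw K])
  define q where "q n x = (w (x + s n *\<^sub>R ?e) - w x) / s n" for n x
  have shift: "integrable lborel (\<lambda>x. w (x + c))" "(LINT x|lborel. w (x + c)) = (LINT x|lborel. w x)" for c
  proof -
    have "integrable (distr lborel borel ((+) c)) w" using int_w by (simp add: lborel_distr_plus)
    then show "integrable lborel (\<lambda>x. w (x + c))"
      by (subst (asm) integrable_distr_eq) (auto simp: add.commute)
    have "(LINT x|lborel. w x) = (LINT x|distr lborel borel ((+) c). w x)" by (simp add: lborel_distr_plus)
    also have "\<dots> = (LINT x|lborel. w (x + c))" by (subst integral_distr) (auto simp: add.commute)
    finally show "(LINT x|lborel. w (x + c)) = (LINT x|lborel. w x)" by simp
  qed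
  have "(\<lambda>n. LINT x|lborel. q n x) \<longlonglongrightarrow> (LINT x|lborel. D x)"
  proof (rule integral_dominated_convergence[where w = "\<lambda>x. max B 0 * indicator K' x"])
    show "integrable lborel (\<lambda>x. max B 0 * indicator K' x)"
    proof (intro integrable_mult_right integrable_real_indicator)
      show "emeasure lborel K' < \<infinity>" unfolding K'_def by (rule emeasure_bounded_finite) simp
    qed (simp add: K'_def)
    show "AE x in lborel. (\<lambda>n. q n x) \<longlonglongrightarrow> D x"
    proof (rule AE_I2)
      fix x
      have "filterlim s (at 0) sequentially"
        unfolding s_def filterlim_at using LIMSEQ_inverse_real_of_nat by (auto simp: inverse_eq_divide)
      moreover have "((\<lambda>h. (w (x + h *\<^sub>R ?e) - w x) / h) \<longlongrightarrow> D x) (at 0)"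
        using deriv[of x] by (simp add: DERIV_def)
      ultimately show "(\<lambda>n. q n x) \<longlonglongrightarrow> D x"
        unfolding q_def by (rule filterlim_compose[rotated])
    qed
    show "AE x in lborel. norm (q n x) \<le> max B 0 * indicator K' x" for n
    proof (rule AE_I2)
      fix x
      show "norm (q n x) \<le> max B 0 * indicator K' x"
      proof (cases "x \<in> K'")
        case True
        obtain z where "w (x + s n *\<^sub>R ?e) - w (x + 0 *\<^sub>R ?e) = (s n - 0) * D (x + z *\<^sub>R ?e)"
          using MVT2[of 0 "s n" "\<lambda>s. w (x + s *\<^sub>R ?e)" "\<lambda>s. D (x + s *\<^sub>R ?e)"] deriv_at s(1)[of n] by blast
        then have "q n x = D (x + z *\<^sub>R ?e)" using s(1)[of n] by (simp add: q_def)
        with DB True show ?thesis by simp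
      next
        case False
        then have x: "norm x > R + 1" by (simp add: K'_def)
        have "norm x \<le> norm (x + s n *\<^sub>R ?e) + norm (s n *\<^sub>R ?e)"
          using norm_triangle_ineq4[of "x + s n *\<^sub>R ?e" "s n *\<^sub>R ?e"] by simp
        also have "norm (s n *\<^sub>R ?e) \<le> 1" using s[of n] by (simp add: norm_axis_1)
        finally have "norm (x + s n *\<^sub>R ?e) > R" using x by simp
        with x have "x + s n *\<^sub>R ?e \<notin> K" "x \<notin> K" using R by force+
        then show ?thesis using K(2) False by (simp add: q_def)
      qed
    qed
    show "q n \<in> borel_measurable lborel" for n unfolding q_def[abs_def] by measurable
  qed measurable
  moreover have "(LINT x|lborel. q n x) = 0" for n
    unfolding q_def by (simp add: shift int_w)
  ultimately have "(\<lambda>n. 0) \<longlonglongrightarrow> (LINT x|lborel. D x)" by simp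
  then show ?thesis using LIMSEQ_unique tendsto_const by blast
qed

section \<open>The Riesz transforms\<close>

lemma test_functionD:
  assumes "test_function p"
  shows "((\<lambda>s. p (x + s *\<^sub>R axis i 1)) has_real_derivative pdv i p x) (at 0)"
    and "continuous_on UNIV p" and "continuous_on UNIV (pdv i p)"
    and "\<exists>K. compact K \<and> (\<forall>x. x \<notin> K \<longrightarrow> p x = 0)"
proof -
  have C: "C_k m p" for m using assms by (simp add: test_function_def)
  have diff: "p differentiable (at x)" for x using C[of 1] by simp
  have "pdv i p differentiable (at x)" for x using C[of 2] by (simp add: numeral_2_eq_2)
  then show "continuous_on UNIV (pdv i p)"
    by (intro continuous_at_imp_continuous_on ballI differentiable_imp_continuous_within)
  show "continuous_on UNIV p"
    using diff by (intro continuous_at_imp_continuous_on ballI differentiable_imp_continuous_within)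
  show "\<exists>K. compact K \<and> (\<forall>x. x \<notin> K \<longrightarrow> p x = 0)" using assms by (simp add: test_function_def)
  have "((\<lambda>s. x + s *\<^sub>R axis i 1) has_derivative (\<lambda>s. s *\<^sub>R axis i 1)) (at 0)"
    by (auto intro!: derivative_eq_intros)
  then have "(\<lambda>s. x + s *\<^sub>R axis i 1) differentiable (at 0)"
    unfolding differentiable_def by blast
  then have "(p \<circ> (\<lambda>s. x + s *\<^sub>R axis i 1)) differentiable (at 0)"
    using diff by (intro differentiable_chain_at) auto
  then show "((\<lambda>s. p (x + s *\<^sub>R axis i 1)) has_real_derivative pdv i p x) (at 0)"
    unfolding pdv_def has_real_derivative_iff_has_vector_derivative
    by (simp add: vector_derivative_works[symmetric] comp_def)
qed

lemma pdv_vanishes_outside_support: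
  assumes p: "test_function p" and K: "compact K" "\<And>x. x \<notin> K \<Longrightarrow> p x = 0" and x: "x \<notin> K"
  shows "pdv i p x = 0"
proof -
  have "open (- K)" using K(1) by (simp add: compact_imp_closed open_Compl)
  moreover have "((\<lambda>s. x + s *\<^sub>R axis i 1) \<longlongrightarrow> x + 0 *\<^sub>R axis i 1) (nhds 0)"
    by (intro tendsto_intros filterlim_ident)
  ultimately have "\<forall>\<^sub>F s in nhds 0. x + s *\<^sub>R axis i 1 \<in> - K"
    using x by (intro topological_tendstoD) auto
  then have "\<forall>\<^sub>F s in nhds 0. p (x + s *\<^sub>R axis i 1) = 0"
    by eventually_elim (use K(2) in auto)
  then have "((\<lambda>s. p (x + s *\<^sub>R axis i 1)) has_real_derivative 0) (at 0)"
    by (subst DERIV_cong_ev[OF refl _ refl, where g = "\<lambda>_. 0"]) auto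
  with test_functionD(1)[OF p] show ?thesis by (rule DERIV_unique)
qed

definition raise :: "'n \<Rightarrow> ('n \<Rightarrow> nat) \<Rightarrow> ('n \<Rightarrow> nat)" where
  "raise i k = k(i := Suc (k i))"

definition lower :: "'n \<Rightarrow> ('n \<Rightarrow> nat) \<Rightarrow> ('n \<Rightarrow> nat)" where
  "lower i k = k(i := k i - 1)"

lemma eigenfun_parts:
  assumes "test_function p"
  shows "(LINT x|lborel. eigenfun k x * pdv i p x) = (LINT x|lborel. eigenfun (raise i k) x * p x)"
    and "integrable lborel (\<lambda>x. eigenfun k x * pdv i p x)" "integrable lborel (\<lambda>x. eigenfun k x * p x)"
proof -
  note p = test_functionD[OF assms]
  obtain K where K: "compact K" "\<And>x. x \<notin> K \<Longrightarrow> p x = 0" using p(4) by blast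
  have int: "integrable lborel (\<lambda>x. eigenfun l x * pdv i p x)" "integrable lborel (\<lambda>x. eigenfun l x * p x)" for l
    by (rule continuous_compact_support(1)[OF _ K(1)],
        auto intro!: continuous_on_mult continuous_eigenfun p simp: K(2) pdv_vanishes_outside_support[OF assms K])+
  from int show "integrable lborel (\<lambda>x. eigenfun k x * pdv i p x)" "integrable lborel (\<lambda>x. eigenfun k x * p x)" by auto
  have "(LINT x|lborel. eigenfun k x * pdv i p x + - eigenfun (raise i k) x * p x) = 0"
  proof (rule LINT_pdv_eq_0[where w = "\<lambda>x. eigenfun k x * p x" and i = i, OF _ _ _ K(1)])
    fix x
    from DERIV_mult[OF eigenfun_line_deriv[of k x i] p(1)[of x i]]
    show "((\<lambda>s. eigenfun k (x + s *\<^sub>R axis i 1) * p (x + s *\<^sub>R axis i 1)) has_real_derivative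
        eigenfun k x * pdv i p x + - eigenfun (raise i k) x * p x) (at 0)"
      by (simp add: raise_def algebra_simps)
    show "continuous_on UNIV (\<lambda>x. eigenfun k x * pdv i p x + - eigenfun (raise i k) x * p x)"
      "continuous_on UNIV (\<lambda>x. eigenfun k x * p x)"
      by (intro continuous_on_add continuous_on_mult continuous_on_minus continuous_eigenfun p)+
  qed (simp add: K(2))
  then show "(LINT x|lborel. eigenfun k x * pdv i p x) = (LINT x|lborel. eigenfun (raise i k) x * p x)"
    using int(1)[of k] int(2)[of "raise i k"] by simp
qed

lemma eigenfun_norm_upd: "eigenfun_norm (k(i := m)) = pi * hermite_norm m * (\<Prod>j\<in>UNIV - {i}. pi * hermite_norm (k j))"
  unfolding eigenfun_norm_def by (subst prod.remove[of _ i]) (auto intro!: prod.cong)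

lemma eigenfun_norm_raise: "eigenfun_norm (raise i k) = 2 * real (Suc (k i)) * eigenfun_norm k"
  using eigenfun_norm_upd[of k i "k i"] by (simp add: raise_def eigenfun_norm_upd hermite_norm_Suc)

text \<open>
  If \<open>k\<^sub>i = 0\<close>, the truncated index in \<^const>\<open>lower\<close> is harmless because of the factor \<open>k\<^sub>i\<close>.
\<close>

lemma lowering: "2 * x $ i * eigenfun k x - eigenfun (raise i k) x = 2 * real (k i) * eigenfun (lower i k) x"
proof -
  have "2 * x $ i * hermite_fun n (x $ i) - hermite_fun (Suc n) (x $ i) = 2 * real n * hermite_fun (n - 1) (x $ i)" for n
    by (cases n) (simp_all add: hermite_fun_rec hermite_fun_0 hermite_fun_1)
  then have "(2 * x $ i * hermite_fun (k i) (x $ i) - hermite_fun (Suc (k i)) (x $ i)) * c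
      = 2 * real (k i) * hermite_fun (k i - 1) (x $ i) * c" for c by metis
  from this[of "\<Prod>j\<in>UNIV - {i}. hermite_fun (k j) (x $ j)"] show ?thesis
    using eigenfun_split[of k i "k i" x]
    by (simp add: raise_def lower_def eigenfun_split left_diff_distrib mult.assoc)
qed

text \<open>
  The functions \<open>\<partial>\<^sub>i e\<^sub>k\<close>.
\<close>

lemma raise_family:
  "orthogonal_family inv_gauss (\<lambda>k x. - eigenfun (raise i k) x) (\<lambda>k. 2 * real (Suc (k i)) * eigenfun_norm k)"
proof
  have inj: "raise i k = raise i l \<longleftrightarrow> k = l" for k l :: "'a \<Rightarrow> nat"
    unfolding raise_def fun_eq_iff by (metis fun_upd_apply nat.inject)
  show "(LINT x|inv_gauss. - eigenfun (raise i k) x * - eigenfun (raise i l) x)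
      = (if k = l then 2 * real (Suc (k i)) * eigenfun_norm k else 0)" for k l
    by (simp add: eigenfun_orthogonal inj eigenfun_norm_raise)
  show "integrable inv_gauss (\<lambda>x. - eigenfun (raise i k) x * - eigenfun (raise i l) x)" for k l
    by (simp add: eigenfun_orthogonal)
qed simp

text \<open>
  The functions \<open>(\<partial>\<^sub>i + 2 x\<^sub>i) e\<^sub>k\<close>. Those with \<open>k\<^sub>i = 0\<close> vanish, and on the others \<^const>\<open>lower\<close> is
  injective.
\<close>

lemma lower_family:
  "orthogonal_family inv_gauss (\<lambda>k x. 2 * real (k i) * eigenfun (lower i k) x) (\<lambda>k. 2 * real (k i) * eigenfun_norm k)"
proof
  show "integrable inv_gauss (\<lambda>x. 2 * real (k i) * eigenfun (lower i k) x * (2 * real (l i) * eigenfun (lower i l) x))" for k l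
    using integrable_mult_right[OF eigenfun_orthogonal(1)[of "lower i k" "lower i l"], of "2 * real (k i) * (2 * real (l i))"]
    by (simp add: mult_ac)
  show "(LINT x|inv_gauss. 2 * real (k i) * eigenfun (lower i k) x * (2 * real (l i) * eigenfun (lower i l) x))
      = (if k = l then 2 * real (k i) * eigenfun_norm k else 0)" for k l
  proof -
    have "(LINT x|inv_gauss. 2 * real (k i) * eigenfun (lower i k) x * (2 * real (l i) * eigenfun (lower i l) x))
        = (LINT x|inv_gauss. (2 * real (k i) * (2 * real (l i))) * (eigenfun (lower i k) x * eigenfun (lower i l) x))"
      by (simp add: mult_ac)
    also have "\<dots> = 2 * real (k i) * (2 * real (l i)) * (if lower i k = lower i l then eigenfun_norm (lower i k) else 0)"
      by (simp only: integral_mult_right_zero eigenfun_orthogonal)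
    also have "\<dots> = (if k = l then 2 * real (k i) * eigenfun_norm k else 0)"
    proof (cases "k i = 0 \<or> l i = 0")
      case False
      then have k: "raise i (lower i k) = k" and l: "raise i (lower i l) = l"
        by (auto simp: raise_def lower_def)
      then have "lower i k = lower i l \<longleftrightarrow> k = l" by metis
      moreover have "eigenfun_norm k = 2 * real (k i) * eigenfun_norm (lower i k)"
        using eigenfun_norm_raise[of i "lower i k"] False unfolding k by (simp add: lower_def)
      ultimately show ?thesis by (cases "k = l") auto
    qed auto
    finally show ?thesis .
  qed
qed simp

lemma eigenval_ge: "eigenval k \<ge> 2 * real (k i) + 2"
proof -
  have "real (k i) \<le> real (\<Sum>j\<in>UNIV. k j)" by (rule of_nat_mono) (rule member_le_sum, auto)
  moreover have "real CARD('a) \<ge> 1" by (simp add: Suc_leI)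
  ultimately show ?thesis unfolding eigenval_def by linarith
qed

text \<open>
  The expansion of \<open>A\<^bsup>-1/2\<^esup> f\<close> and its image under \<open>\<partial>\<^sub>i\<close> converge almost everywhere along a common
  subsequence of index sets; then so does the image under \<open>\<partial>\<^sub>i + 2 x\<^sub>i\<close>, and Fatou's lemma bounds its
  limit without a separate construction.
\<close>

theorem riesz_construction:
  fixes f :: "real ^ 'n \<Rightarrow> complex"
  assumes f: "f \<in> L2"
  obtains F D where "spectral (\<lambda>l. l powr (- 1 / 2)) f F" "weak_pdv i F D"
    "F \<in> borel_measurable borel" "D \<in> borel_measurable borel"
    "norm2 D \<le> norm2 f" "norm2 (\<lambda>x. D x + of_real (2 * x $ i) * F x) \<le> norm2 f"
proof -
  interpret up: orthogonal_family inv_gauss "\<lambda>k x. - eigenfun (raise i k) x" "\<lambda>k. 2 * real (Suc (k i)) * eigenfun_norm k"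
    by (rule raise_family)
  interpret down: orthogonal_family inv_gauss "\<lambda>k x. 2 * real (k i) * eigenfun (lower i k) x" "\<lambda>k. 2 * real (k i) * eigenfun_norm k"
    by (rule lower_family)
  define a where "a k = of_real (eigenval k powr (- 1 / 2)) * coefficient k f" for k
  let ?c = "\<lambda>k. coefficient k f"
  have ev: "eigenval k \<ge> 1" for k :: "'n \<Rightarrow> nat"
    by (rule order_trans[OF _ eigenval_ge[of k i]]) simp
  have powr_sq: "(eigenval k powr (- 1 / 2))\<^sup>2 = 1 / eigenval k" for k :: "'n \<Rightarrow> nat"
    using ev[of k] by (simp add: power2_eq_square powr_minus_divide flip: powr_add)
  have a_sq: "(cmod (a k))\<^sup>2 * (\<mu> * eigenfun_norm k) \<le> eig.weight ?c k" if "0 \<le> \<mu>" "\<mu> \<le> eigenval k" for k \<mu>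
  proof -
    have "(cmod (a k))\<^sup>2 * (\<mu> * eigenfun_norm k) = \<mu> / eigenval k * eig.weight ?c k"
      unfolding a_def norm_mult power_mult_distrib norm_of_real power2_abs powr_sq eig.weight_def by simp
    also have "\<dots> \<le> 1 * eig.weight ?c k"
      using that ev[of k] by (intro mult_right_mono) auto
    finally show ?thesis by simp
  qed
  have w_eig: "eig.weight a k \<le> eig.weight ?c k" for k
    using a_sq[of 1 k] ev[of k] by (simp add: eig.weight_def)
  have w_up: "up.weight a k \<le> eig.weight ?c k" for k
    unfolding up.weight_def by (rule a_sq) (use eigenval_ge[of k i] in auto)
  have w_down: "down.weight a k \<le> eig.weight ?c k" for k
    unfolding down.weight_def by (rule a_sq) (use eigenval_ge[of k i] in auto)
  note s_eig = weight_multiplier[OF f w_eig eig.weight_nonneg]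
  note s_up = weight_multiplier[OF f w_up up.weight_nonneg]
  note s_down = weight_multiplier[OF f w_down down.weight_nonneg]
  obtain r F where r: "strict_mono r" and F [measurable]: "F \<in> borel_measurable borel"
    and limF: "AE x in inv_gauss. (\<lambda>n. eig.comb (below (r n)) a x) \<longlonglongrightarrow> F x"
    using eig.Riesz_Fischer[OF s_eig(1) finite_below filterlim_below] by auto
  have below_r: "filterlim (\<lambda>n. below (r n) :: ('n \<Rightarrow> nat) set) (finite_subsets_at_top UNIV) sequentially"
    by (rule filterlim_compose[OF filterlim_below filterlim_subseq[OF r]])
  \<comment> \<open>A second extraction, from the subsequence already found for \<open>F\<close>.\<close>
  obtain r' D where r': "strict_mono r'" and D [measurable]: "D \<in> borel_measurable borel"
    and limD: "AE x in inv_gauss. (\<lambda>n. up.comb (below (r (r' n))) a x) \<longlonglongrightarrow> D x"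
    using up.Riesz_Fischer[OF s_up(1) finite_below below_r] by auto
  define K where "K n = (below (r (r' n)) :: ('n \<Rightarrow> nat) set)" for n
  have K: "finite (K n)" for n by (simp add: K_def)
  have K_top: "filterlim K (finite_subsets_at_top UNIV) sequentially"
    unfolding K_def[abs_def] by (rule filterlim_compose[OF below_r filterlim_subseq[OF r']])
  have limF': "AE x in inv_gauss. (\<lambda>n. eig.comb (K n) a x) \<longlonglongrightarrow> F x"
    using limF
  proof eventually_elim
    case (elim x)
    from LIMSEQ_subseq_LIMSEQ[OF this r'] show ?case by (simp add: comp_def K_def)
  qed
  have limD': "AE x in inv_gauss. (\<lambda>n. up.comb (K n) a x) \<longlonglongrightarrow> D x"
    using limD by (simp add: K_def)
  have powr_le: "\<bar>eigenval k powr (- 1 / 2)\<bar> \<le> 1" for k :: "'n \<Rightarrow> nat"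
    using ev[of k] powr_mono[of "- 1 / 2" 0 "eigenval k"] by simp
  note F_spectral = spectralI[where \<phi> = "\<lambda>l. l powr (- 1 / 2)",
      OF f powr_le F finite_below below_r limF[unfolded a_def]]
  have "norm2 D \<le> ennreal (infsum (up.weight a) UNIV)"
    by (rule up.sqnorm_limit_le[OF s_up(1) K K_top _ limD']) simp
  with s_up(2) have normD: "norm2 D \<le> norm2 f" by simp
  have down_eq: "up.comb (K n) a x + of_real (2 * x $ i) * eig.comb (K n) a x = down.comb (K n) a x" for n x
  proof -
    have "up.comb (K n) a x + of_real (2 * x $ i) * eig.comb (K n) a x
        = (\<Sum>k\<in>K n. a k * of_real (2 * x $ i * eigenfun k x - eigenfun (raise i k) x))"
      unfolding up.comb_def eig.comb_def sum_distrib_left sum.distrib[symmetric]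
      by (intro sum.cong refl) (simp add: algebra_simps)
    then show ?thesis unfolding lowering down.comb_def .
  qed
  have "AE x in inv_gauss. (\<lambda>n. down.comb (K n) a x) \<longlonglongrightarrow> D x + of_real (2 * x $ i) * F x"
    using limF' limD'
  proof eventually_elim
    case (elim x)
    from tendsto_add[OF elim(2) tendsto_mult_left[OF elim(1), of "of_real (2 * x $ i)"]]
    show ?case unfolding down_eq .
  qed
  then have "norm2 (\<lambda>x. D x + of_real (2 * x $ i) * F x) \<le> ennreal (infsum (down.weight a) UNIV)"
    by (intro down.sqnorm_limit_le[OF s_down(1) K K_top]) simp_all
  with s_down(2) have normA: "norm2 (\<lambda>x. D x + of_real (2 * x $ i) * F x) \<le> norm2 f" by simp
  have L2: "F \<in> L2" "D \<in> L2"
    using F_spectral(2) normD f by (auto simp: L2_iff)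
  have L2_comb: "eig.comb (K n) a \<in> L2" "up.comb (K n) a \<in> L2" for n
    using eig.comb_measurable[of "K n" a] up.comb_measurable[of "K n" a]
    by (auto simp: L2_iff eig.sqnorm_comb[OF K] up.sqnorm_comb[OF K])
  have L2lim: "(\<lambda>n. norm2 (\<lambda>x. F x - eig.comb (K n) a x)) \<longlonglongrightarrow> 0"
    "(\<lambda>n. norm2 (\<lambda>x. D x - up.comb (K n) a x)) \<longlonglongrightarrow> 0"
    by (rule filterlim_compose[OF eig.comb_tendsto_limit[OF s_eig(1) K K_top _ limF'] K_top], simp,
        rule filterlim_compose[OF up.comb_tendsto_limit[OF s_up(1) K K_top _ limD'] K_top], simp)
  have "(LINT x|lborel. F x * of_real (pdv i p x)) = - (LINT x|lborel. D x * of_real (p x))"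
    if p: "test_function p" for p
  proof -
    note tp = test_functionD[OF p]
    obtain S where S: "compact S" "\<And>x. x \<notin> S \<Longrightarrow> p x = 0" using tp(4) by blast
    obtain B where B: "\<And>x. \<bar>p x\<bar> \<le> B" using continuous_compact_support(2)[OF tp(2) S] by blast
    obtain B' where B': "\<And>x. \<bar>pdv i p x\<bar> \<le> B'"
      using continuous_compact_support(2)[OF tp(3) S(1) pdv_vanishes_outside_support[OF p S]] by blast
    have parts: "(LINT x|lborel. eig.comb (K n) a x * of_real (pdv i p x)) = - (LINT x|lborel. up.comb (K n) a x * of_real (p x))" for n
    proof -
      have i1: "integrable lborel (\<lambda>x. complex_of_real (eigenfun k x * pdv i p x))" 
        and i2: "integrable lborel (\<lambda>x. complex_of_real (eigenfun k x * p x))" for k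
        unfolding complex_of_real_integrable_eq using eigenfun_parts[OF p] by auto
      have "(LINT x|lborel. eig.comb (K n) a x * of_real (pdv i p x))
          = (LINT x|lborel. (\<Sum>k\<in>K n. a k * complex_of_real (eigenfun k x * pdv i p x)))"
        by (simp add: eig.comb_def sum_distrib_right mult.assoc)
      also have "\<dots> = (\<Sum>k\<in>K n. a k * complex_of_real (LINT x|lborel. eigenfun k x * pdv i p x))"
        unfolding integral_complex_of_real[symmetric]
        by (subst Bochner_Integration.integral_sum) (auto intro!: i1 integrable_mult_right simp del: of_real_mult)
      also have "\<dots> = (\<Sum>k\<in>K n. a k * complex_of_real (LINT x|lborel. eigenfun (raise i k) x * p x))"
        by (simp add: eigenfun_parts(1)[OF p])
      also have "\<dots> = (LINT x|lborel. (\<Sum>k\<in>K n. a k * complex_of_real (eigenfun (raise i k) x * p x)))"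
        unfolding integral_complex_of_real[symmetric]
        by (subst Bochner_Integration.integral_sum) (auto intro!: i2 integrable_mult_right simp del: of_real_mult)
      also have "\<dots> = (LINT x|lborel. - (up.comb (K n) a x * of_real (p x)))"
        by (simp add: up.comb_def sum_distrib_right mult.assoc sum_negf)
      finally show ?thesis by simp
    qed
    have [measurable]: "p \<in> borel_measurable borel" "pdv i p \<in> borel_measurable borel"
      using tp by (auto intro: borel_measurable_continuous_onI)
    have "(\<lambda>n. LINT x|lborel. eig.comb (K n) a x * of_real (pdv i p x)) \<longlonglongrightarrow> (LINT x|lborel. F x * of_real (pdv i p x))"
      by (rule norm2_limit_imp_integral_limit(2)[OF L2_comb(1) L2(1) L2lim(1) _ B']) simp
    moreover have "(\<lambda>n. LINT x|lborel. up.comb (K n) a x * of_real (p x)) \<longlonglongrightarrow> (LINT x|lborel. D x * of_real (p x))"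
      by (rule norm2_limit_imp_integral_limit(2)[OF L2_comb(2) L2(2) L2lim(2) _ B]) simp
    then have "(\<lambda>n. LINT x|lborel. eig.comb (K n) a x * of_real (pdv i p x)) \<longlonglongrightarrow> - (LINT x|lborel. D x * of_real (p x))"
      unfolding parts by (rule tendsto_minus)
    ultimately show ?thesis by (rule LIMSEQ_unique)
  qed
  then have "weak_pdv i F D" unfolding weak_pdv_def using L2 by (simp add: L2_loc_integrable)
  with F_spectral(1) show thesis using that F D normD normA by blast
qed

theorem riesz_bounded: "L2_bounded (riesz i)" "L2_bounded (riesz_adj i)"
proof -
  show "L2_bounded (riesz i)"
  proof (rule L2_boundedI[of 1])
    fix f :: "real ^ 'a \<Rightarrow> complex" assume "f \<in> L2"
    then show "\<exists>g. riesz i f g \<and> g \<in> borel_measurable borel \<and> sqnorm inv_gauss g \<le> ennreal (1\<^sup>2) * norm2 f"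
    proof (rule riesz_construction[of f i])
      fix F D assume *: "spectral (\<lambda>l. l powr (- 1 / 2)) f F" "weak_pdv i F D" "D \<in> borel_measurable borel" "norm2 D \<le> norm2 f"
      then show ?thesis unfolding riesz_def by (intro exI[of _ "modulus D"]) auto
    qed
  qed simp
  show "L2_bounded (riesz_adj i)"
  proof (rule L2_boundedI[of 1])
    fix f :: "real ^ 'a \<Rightarrow> complex" assume "f \<in> L2"
    then show "\<exists>g. riesz_adj i f g \<and> g \<in> borel_measurable borel \<and> sqnorm inv_gauss g \<le> ennreal (1\<^sup>2) * norm2 f"
    proof (rule riesz_construction[of f i])
      fix F D assume *: "spectral (\<lambda>l. l powr (- 1 / 2)) f F" "weak_pdv i F D"
        "norm2 (\<lambda>x. D x + of_real (2 * x $ i) * F x) \<le> norm2 f"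
        and [measurable]: "F \<in> borel_measurable borel" "D \<in> borel_measurable borel"
      have "modulus (\<lambda>x. D x + of_real (2 * x $ i) * F x) \<in> borel_measurable borel" by measurable
      with * show ?thesis unfolding riesz_adj_def
        by (intro exI[of _ "modulus (\<lambda>x. D x + of_real (2 * x $ i) * F x)"]) auto
    qed
  qed simp
qed

theorem theorem1p6:
  shows "L2_bounded (maximal_op :: (real ^ 'n \<Rightarrow> complex) \<Rightarrow> (real ^ 'n \<Rightarrow> ennreal) \<Rightarrow> bool)
    \<and> (\<forall>i::'n. L2_bounded (riesz i) \<and> L2_bounded (riesz_adj i))
    \<and> L2_bounded (square_function :: (real ^ 'n \<Rightarrow> complex) \<Rightarrow> (real ^ 'n \<Rightarrow> ennreal) \<Rightarrow> bool)"
  using maximal_op_bounded square_function_bounded riesz_bounded by blast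

end
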